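(* Let $1\le p\le\infty$ and $n\in\mathbb N=\{0,1,2,\dots\}$. Then the nontangential boundary value map $F\mapsto F_l$ defines an isometric isomorphism from $H_n^p(\mathbb C^+)$ onto $H_n^p(\mathbb R)$.
   Context: $\mathbb C^+=\{z\in\mathbb C:\operatorname{Im} z>0\}$. For $1\le p<\infty$, $H^p(\mathbb C^+)$ is the space of holomorphic $F$ on $\mathbb C^+$ with $\|F\|_{H^p}=\sup_{y>0}\left(\int_{\mathbb R}|F(x+iy)|^p\,dx\right)^{1/p}<\infty$; $H^\infty(\mathbb C^+)$ is the space of bounded holomorphic functions with the sup norm. Every $F\in H^p(\mathbb C^+)$, $1\le p\le\infty$, has a nontangential boundary value $F_l(x)$ at almost every $x\in\mathbb R$. $H_n^p(\mathbb C^+)$ is the space of holomorphic $F$ on $\mathbb C^+$ with $F^{(k)}\in H^p(\mathbb C^+)$ for $k=0,1,\dots,n$, with norm $\|F\|_{H_n^p}=\left(\sum_{k=0}^n\|F^{(k)}\|_{H^p}^p\right)^{1/p}$ if $1\le p<\infty$ and $\|F\|_{H_n^\infty}=\sum_{k=0}^n\|F^{(k)}\|_{H^\infty}$ if $p=\infty$. For $1\le p<\infty$, $H^p(\mathbb R)$ is the set of $f\in L^p(\mathbb R)$ that are nontangential boundary values of functions in $H^p(\mathbb C^+)$; equivalently, of those $f\in L^p(\mathbb R)$ with $\int_{\mathbb R}\frac{f(x)}{x-\overline z}\,dx=0$ for all $z\in\mathbb C^+$. For $p=\infty$, $H^\infty(\mathbb R)=\{f\in L^\infty(\mathbb R):\int_{\mathbb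 R}\frac{f(x)}{(x-\overline z)(x+i)}\,dx=0\ \forall z\in\mathbb C^+\}$. $W_n^p(\mathbb R)$ is the Sobolev space of $f\in L^p(\mathbb R)$ whose weak derivatives $D^{(k)}f$, $k=1,\dots,n$, exist and lie in $L^p(\mathbb R)$, with norm $\left(\sum_{k=0}^n\|D^{(k)}f\|_{L^p}^p\right)^{1/p}$ if $p<\infty$ and $\sum_{k=0}^n\|D^{(k)}f\|_{L^\infty}$ if $p=\infty$; $W_0^p(\mathbb R)=L^p(\mathbb R)$. Finally $H_n^p(\mathbb R)=H^p(\mathbb R)\cap W_n^p(\mathbb R)$ with the norm of $W_n^p(\mathbb R)$. *)

theory Defs
  imports "HOL-Analysis.Analysis" "HOL-Probability.Essential_Supremum"
begin

text \<open>
  Exponents are extended nonnegative reals \<open>p\<close>, used only for \<open>1 \<le> p\<close>; the real exponent for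
  finite \<open>p\<close> is \<open>enn2real p\<close>.  Elements of the function spaces are represented by total
  functions: on the line two of them denote the same element if they agree almost everywhere, and
  on the half-plane if they agree at every point of the half-plane.  The norms are real-valued and
  are meaningful on the corresponding spaces only.
\<close>

definition upper_half_plane :: "complex set" where
  "upper_half_plane = {z. Im z > 0}"


subsection \<open>Lebesgue spaces on the real line\<close>

definition Lp_space :: "ennreal \<Rightarrow> (real \<Rightarrow> complex) set" where
  "Lp_space p = {f \<in> borel_measurable lebesgue.
     if p = \<infinity> then esssup lebesgue (\<lambda>x. ennreal (norm (f x))) < \<infinity>
     else integrable lebesgue (\<lambda>x. norm (f x) powr enn2real p)}"

definition Lp_norm :: "ennreal \<Rightarrow> (real \<Rightarrow> complex) \<Rightarrow> real" where
  "Lp_norm p f =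
     (if p = \<infinity> then enn2real (esssup lebesgue (\<lambda>x. ennreal (norm (f x))))
      else (LINT x|lebesgue. norm (f x) powr enn2real p) powr (1 / enn2real p))"

text \<open>The norm of a tuple \<open>(f\<^sub>0, \<dots>, f\<^sub>n)\<close> whose entries have norms \<open>a 0, \<dots>, a n\<close>.  For \<open>p = \<infinity>\<close>
  this is the sum and not the maximum.\<close>

definition combined_norm :: "ennreal \<Rightarrow> nat \<Rightarrow> (nat \<Rightarrow> real) \<Rightarrow> real" where
  "combined_norm p n a =
     (if p = \<infinity> then (\<Sum>k\<le>n. a k)
      else (\<Sum>k\<le>n. a k powr enn2real p) powr (1 / enn2real p))"


subsection \<open>Hardy and Hardy--Sobolev spaces on the upper half-plane\<close>

definition Hardy :: "ennreal \<Rightarrow> (complex \<Rightarrow> complex) set" where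
  "Hardy p = {F. F holomorphic_on upper_half_plane \<and>
     (if p = \<infinity> then bounded (F ` upper_half_plane)
      else (\<forall>y>0. (\<lambda>x. F (Complex x y)) \<in> Lp_space p) \<and>
           bdd_above ((\<lambda>y. Lp_norm p (\<lambda>x. F (Complex x y))) ` {0<..}))}"

definition Hardy_norm :: "ennreal \<Rightarrow> (complex \<Rightarrow> complex) \<Rightarrow> real" where
  "Hardy_norm p F =
     (if p = \<infinity> then (SUP z\<in>upper_half_plane. norm (F z))
      else (SUP y\<in>{0<..}. Lp_norm p (\<lambda>x. F (Complex x y))))"

definition Hardy_Sobolev :: "nat \<Rightarrow> ennreal \<Rightarrow> (complex \<Rightarrow> complex) set" where
  "Hardy_Sobolev n p =
     {F. F holomorphic_on upper_half_plane \<and> (\<forall>k\<le>n. (deriv ^^ k) F \<in> Hardy p)}"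

definition Hardy_Sobolev_norm :: "nat \<Rightarrow> ennreal \<Rightarrow> (complex \<Rightarrow> complex) \<Rightarrow> real" where
  "Hardy_Sobolev_norm n p F = combined_norm p n (\<lambda>k. Hardy_norm p ((deriv ^^ k) F))"


subsection \<open>Nontangential boundary values\<close>

definition cone :: "real \<Rightarrow> real \<Rightarrow> complex set" where
  "cone a x = {z. Im z > 0 \<and> \<bar>Re z - x\<bar> < a * Im z}"

text \<open>The limit has to exist, with the same value, within cones of every aperture.\<close>

definition has_nontangential_limit :: "(complex \<Rightarrow> complex) \<Rightarrow> real \<Rightarrow> complex \<Rightarrow> bool" where
  "has_nontangential_limit F x L \<longleftrightarrow>
     (\<forall>a>0. (F \<longlongrightarrow> L) (at (complex_of_real x) within cone a x))"

text \<open>The value is unspecified at points where there is no nontangential limit.\<close>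

definition boundary_value :: "(complex \<Rightarrow> complex) \<Rightarrow> real \<Rightarrow> complex" where
  "boundary_value F x = (THE L. has_nontangential_limit F x L)"


subsection \<open>Sobolev spaces on the real line\<close>

definition test_function :: "(real \<Rightarrow> real) \<Rightarrow> bool" where
  "test_function \<phi> \<longleftrightarrow>
     (\<forall>k x. (deriv ^^ k) \<phi> field_differentiable at x) \<and> compact (closure {x. \<phi> x \<noteq> 0})"

definition locally_integrable :: "(real \<Rightarrow> complex) \<Rightarrow> bool" where
  "locally_integrable f \<longleftrightarrow> (\<forall>a b. set_integrable lebesgue {a..b} f)"

definition has_weak_deriv :: "nat \<Rightarrow> (real \<Rightarrow> complex) \<Rightarrow> (real \<Rightarrow> complex) \<Rightarrow> bool" where
  "has_weak_deriv k f g \<longleftrightarrow> locally_integrable f \<and> locally_integrable g \<and>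
     (\<forall>\<phi>. test_function \<phi> \<longrightarrow>
        (LINT x|lebesgue. f x * of_real ((deriv ^^ k) \<phi> x)) =
        (-1) ^ k * (LINT x|lebesgue. g x * of_real (\<phi> x)))"

text \<open>A weak derivative is unique up to null sets, so that the choice is immaterial.\<close>

definition weak_deriv :: "nat \<Rightarrow> (real \<Rightarrow> complex) \<Rightarrow> real \<Rightarrow> complex" where
  "weak_deriv k f = (if k = 0 then f else (SOME g. has_weak_deriv k f g))"

definition Sobolev :: "nat \<Rightarrow> ennreal \<Rightarrow> (real \<Rightarrow> complex) set" where
  "Sobolev n p = {f \<in> Lp_space p. \<forall>k\<in>{1..n}. \<exists>g\<in>Lp_space p. has_weak_deriv k f g}"

definition Sobolev_norm :: "nat \<Rightarrow> ennreal \<Rightarrow> (real \<Rightarrow> complex) \<Rightarrow> real" where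
  "Sobolev_norm n p f = combined_norm p n (\<lambda>k. Lp_norm p (weak_deriv k f))"


subsection \<open>Hardy and Hardy--Sobolev spaces on the real line\<close>

definition Hardy_real :: "ennreal \<Rightarrow> (real \<Rightarrow> complex) set" where
  "Hardy_real p = {f \<in> Lp_space p.
     if p = \<infinity> then
       (\<forall>z\<in>upper_half_plane.
          (LINT x|lebesgue. f x / ((of_real x - cnj z) * (of_real x + \<i>))) = 0)
     else (\<exists>F\<in>Hardy p. AE x in lebesgue. has_nontangential_limit F x (f x))}"

text \<open>The norm of this space is \<open>Sobolev_norm n p\<close>.\<close>

definition Hardy_Sobolev_real :: "nat \<Rightarrow> ennreal \<Rightarrow> (real \<Rightarrow> complex) set" where
  "Hardy_Sobolev_real n p = Hardy_real p \<inter> Sobolev n p"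

end

theory Submission
  imports Defs "HOL-Complex_Analysis.Complex_Analysis" "HOL-Probability.Sinc_Integral" "HOL-Real_Asymp.Real_Asymp"
begin

text \<open>
  Everything rests on the claim that each \<open>F\<close> in a Hardy space is the Poisson integral of its
  nontangential boundary values.  Dividing by \<open>(z + \<i>)\<^sup>2\<close> reduces this to exponent 1.  There \<open>F\<close>
  is a product of two functions of exponent 2: \<open>sqrt \<bar>F\<bar>\<close> has a majorant that is the Poisson
  integral of a square integrable \<open>w\<close>, hence the real part of a holomorphic \<open>\<Phi>\<close> of exponent 2, and
  \<open>F = (F / \<Phi>) \<Phi>\<close>.  In exponent 2 the horizontal restrictions form a Cauchy family by an
  orthogonality argument, so those of \<open>F\<close> converge in the mean, and the maximal inequality turns this
  into nontangential convergence.  Contractivity of the Poisson integral and Fatou's lemma give the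
  equality of norms.  Weak derivatives on the line and complex derivatives in the half-plane
  correspond because the Poisson kernel commutes with translations.
\<close>

section \<open>The Poisson kernel\<close>

text \<open>In exponent 1 a bounded family has weak limits only among measures, so compactness does
  not produce a boundary function. Convergence in the mean has to be proved, and it is also what
  lets the Poisson formula pass to the limit. In exponent 2 it comes from the Hilbert space
  structure, and a product of two such functions inherits it; hence the search for a factorization.
  No zeros are divided out: it is enough that the second factor has no zeros and is at least
  \<open>sqrt (cmod (F z))\<close> in modulus. The Poisson formula is first proved for functions
  holomorphic across the real axis and bounded above it. Upward shifts of \<open>F\<close> are of
  this kind by a Cauchy estimate, and statements about \<open>F\<close> are limits of statements
  about its shifts. The weight \<open>(z + \<i>)\<^sup>2\<close> matches the decay of the Poisson
  kernel, so that the single class \<open>poisson_integrable\<close> serves all exponents, infinity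
  included, and the arguments on derivatives do not mention the exponent.\<close>

lemma continuous_imp_lebesgue_measurable:
  fixes f :: "real \<Rightarrow> 'a::topological_space"
  assumes "continuous_on UNIV f"
  shows "f \<in> borel_measurable lebesgue"
  using borel_measurable_continuous_onI[OF assms] by (intro measurable_completion) simp

lemma ident_lebesgue_measurable [measurable]: "(\<lambda>x::real. x) \<in> borel_measurable lebesgue"
  by (intro continuous_imp_lebesgue_measurable continuous_intros)

lemma of_real_lebesgue_measurable: "complex_of_real \<in> borel_measurable lebesgue"
  by (intro continuous_imp_lebesgue_measurable continuous_intros)

lemma integrable_inverse_1_plus_square_lebesgue: "integrable lebesgue (\<lambda>t::real. 1 / (1 + t\<^sup>2))"
proof -
  have "integrable lborel (\<lambda>t::real. inverse (1 + t\<^sup>2))"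
    using integrable_inverse_1_plus_square by (simp add: set_integrable_def)
  then show ?thesis by (simp add: integrable_completion inverse_eq_divide)
qed

lemma cmod_of_real_plus_i_square: "(cmod (of_real t + \<i>))\<^sup>2 = 1 + t\<^sup>2"
  by (simp add: cmod_def)

definition poisson :: "complex \<Rightarrow> real \<Rightarrow> real" where
  "poisson z t = Im z / (pi * (cmod (of_real t - z))\<^sup>2)"

text \<open>At \<open>z = \<i>\<close> the Poisson kernel is
  \<open>1 / (pi * (1 + t\<^sup>2))\<close>, and at every other point it is bounded by a multiple of
  this (\<open>poisson_le\<close>). Hence this is the class of measurable functions whose Poisson
  integrals converge absolutely at every point of the half-plane.\<close>

definition poisson_integrable :: "(real \<Rightarrow> 'a::{banach,second_countable_topology}) \<Rightarrow> bool" where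
  "poisson_integrable f \<longleftrightarrow>
     f \<in> borel_measurable lebesgue \<and> integrable lebesgue (\<lambda>t. norm (f t) / (1 + t\<^sup>2))"

definition poisson_int :: "(real \<Rightarrow> 'a::{banach,second_countable_topology}) \<Rightarrow> complex \<Rightarrow> 'a" where
  "poisson_int f z = (LINT t|lebesgue. poisson z t *\<^sub>R f t)"

text \<open>Comparison constant for \<open>kernel_bound\<close>: write
  \<open>of_real t + \<i>\<close> as \<open>(of_real t - z) + (z + \<i>)\<close> and estimate the
  second summand by means of \<open>Im z \<le> cmod (of_real t - z)\<close>.\<close>

definition kernel_const :: "complex \<Rightarrow> real" where
  "kernel_const z = 1 + cmod (z + \<i>) / Im z"

lemma kernel_const_ge1: "0 < Im z \<Longrightarrow> 1 \<le> kernel_const z"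
  by (simp add: kernel_const_def)

lemma cmod_of_real_diff_ge: "0 < Im z \<Longrightarrow> Im z \<le> cmod (of_real t - z)"
  using abs_Im_le_cmod[of "of_real t - z"] by simp

lemma of_real_diff_nonzero: "0 < Im z \<Longrightarrow> of_real t - z \<noteq> 0"
  by (auto simp: complex_eq_iff)

lemma of_real_diff_cnj_nonzero: "0 < Im z \<Longrightarrow> of_real t - cnj z \<noteq> 0"
  by (auto simp: complex_eq_iff)

lemma kernel_bound:
  assumes "0 < Im z"
  shows "cmod (of_real t + \<i>) \<le> kernel_const z * cmod (of_real t - z)"
proof -
  have "cmod (of_real t + \<i>) \<le> cmod (of_real t - z) + cmod (z + \<i>)"
    using norm_triangle_ineq[of "of_real t - z" "z + \<i>"] by simp
  also have "cmod (z + \<i>) \<le> cmod (z + \<i>) / Im z * cmod (of_real t - z)"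
    using mult_left_mono[OF cmod_of_real_diff_ge[OF assms, of t], of "cmod (z + \<i>) / Im z"] assms
    by simp
  finally show ?thesis by (simp add: kernel_const_def algebra_simps)
qed

lemma kernel_bound_square:
  assumes "0 < Im z"
  shows "1 / (cmod (of_real t - z))\<^sup>2 \<le> (kernel_const z)\<^sup>2 / (1 + t\<^sup>2)"
proof -
  have "1 + t\<^sup>2 \<le> (kernel_const z)\<^sup>2 * (cmod (of_real t - z))\<^sup>2"
    using power_mono[OF kernel_bound[OF assms, of t], of 2]
    by (simp add: cmod_of_real_plus_i_square power_mult_distrib)
  moreover have "0 < cmod (of_real t - z)" using of_real_diff_nonzero[OF assms] by simp
  moreover have "0 < 1 + t\<^sup>2" by (simp add: add_pos_nonneg)
  ultimately show ?thesis by (simp add: divide_simps mult.commute)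
qed

lemma poisson_nonneg: "0 < Im z \<Longrightarrow> 0 \<le> poisson z t"
  by (simp add: poisson_def)

lemma poisson_le:
  assumes "0 < Im z"
  shows "poisson z t \<le> Im z * (kernel_const z)\<^sup>2 / pi * (1 / (1 + t\<^sup>2))"
proof -
  have "poisson z t = Im z / pi * (1 / (cmod (of_real t - z))\<^sup>2)" by (simp add: poisson_def)
  also have "\<dots> \<le> Im z / pi * ((kernel_const z)\<^sup>2 / (1 + t\<^sup>2))"
    using assms by (intro mult_left_mono kernel_bound_square) auto
  finally show ?thesis by simp
qed

lemma poisson_swap: "poisson (Complex x y) t = poisson (Complex t y) x"
  by (simp add: poisson_def cmod_def power2_commute)

lemma poisson_measurable [measurable]: "poisson z \<in> borel_measurable lebesgue"
  unfolding poisson_def by measurable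

lemma integrable_poisson_bound:
  fixes f :: "real \<Rightarrow> 'a::{banach,second_countable_topology}"
    and g :: "real \<Rightarrow> 'b::{banach,second_countable_topology}"
  assumes "poisson_integrable f" "g \<in> borel_measurable lebesgue"
    and "\<And>t. norm (g t) \<le> C * (norm (f t) / (1 + t\<^sup>2))"
  shows "integrable lebesgue g"
proof (rule Bochner_Integration.integrable_bound)
  show "integrable lebesgue (\<lambda>t. C * (norm (f t) / (1 + t\<^sup>2)))"
    using assms(1) unfolding poisson_integrable_def by (intro integrable_mult_right) auto
  show "AE t in lebesgue. norm (g t) \<le> norm (C * (norm (f t) / (1 + t\<^sup>2)))"
    using assms(3) by (intro AE_I2) (metis abs_ge_self order_trans real_norm_def)
qed (use assms in auto)

lemma poisson_integrable_measurable: "poisson_integrable f \<Longrightarrow> f \<in> borel_measurable lebesgue"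
  by (simp add: poisson_integrable_def)

lemma integrable_poisson:
  assumes "poisson_integrable f" "0 < Im z"
  shows "integrable lebesgue (\<lambda>t. poisson z t *\<^sub>R f t)"
proof (rule integrable_poisson_bound[OF assms(1)])
  show "(\<lambda>t. poisson z t *\<^sub>R f t) \<in> borel_measurable lebesgue"
    using poisson_integrable_measurable[OF assms(1)] by measurable
  fix t show "norm (poisson z t *\<^sub>R f t) \<le> Im z * (kernel_const z)\<^sup>2 / pi * (norm (f t) / (1 + t\<^sup>2))"
    using mult_right_mono[OF poisson_le[OF assms(2), of t], of "norm (f t)"] poisson_nonneg[OF assms(2)]
    by (simp add: algebra_simps)
qed

lemma poisson_integrable_bounded:
  assumes "f \<in> borel_measurable lebesgue" "\<And>t. norm (f t) \<le> B"
  shows "poisson_integrable f"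
  unfolding poisson_integrable_def
proof
  show "integrable lebesgue (\<lambda>t. norm (f t) / (1 + t\<^sup>2))"
  proof (rule Bochner_Integration.integrable_bound)
    show "integrable lebesgue (\<lambda>t::real. B * (1 / (1 + t\<^sup>2)))"
      using integrable_inverse_1_plus_square_lebesgue by (intro integrable_mult_right) auto
    show "(\<lambda>t. norm (f t) / (1 + t\<^sup>2)) \<in> borel_measurable lebesgue" using assms(1) by measurable
    have "0 \<le> B" using assms(2) norm_ge_zero order_trans by blast
    then show "AE t in lebesgue. norm (norm (f t) / (1 + t\<^sup>2)) \<le> norm (B * (1 / (1 + t\<^sup>2)))"
      using assms(2) by (intro AE_I2) (simp add: divide_right_mono)
  qed
qed fact

lemma integrable_imp_poisson_integrable:
  assumes "integrable lebesgue f" shows "poisson_integrable f"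
  unfolding poisson_integrable_def
proof
  show m: "f \<in> borel_measurable lebesgue" using assms by auto
  show "integrable lebesgue (\<lambda>t. norm (f t) / (1 + t\<^sup>2))"
  proof (rule Bochner_Integration.integrable_bound[OF integrable_norm[OF assms]])
    show "(\<lambda>t. norm (f t) / (1 + t\<^sup>2)) \<in> borel_measurable lebesgue" using m by measurable
    show "AE t in lebesgue. norm (norm (f t) / (1 + t\<^sup>2)) \<le> norm (norm (f t))"
      by (intro AE_I2) (simp add: divide_le_eq add_pos_nonneg mult_le_cancel_left1)
  qed
qed

section \<open>Cauchy's formula on rectangles and the Poisson formula for bounded functions\<close>

lemma rectpath_contour_integral:
  fixes f :: "complex \<Rightarrow> complex"
  assumes "continuous_on (path_image (rectpath a c)) f" "Re a \<le> Re c" "Im a \<le> Im c"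
  defines "b \<equiv> Complex (Re c) (Im a)" and "d \<equiv> Complex (Re a) (Im c)"
  shows "contour_integral (rectpath a c) f = contour_integral (linepath a b) f
     + contour_integral (linepath b c) f + contour_integral (linepath c d) f + contour_integral (linepath d a) f"
proof -
  have pim: "path_image (rectpath a c) = closed_segment a b \<union> closed_segment b c \<union> closed_segment c d \<union> closed_segment d a"
    by (simp add: rectpath_def Let_def path_image_join b_def d_def Un_assoc)
  have "f contour_integrable_on linepath a b" "f contour_integrable_on linepath b c"
    "f contour_integrable_on linepath c d" "f contour_integrable_on linepath d a"
    by (rule contour_integrable_continuous_linepath, rule continuous_on_subset[OF assms(1)], use pim in auto)+
  then show ?thesis
    by (simp add: rectpath_def Let_def b_def[symmetric] d_def[symmetric] add.assoc)
qed

lemma tendsto_LINT_symmetric_intervals: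
  fixes f :: "real \<Rightarrow> 'a::{banach,second_countable_topology}"
  assumes "integrable lebesgue f"
  shows "(\<lambda>n. LINT t:{- real n..real n}|lebesgue. f t) \<longlonglongrightarrow> (LINT t|lebesgue. f t)"
  unfolding set_lebesgue_integral_def
proof (rule integral_dominated_convergence[where w="\<lambda>t. norm (f t)"])
  show "AE t in lebesgue. (\<lambda>n. indicat_real {- real n..real n} t *\<^sub>R f t) \<longlonglongrightarrow> f t"
  proof (intro AE_I2)
    fix t :: real
    have "\<forall>\<^sub>F n in sequentially. \<bar>t\<bar> \<le> real n"
      using real_arch_simple[of "\<bar>t\<bar>"] by (meson eventually_sequentiallyI le_trans of_nat_le_iff order_trans)
    then have "\<forall>\<^sub>F n in sequentially. indicat_real {- real n..real n} t *\<^sub>R f t = f t"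
      by eventually_elim (auto simp: indicator_def abs_le_iff)
    then show "(\<lambda>n. indicat_real {- real n..real n} t *\<^sub>R f t) \<longlonglongrightarrow> f t"
      by (rule tendsto_eventually)
  qed
qed (use assms in \<open>auto simp: indicator_def\<close>)

lemma poisson_cauchy_kernel:
  assumes "0 < Im z"
  shows "of_real (poisson z t) = (1 / (of_real t - z) - 1 / (of_real t - cnj z)) / (2 * pi * \<i>)"
proof -
  have "(of_real t - z) * (of_real t - cnj z) = of_real ((cmod (of_real t - z))\<^sup>2)"
    using complex_norm_square[of "of_real t - z"] by simp
  moreover have "z - cnj z = 2 * \<i> * Im z" by (simp add: complex_diff_cnj)
  ultimately show ?thesis
    using of_real_diff_nonzero[OF assms, of t] of_real_diff_cnj_nonzero[OF assms, of t]
    by (simp add: poisson_def divide_simps)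
qed

text \<open>Cauchy's formula is applied not to \<open>F\<close> but to \<open>h\<close>, which
  agrees with \<open>F\<close> at \<open>z\<close> and carries the extra factor
  \<open>(z - cnj z) / (w - cnj z)\<close>. On the real line this factor turns the Cauchy kernel
  into \<open>2 * pi * \<i>\<close> times the Poisson kernel; on the other three sides of the
  contour it supplies a second power of decay, so that boundedness of \<open>F\<close> suffices to
  make them vanish in the limit. Holomorphy slightly below the axis allows the contour to run along
  the axis itself.\<close>

theorem poisson_formula:
  fixes F :: "complex \<Rightarrow> complex"
  assumes e: "0 < e" and hol: "F holomorphic_on {z. - e < Im z}"
    and bd: "\<And>z. 0 \<le> Im z \<Longrightarrow> cmod (F z) \<le> B" and z: "0 < Im z"
  shows "F z = poisson_int (\<lambda>t. F (of_real t)) z"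
proof -
  define y where "y = Im z"
  have y: "y > 0" using z y_def by simp
  define h where "h \<equiv> (\<lambda>w. F w * (z - cnj z) / (w - cnj z))"
  define g where "g \<equiv> (\<lambda>w. h w / (w - z))"
  have B: "0 \<le> B" using order_trans[OF norm_ge_zero bd[of 0]] by simp
  \<comment> \<open>\<open>S\<close> stays above both the boundary of the domain of \<open>F\<close>
    and the pole \<open>cnj z\<close> of \<open>h\<close>, which lies at height
    \<open>- y\<close>.\<close>
  define S where "S = {w. - min e y < Im w}"
  have convS: "convex S" unfolding S_def by (rule convex_halfspace_Im_gt)
  have openS: "open S" unfolding S_def by (rule open_halfspace_Im_gt)
  have zS: "z \<in> S" using y e by (auto simp: S_def y_def min_def)
  have nz: "w - cnj z \<noteq> 0" if "w \<in> S" for w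
    using that by (auto simp: S_def y_def complex_eq_iff)
  have holh: "h holomorphic_on S" unfolding h_def
    by (intro holomorphic_intros holomorphic_on_subset[OF hol]) (use nz in \<open>auto simp: S_def\<close>)
  have hz: "h z = F z"
    using nz[OF zS] by (simp add: h_def)
  have cont: "continuous_on UNIV (\<lambda>t. F (of_real t))"
    by (rule continuous_on_compose2[OF holomorphic_on_imp_continuous_on[OF hol]])
       (use e in \<open>auto intro!: continuous_intros\<close>)
  have pint: "poisson_integrable (\<lambda>t. F (of_real t))"
    by (rule poisson_integrable_bounded[OF continuous_imp_lebesgue_measurable[OF cont], of B]) (auto intro: bd)
  have greal: "g (of_real t) = 2 * pi * \<i> * (poisson z t *\<^sub>R F (of_real t))" for t
    using of_real_diff_nonzero[OF z, of t] of_real_diff_cnj_nonzero[OF z, of t]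
    unfolding scaleR_conv_of_real poisson_cauchy_kernel[OF z]
    by (simp add: g_def h_def divide_simps)
  have gint: "integrable lebesgue (\<lambda>t. g (of_real t))"
    unfolding greal by (rule integrable_mult_right[OF integrable_poisson[OF pint z]])
  \<comment> \<open>\<open>E R\<close> is the contribution of the three sides off the real axis of
    the rectangle over \<open>{-R..R}\<close> of height \<open>R\<close>: their total length is
    \<open>4 * R\<close>, and the integrand is of the order of the inverse square of
    \<open>R\<close>.\<close>
  define E where "E R = 2 * pi * \<i> * F z - (LINT t:{-R..R}|lebesgue. g (of_real t))" for R :: real
  have bound: "cmod (E R) \<le> 4 * R * (B * (2 * y) / (R - cmod z)\<^sup>2)" if R: "R > cmod z" for R
  proof -
    define a b c d where "a = Complex (-R) 0" and "b = Complex R 0" and "c = Complex R R" and "d = Complex (-R) R"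
    have R0: "R > 0" using R norm_ge_zero[of z] by linarith
    have zin: "z \<in> box a c"
      using R z abs_Re_le_cmod[of z] abs_Im_le_cmod[of z] by (auto simp: in_box_complex_iff a_def c_def)
    have pim: "path_image (rectpath a c) = cbox a c - box a c"
      by (rule path_image_rectpath_cbox_minus_box) (use R0 in \<open>auto simp: a_def c_def\<close>)
    have cboxS: "cbox a c \<subseteq> S" using e y by (auto simp: in_cbox_complex_iff a_def c_def S_def)
    have sub: "path_image (rectpath a c) \<subseteq> S - {z}" using pim cboxS zin by auto
    have "(g has_contour_integral (2 * pi * \<i> * winding_number (rectpath a c) z * h z)) (rectpath a c)"
      unfolding g_def
      by (rule Cauchy_integral_formula_convex_simple[OF convS holh])
         (use zS openS sub in \<open>auto simp: interior_open\<close>)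
    then have tot: "contour_integral (rectpath a c) g = 2 * pi * \<i> * F z"
      using winding_number_rectpath[OF zin] by (simp add: hz contour_integral_unique)
    have contg: "continuous_on (S - {z}) g" unfolding g_def
      using holomorphic_on_imp_continuous_on[OF holh]
      by (intro continuous_intros) (auto intro: continuous_on_subset)
    have split: "contour_integral (rectpath a c) g = contour_integral (linepath a b) g
       + contour_integral (linepath b c) g + contour_integral (linepath c d) g + contour_integral (linepath d a) g"
      using rectpath_contour_integral[of a c g] continuous_on_subset[OF contg sub] R0
      by (simp add: a_def b_def c_def d_def)
    have segs: "path_image (rectpath a c) = closed_segment a b \<union> closed_segment b c \<union> closed_segment c d \<union> closed_segment d a"
      by (simp add: rectpath_def Let_def path_image_join a_def b_def c_def d_def Un_assoc)
    have gb: "cmod (g w) \<le> B * (2 * y) / (R - cmod z)\<^sup>2" if "R \<le> cmod w" "0 \<le> Im w" for w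
    proof -
      have 1: "R - cmod z \<le> cmod (w - z)" "R - cmod z \<le> cmod (w - cnj z)"
        using that norm_triangle_ineq2[of w z] norm_triangle_ineq2[of w "cnj z"] by auto
      have 2: "cmod (z - cnj z) = 2 * y" using y by (simp add: complex_diff_cnj norm_mult y_def)
      have "cmod (g w) = cmod (F w) * (2 * y) / (cmod (w - cnj z) * cmod (w - z))"
        by (simp add: g_def h_def norm_mult norm_divide 2)
      also have "\<dots> \<le> B * (2 * y) / ((R - cmod z) * (R - cmod z))"
        using 1 R y B bd[OF that(2)] by (intro frac_le mult_mono mult_nonneg_nonneg mult_pos_pos) auto
      finally show ?thesis by (simp add: power2_eq_square)
    qed
    have c_int: "g contour_integrable_on linepath b c" "g contour_integrable_on linepath c d" "g contour_integrable_on linepath d a"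
      by (rule contour_integrable_continuous_linepath, rule continuous_on_subset[OF contg], use segs sub in auto)+
    have K0: "0 \<le> B * (2 * y) / (R - cmod z)\<^sup>2" using B y by simp
    have "cmod (contour_integral (linepath b c) g) \<le> B * (2 * y) / (R - cmod z)\<^sup>2 * cmod (c - b)"
    proof (rule contour_integral_bound_linepath[OF c_int(1) K0])
      fix w assume "w \<in> closed_segment b c"
      then have "Re w = R" "0 \<le> Im w" using R0 
        by (auto simp: closed_segment_def b_def c_def) (simp add: algebra_simps)
      then show "cmod (g w) \<le> B * (2 * y) / (R - cmod z)\<^sup>2"
        using gb abs_Re_le_cmod[of w] R0 by auto
    qed
    moreover have "cmod (contour_integral (linepath c d) g) \<le> B * (2 * y) / (R - cmod z)\<^sup>2 * cmod (d - c)"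
    proof (rule contour_integral_bound_linepath[OF c_int(2) K0])
      fix w assume "w \<in> closed_segment c d"
      then have "Im w = R" using R0 
        by (auto simp: closed_segment_def d_def c_def) (simp add: algebra_simps)
      then show "cmod (g w) \<le> B * (2 * y) / (R - cmod z)\<^sup>2"
        using gb abs_Im_le_cmod[of w] R0 by auto
    qed
    moreover have "cmod (contour_integral (linepath d a) g) \<le> B * (2 * y) / (R - cmod z)\<^sup>2 * cmod (a - d)"
    proof (rule contour_integral_bound_linepath[OF c_int(3) K0])
      fix w assume "w \<in> closed_segment d a"
      then have "Re w = -R" "0 \<le> Im w" using R0 
        by (auto simp: closed_segment_def a_def d_def) (simp add: algebra_simps)
      then show "cmod (g w) \<le> B * (2 * y) / (R - cmod z)\<^sup>2"
        using gb abs_Re_le_cmod[of w] R0 by auto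
    qed
    moreover have "cmod (c - b) = R" "cmod (d - c) = 2 * R" "cmod (a - d) = R"
      using R0 by (auto simp: a_def b_def c_def d_def cmod_def real_sqrt_mult)
    moreover have "contour_integral (linepath a b) g = (LINT t:{-R..R}|lebesgue. g (of_real t))"
    proof -
      have "contour_integral (linepath a b) g = integral {-R..R} (\<lambda>t. g (of_real t))"
        using contour_integral_linepath_Reals_eq[of a b g] R0 
        by (simp add: a_def b_def complex_is_Real_iff)
      also have "\<dots> = (LINT t:{-R..R}|lebesgue. g (of_real t))"
      proof (rule set_lebesgue_integral_eq_integral(2)[symmetric])
        show "set_integrable lebesgue {-R..R} (\<lambda>t. g (of_real t))"
          unfolding set_integrable_def by (intro integrable_mult_indicator gint) auto
      qed
      finally show ?thesis .
    qed
    moreover have "cmod (E R) \<le> B * (2 * y) / (R - cmod z)\<^sup>2 * cmod (c - b)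
        + B * (2 * y) / (R - cmod z)\<^sup>2 * cmod (d - c) + B * (2 * y) / (R - cmod z)\<^sup>2 * cmod (a - d)"
    proof -
      have "E R = contour_integral (linepath b c) g + contour_integral (linepath c d) g + contour_integral (linepath d a) g"
        using tot split calculation(7) by (simp add: E_def algebra_simps)
      then show ?thesis using calculation(1-3) by (auto intro!: norm_triangle_mono)
    qed
    ultimately have "cmod (E R) \<le> B * (2 * y) / (R - cmod z)\<^sup>2 * R + B * (2 * y) / (R - cmod z)\<^sup>2 * (2 * R) + B * (2 * y) / (R - cmod z)\<^sup>2 * R"
      by metis
    then show ?thesis by (simp add: algebra_simps)
  qed
  have "(\<lambda>n. 4 * real n * (B * (2 * y) / (real n - cmod z)\<^sup>2)) \<longlonglongrightarrow> 0"
    by real_asymp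
  then have "(\<lambda>n. E (real n)) \<longlonglongrightarrow> 0"
  proof (rule Lim_null_comparison[rotated])
    show "\<forall>\<^sub>F n in sequentially. norm (E (real n)) \<le> 4 * real n * (B * (2 * y) / (real n - cmod z)\<^sup>2)"
      using filterlim_real_sequentially[unfolded filterlim_at_top_dense, rule_format, of "cmod z"]
      by eventually_elim (use bound in auto)
  qed
  moreover have "(\<lambda>n. E (real n)) \<longlonglongrightarrow> 2 * pi * \<i> * F z - (LINT t|lebesgue. g (of_real t))"
    unfolding E_def
    by (intro tendsto_intros tendsto_LINT_symmetric_intervals)
       (rule gint)
  ultimately have "2 * pi * \<i> * F z = (LINT t|lebesgue. g (of_real t))"
    using LIMSEQ_unique by fastforce
  also have "\<dots> = 2 * pi * \<i> * poisson_int (\<lambda>t. F (of_real t)) z"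
    unfolding greal poisson_int_def by (rule integral_mult_right_zero)
  finally show ?thesis by simp
qed

section \<open>Poisson integrals: total mass, Jensen's inequality, contractivity\<close>

lemma sigma_finite_lebesgue: "sigma_finite_measure (lebesgue :: real measure)"
proof
  show "\<exists>A. countable A \<and> A \<subseteq> sets lebesgue \<and> \<Union> A = space (lebesgue :: real measure) \<and> (\<forall>a\<in>A. emeasure lebesgue a \<noteq> \<infinity>)"
  proof (intro exI[of _ "range (\<lambda>n::nat. {- real n..real n})"] conjI)
    show "\<Union> (range (\<lambda>n::nat. {- real n..real n})) = space lebesgue"
    proof (auto)
      fix x :: real
      obtain n :: nat where "\<bar>x\<bar> \<le> real n" using real_arch_simple by blast
      then show "\<exists>n. - real n \<le> x \<and> x \<le> real n" by (intro exI[of _ n]) auto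
    qed
  qed auto
qed

interpretation lebesgue_pair: pair_sigma_finite "lebesgue :: real measure" "lebesgue :: real measure"
  using sigma_finite_lebesgue by (simp add: pair_sigma_finite_def)

lemma poisson_Complex: "poisson (Complex x y) t = y / (pi * ((t - x)\<^sup>2 + y\<^sup>2))"
  by (simp add: poisson_def cmod_def power2_commute)

lemma poisson_pair_measurable [measurable]:
  "(\<lambda>p. poisson (Complex (fst p) y) (snd p)) \<in> borel_measurable (lebesgue \<Otimes>\<^sub>M lebesgue)"
  unfolding poisson_Complex by measurable

lemma poisson_pair_measurable' [measurable]:
  "(\<lambda>p. poisson (Complex (snd p) y) (fst p)) \<in> borel_measurable (lebesgue \<Otimes>\<^sub>M lebesgue)"
  unfolding poisson_Complex by measurable

text \<open>The total mass is the Poisson formula for the constant function 1, read backwards; no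
  primitive of the kernel is computed.\<close>

lemma integral_poisson:
  assumes "0 < Im z"
  shows "(LINT t|lebesgue. poisson z t) = 1"
proof -
  have "(\<lambda>_. 1 :: complex) z = poisson_int (\<lambda>t. 1) z"
    by (rule poisson_formula[where e = 1 and B = 1]) (use assms in auto)
  then have "1 = (LINT t|lebesgue. of_real (poisson z t) :: complex)"
    by (simp add: poisson_int_def scaleR_conv_of_real)
  then show ?thesis by (metis integral_complex_of_real of_real_eq_1_iff)
qed

lemma integrable_poisson_kernel: "0 < Im z \<Longrightarrow> integrable lebesgue (poisson z)"
  using integrable_poisson[OF poisson_integrable_bounded[of "\<lambda>_. 1::real" 1]] by auto

lemma nn_integral_poisson:
  assumes "0 < Im z" shows "(\<integral>\<^sup>+t. ennreal (poisson z t) \<partial>lebesgue) = 1"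
  using integral_poisson[OF assms] integrable_poisson_kernel[OF assms] poisson_nonneg[OF assms]
  by (simp add: nn_integral_eq_integral)

lemma poisson_int_const: "0 < Im z \<Longrightarrow> poisson_int (\<lambda>_. c) z = c"
  using integral_poisson[of z] integrable_poisson_kernel[of z] by (simp add: poisson_int_def)

lemma poisson_integrable_add:
  fixes f g :: "real \<Rightarrow> 'a::{banach,second_countable_topology}"
  assumes "poisson_integrable f" "poisson_integrable g" shows "poisson_integrable (\<lambda>t. f t + g t)"
  unfolding poisson_integrable_def
proof
  show m: "(\<lambda>t. f t + g t) \<in> borel_measurable lebesgue"
    using assms unfolding poisson_integrable_def by (intro borel_measurable_add) auto
  show "integrable lebesgue (\<lambda>t. norm (f t + g t) / (1 + t\<^sup>2))"
  proof (rule Bochner_Integration.integrable_bound)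
    show "integrable lebesgue (\<lambda>t. norm (f t) / (1 + t\<^sup>2) + norm (g t) / (1 + t\<^sup>2))"
      using assms by (simp add: poisson_integrable_def)
    show "(\<lambda>t. norm (f t + g t) / (1 + t\<^sup>2)) \<in> borel_measurable lebesgue" using m by measurable
    show "AE t in lebesgue. norm (norm (f t + g t) / (1 + t\<^sup>2)) \<le> norm (norm (f t) / (1 + t\<^sup>2) + norm (g t) / (1 + t\<^sup>2))"
      by (intro AE_I2) (simp add: add_divide_distrib[symmetric] divide_right_mono norm_triangle_ineq)
  qed
qed

lemma poisson_integrable_scale:
  fixes f :: "real \<Rightarrow> 'a::{banach,second_countable_topology,real_normed_algebra}"
  assumes "poisson_integrable f" shows "poisson_integrable (\<lambda>t. c * f t)"
  unfolding poisson_integrable_def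
proof
  have "f \<in> borel_measurable lebesgue" using assms by (simp add: poisson_integrable_def)
  then show m: "(\<lambda>t. c * f t) \<in> borel_measurable lebesgue" by measurable
  have i: "integrable lebesgue (\<lambda>t. norm c * (norm (f t) / (1 + t\<^sup>2)))"
    using assms unfolding poisson_integrable_def by (intro integrable_mult_right) auto
  have m2: "(\<lambda>t. norm (c * f t) / (1 + t\<^sup>2)) \<in> borel_measurable lebesgue" using m by measurable
  have "norm (norm (c * f t) / (1 + t\<^sup>2)) \<le> norm (norm c * (norm (f t) / (1 + t\<^sup>2)))" for t
    by (simp add: divide_right_mono norm_mult_ineq)
  then show "integrable lebesgue (\<lambda>t. norm (c * f t) / (1 + t\<^sup>2))"
    using Bochner_Integration.integrable_bound[OF i m2] by blast
qed

lemma poisson_integrable_diff: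
  fixes f g :: "real \<Rightarrow> complex"
  assumes "poisson_integrable f" "poisson_integrable g" shows "poisson_integrable (\<lambda>t. f t - g t)"
  using poisson_integrable_add[OF assms(1) poisson_integrable_scale[OF assms(2), of "-1"]] by simp

lemma poisson_int_diff:
  assumes "poisson_integrable f" "poisson_integrable g" "0 < Im z"
  shows "poisson_int (\<lambda>t. f t - g t) z = poisson_int f z - poisson_int g z"
  unfolding poisson_int_def scaleR_diff_right
  by (rule Bochner_Integration.integral_diff[OF integrable_poisson[OF assms(1,3)] integrable_poisson[OF assms(2,3)]])

lemma poisson_integrable_norm:
  fixes f :: "real \<Rightarrow> 'a::{banach,second_countable_topology}"
  assumes "poisson_integrable f" shows "poisson_integrable (\<lambda>t. norm (f t))"
  using assms by (auto simp: poisson_integrable_def)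

lemma poisson_int_nonneg:
  fixes f :: "real \<Rightarrow> real"
  assumes "0 < Im z" "\<And>t. 0 \<le> f t" shows "0 \<le> poisson_int f z"
  unfolding poisson_int_def using assms poisson_nonneg by (intro Bochner_Integration.integral_nonneg) auto

lemma norm_poisson_int_le:
  fixes f :: "real \<Rightarrow> 'a::{banach,second_countable_topology}"
  assumes "0 < Im z"
  shows "norm (poisson_int f z) \<le> poisson_int (\<lambda>t. norm (f t)) z"
proof -
  have "norm (poisson_int f z) \<le> (LINT t|lebesgue. norm (poisson z t *\<^sub>R f t))"
    unfolding poisson_int_def by (rule integral_norm_bound)
  also have "\<dots> = poisson_int (\<lambda>t. norm (f t)) z"
    unfolding poisson_int_def using poisson_nonneg[OF assms] by (intro Bochner_Integration.integral_cong) auto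
  finally show ?thesis .
qed

lemma norm_integral_le_AE:
  fixes f :: "'b \<Rightarrow> 'a::{banach,second_countable_topology}"
  assumes "integrable M f" "integrable M g" "AE x in M. norm (f x) \<le> g x"
  shows "norm (integral\<^sup>L M f) \<le> integral\<^sup>L M g"
  using integral_norm_bound[of M f] integral_mono_AE[OF integrable_norm[OF assms(1)] assms(2,3)] by linarith

lemma norm_poisson_int_bounded:
  fixes f :: "real \<Rightarrow> 'a::{banach,second_countable_topology}"
  assumes z: "0 < Im z" and m: "f \<in> borel_measurable lebesgue" and B: "AE t in lebesgue. norm (f t) \<le> B"
  shows "norm (poisson_int f z) \<le> B"
proof -
  have i: "integrable lebesgue (\<lambda>t. poisson z t * B)"
    using integrable_poisson_kernel[OF z] by simp
  have le: "AE t in lebesgue. norm (poisson z t *\<^sub>R f t) \<le> poisson z t * B"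
    using B by eventually_elim (use poisson_nonneg[OF z] in \<open>auto intro!: mult_left_mono\<close>)
  have "norm (poisson_int f z) \<le> (LINT t|lebesgue. poisson z t * B)"
    unfolding poisson_int_def
  proof (rule norm_integral_le_AE[OF _ i le])
    show "integrable lebesgue (\<lambda>t. poisson z t *\<^sub>R f t)"
    proof (rule Bochner_Integration.integrable_bound[OF i])
      show "(\<lambda>t. poisson z t *\<^sub>R f t) \<in> borel_measurable lebesgue" using m by measurable
      show "AE t in lebesgue. norm (poisson z t *\<^sub>R f t) \<le> norm (poisson z t * B)"
        using le by eventually_elim auto
    qed
  qed
  also have "\<dots> = B" using integral_poisson[OF z] integrable_poisson_kernel[OF z] by simp
  finally show ?thesis .
qed

text \<open>The supporting line at \<open>m\<close> of a convex power. The cases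
  \<open>m = 0\<close> and \<open>a = 0\<close> are treated apart because the convexity argument
  runs on the open half-line; at \<open>m = 0\<close> the left side collapses, since
  \<open>powr\<close> with base 0 is 0.\<close>

lemma powr_tangent:
  fixes a m p :: real
  assumes "1 \<le> p" "0 \<le> a" "0 \<le> m"
  shows "m powr p + p * m powr (p - 1) * (a - m) \<le> a powr p"
proof (cases "m = 0")
  case True then show ?thesis using assms by simp
next
  case False
  then have m: "m > 0" using assms by simp
  show ?thesis
  proof (cases "a = 0")
    case True
    have "m powr p + p * m powr (p - 1) * (a - m) = (1 - p) * m powr p"
      using m True by (simp add: powr_diff algebra_simps)
    also have "\<dots> \<le> 0" using assms by (simp add: mult_nonpos_nonneg)
    finally show ?thesis using True assms by simp
  next
    case False
    have "p * m powr (p - 1) * (a - m) \<le> a powr p - m powr p"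
    proof (rule convex_on_imp_above_tangent[where A = "{0<..}"])
      show "convex_on {0<..} (\<lambda>x::real. x powr p)"
        using convex_on_subset[OF powr_convex[OF assms(1)], of "{0<..}"] by auto
      show "((\<lambda>x. x powr p) has_real_derivative p * m powr (p - 1)) (at m within {0<..})"
        using m by (auto intro!: derivative_eq_intros simp: powr_diff)
    qed (use m False assms in \<open>auto simp: interior_open\<close>)
    then show ?thesis by simp
  qed
qed

text \<open>Integrate the supporting line at the mean \<open>m\<close> of \<open>norm (f t)\<close>
  against the probability density \<open>poisson z\<close>; its linear term integrates to 0. The
  right side is kept as a nonnegative integral that may be infinite, so that it can be integrated
  once more in the point without integrability conditions.\<close>

lemma poisson_jensen:
  fixes f :: "real \<Rightarrow> 'a::{banach,second_countable_topology}"
  assumes z: "0 < Im z" and p: "1 \<le> p" and f: "poisson_integrable f"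
  shows "ennreal (norm (poisson_int f z) powr p) \<le> (\<integral>\<^sup>+t. ennreal (poisson z t * norm (f t) powr p) \<partial>lebesgue)"
proof (cases "(\<integral>\<^sup>+t. ennreal (poisson z t * norm (f t) powr p) \<partial>lebesgue) = \<infinity>")
  case False
  have [measurable]: "f \<in> borel_measurable lebesgue" using f by (simp add: poisson_integrable_def)
  have int: "integrable lebesgue (\<lambda>t. poisson z t * norm (f t) powr p)"
    using False poisson_nonneg[OF z] by (intro integrableI_nonneg) (auto simp: less_top)
  define m where "m = poisson_int (\<lambda>t. norm (f t)) z"
  have m0: "0 \<le> m" unfolding m_def by (rule poisson_int_nonneg[OF z]) simp
  have ki: "integrable lebesgue (poisson z)" by (rule integrable_poisson_kernel[OF z])
  have fi: "integrable lebesgue (\<lambda>t. poisson z t * norm (f t))"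
    using integrable_poisson[OF poisson_integrable_norm[OF f] z] by simp
  have "m powr p = (LINT t|lebesgue. poisson z t * (m powr p - p * m powr (p - 1) * m) + p * m powr (p - 1) * (poisson z t * norm (f t)))"
    using ki fi integral_poisson[OF z] by (simp add: m_def poisson_int_def)
  also have "\<dots> \<le> (LINT t|lebesgue. poisson z t * norm (f t) powr p)"
  proof (rule integral_mono)
    fix t
    have "poisson z t * (m powr p + p * m powr (p - 1) * (norm (f t) - m)) \<le> poisson z t * norm (f t) powr p"
      by (intro mult_left_mono powr_tangent p m0 poisson_nonneg[OF z]) auto
    then show "poisson z t * (m powr p - p * m powr (p - 1) * m) + p * m powr (p - 1) * (poisson z t * norm (f t)) \<le> poisson z t * norm (f t) powr p"
      by (simp add: algebra_simps)
  qed (use ki fi int in auto)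
  finally have "m powr p \<le> (LINT t|lebesgue. poisson z t * norm (f t) powr p)" .
  moreover have "norm (poisson_int f z) powr p \<le> m powr p"
    unfolding m_def using norm_poisson_int_le[OF z] p by (intro powr_mono2) auto
  ultimately have "norm (poisson_int f z) powr p \<le> (LINT t|lebesgue. poisson z t * norm (f t) powr p)" by linarith
  then show ?thesis
    using int poisson_nonneg[OF z] by (subst nn_integral_eq_integral) (auto intro: ennreal_leI)
qed simp

text \<open>Jensen's inequality at each point, then Tonelli: by \<open>poisson_swap\<close> the
  kernel also has mass 1 as a function of \<open>x\<close>.\<close>

lemma poisson_int_Lp_contraction:
  fixes f :: "real \<Rightarrow> 'a::{banach,second_countable_topology}"
  assumes y: "0 < y" and p: "1 \<le> p" and f: "poisson_integrable f"
  shows "(\<integral>\<^sup>+x. ennreal (norm (poisson_int f (Complex x y)) powr p) \<partial>lebesgue) \<le> (\<integral>\<^sup>+t. ennreal (norm (f t) powr p) \<partial>lebesgue)"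
proof -
  have [measurable]: "f \<in> borel_measurable lebesgue" using f by (simp add: poisson_integrable_def)
  have "(\<integral>\<^sup>+x. ennreal (norm (poisson_int f (Complex x y)) powr p) \<partial>lebesgue)
      \<le> (\<integral>\<^sup>+x. (\<integral>\<^sup>+t. ennreal (poisson (Complex x y) t * norm (f t) powr p) \<partial>lebesgue) \<partial>lebesgue)"
    by (intro nn_integral_mono poisson_jensen p f) (use y in auto)
  also have "\<dots> = (\<integral>\<^sup>+t. (\<integral>\<^sup>+x. ennreal (poisson (Complex x y) t * norm (f t) powr p) \<partial>lebesgue) \<partial>lebesgue)"
    by (rule lebesgue_pair.Fubini'[symmetric]) (unfold case_prod_beta, measurable)
  also have "\<dots> = (\<integral>\<^sup>+t. ennreal (norm (f t) powr p) \<partial>lebesgue)"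
  proof (rule nn_integral_cong)
    fix t
    have "(\<integral>\<^sup>+x. ennreal (poisson (Complex x y) t * norm (f t) powr p) \<partial>lebesgue)
       = (\<integral>\<^sup>+x. ennreal (poisson (Complex t y) x) * ennreal (norm (f t) powr p) \<partial>lebesgue)"
      by (intro nn_integral_cong) (use poisson_nonneg[of "Complex t y"] y in \<open>simp add: poisson_swap[of _ y t] ennreal_mult\<close>)
    also have "\<dots> = ennreal (norm (f t) powr p)"
      using nn_integral_poisson[of "Complex t y"] y by (subst nn_integral_multc) auto
    finally show "(\<integral>\<^sup>+x. ennreal (poisson (Complex x y) t * norm (f t) powr p) \<partial>lebesgue) = ennreal (norm (f t) powr p)" .
  qed
  finally show ?thesis .
qed

text \<open>The Poisson formula at \<open>\<i>\<close> for \<open>K\<close>. Its extra factor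
  vanishes at \<open>\<i>\<close>, while on the real line it equals \<open>1 + t\<^sup>2\<close>,
  which cancels the Poisson kernel at \<open>\<i>\<close> and leaves \<open>H\<close>. The quadratic
  decay of \<open>H\<close> makes \<open>K\<close> bounded.\<close>

lemma cauchy_vanishing:
  fixes H :: "complex \<Rightarrow> complex"
  assumes e: "0 < e" and hol: "H holomorphic_on {z. - e < Im z}"
    and bd: "\<And>z. 0 \<le> Im z \<Longrightarrow> cmod (H z) \<le> C / (cmod (z + \<i>))\<^sup>2"
  shows "(LINT t|lebesgue. H (of_real t)) = 0"
proof -
  define K where "K = (\<lambda>z. H z * ((z - \<i>) * (z + \<i>)))"
  have C0: "0 \<le> C" using order_trans[OF norm_ge_zero bd[of 0]] by simp
  have "K \<i> = poisson_int (\<lambda>t. K (of_real t)) \<i>"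
  proof (rule poisson_formula[OF e])
    show "K holomorphic_on {z. - e < Im z}" unfolding K_def by (intro holomorphic_intros hol)
    fix z assume z: "0 \<le> Im z"
    have nz: "z + \<i> \<noteq> 0" using z by (auto simp: complex_eq_iff)
    have le: "cmod (z - \<i>) \<le> cmod (z + \<i>)"
    proof -
      have "(Im z - 1)\<^sup>2 \<le> (Im z + 1)\<^sup>2" using z by (simp add: power2_eq_square algebra_simps)
      then show ?thesis by (simp add: cmod_def)
    qed
    have "cmod (K z) = cmod (H z) * (cmod (z - \<i>) * cmod (z + \<i>))" by (simp add: K_def norm_mult)
    also have "\<dots> \<le> C / (cmod (z + \<i>))\<^sup>2 * (cmod (z + \<i>) * cmod (z + \<i>))"
      using bd[OF z] le C0 by (intro mult_mono) auto
    also have "\<dots> = C" using nz by (simp add: power2_eq_square)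
    finally show "cmod (K z) \<le> C" .
  qed auto
  moreover have "poisson \<i> t *\<^sub>R K (of_real t) = (1 / pi) *\<^sub>R H (of_real t)" for t
  proof -
    have "(of_real t - \<i>) * (of_real t + \<i>) = complex_of_real (1 + t\<^sup>2)"
      by (simp add: algebra_simps power2_eq_square)
    moreover have "poisson \<i> t = 1 / (pi * (1 + t\<^sup>2))"
      by (simp add: poisson_def cmod_def)
    moreover have "1 + t\<^sup>2 \<noteq> 0" using zero_le_power2[of t] by linarith
    ultimately show ?thesis by (simp add: K_def scaleR_conv_of_real del: of_real_add of_real_power)
  qed
  ultimately show ?thesis by (simp add: K_def poisson_int_def)
qed

text \<open>The usual splitting for an approximate identity: near \<open>x\<close> continuity
  controls the integrand, away from \<open>x\<close> the kernel is at most \<open>Im z\<close> times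
  a fixed multiple of \<open>1 / (1 + t\<^sup>2)\<close>. The approach to \<open>x\<close> is
  unrestricted, not only nontangential.\<close>

lemma poisson_int_tendsto_boundary:
  fixes f :: "real \<Rightarrow> 'a::{banach,second_countable_topology}"
  assumes f: "poisson_integrable f" and c: "isCont f x"
  shows "(poisson_int f \<longlongrightarrow> f x) (at (of_real x) within {z. 0 < Im z})"
proof (rule tendstoI)
  fix e :: real assume e: "0 < e"
  obtain d where d: "0 < d" "\<And>t. \<bar>t - x\<bar> < d \<Longrightarrow> norm (f t - f x) < e / 2"
    using c e unfolding continuous_at_eps_delta dist_norm real_norm_def
    by (metis half_gt_zero)
  have m[measurable]: "f \<in> borel_measurable lebesgue" using f by (simp add: poisson_integrable_def)
  define g where "g t = f t - f x" for t
  have g: "poisson_integrable g"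
    using poisson_integrable_add[OF f poisson_integrable_bounded[of "\<lambda>_. - f x" "norm (f x)"]] by (simp add: g_def[abs_def])
  define I where "I = (LINT t|lebesgue. norm (g t) / (1 + t\<^sup>2))"
  \<comment> \<open>Chosen so that \<open>1 + t\<^sup>2 \<le> Q * (t - x)\<^sup>2\<close> whenever
    \<open>d \<le> \<bar>t - x\<bar>\<close>. The factor 4 in \<open>D\<close> comes from
    \<open>\<bar>t - x\<bar> / 2 \<le> cmod (of_real t - z)\<close>, valid for \<open>z\<close>
    close to \<open>x\<close>.\<close>
  define Q where "Q = (1 + 2 * x\<^sup>2) / d\<^sup>2 + 2"
  define D where "D = 4 / pi * Q"
  have Q0: "0 < Q" unfolding Q_def using d by (intro add_nonneg_pos divide_nonneg_pos) auto
  then have D0: "0 < D" by (simp add: D_def)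
  have far: "poisson z t \<le> Im z * D / (1 + t\<^sup>2)" if z: "0 < Im z" and near: "cmod (z - of_real x) < d / 2" and tx: "d \<le> \<bar>t - x\<bar>" for z t
  proof -
    define A where "A = \<bar>t - x\<bar>"
    have "cmod (of_real t - of_real x) \<le> cmod (of_real t - z) + cmod (z - of_real x)"
      using norm_triangle_ineq[of "of_real t - z" "z - of_real x"] by simp
    then have "A \<le> cmod (of_real t - z) + cmod (z - of_real x)"
      unfolding A_def by (metis norm_of_real of_real_diff)
    then have 1: "A / 2 \<le> cmod (of_real t - z)" using near tx unfolding A_def[symmetric] by linarith
    have "d\<^sup>2 \<le> (t - x)\<^sup>2" using tx d by (metis abs_le_square_iff abs_of_pos)
    then have 3: "1 + 2 * x\<^sup>2 \<le> (1 + 2 * x\<^sup>2) / d\<^sup>2 * (t - x)\<^sup>2"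
      using d mult_left_mono[of "d\<^sup>2" "(t-x)\<^sup>2" "1 + 2 * x\<^sup>2"] by (simp add: field_simps)
    have 4: "t\<^sup>2 \<le> 2 * x\<^sup>2 + 2 * (t - x)\<^sup>2"
      using zero_le_power2[of "t - 2 * x"] by (simp add: power2_eq_square algebra_simps)
    have 5: "1 + t\<^sup>2 \<le> Q * (t - x)\<^sup>2"
      using 3 4 by (simp add: algebra_simps Q_def)
    have "(t - x)\<^sup>2 \<le> 4 * (cmod (of_real t - z))\<^sup>2"
      using power_mono[OF 1, of 2] by (simp add: power_divide A_def)
    then have 6: "1 + t\<^sup>2 \<le> Q * (4 * (cmod (of_real t - z))\<^sup>2)"
      using 5 mult_left_mono[of "(t - x)\<^sup>2" "4 * (cmod (of_real t - z))\<^sup>2" Q] Q0 by linarith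
    have 7: "0 < (cmod (of_real t - z))\<^sup>2" "0 < 1 + t\<^sup>2" using of_real_diff_nonzero[OF z, of t] by (auto simp: add_pos_nonneg)
    have "1 / (pi * (cmod (of_real t - z))\<^sup>2) \<le> D / (1 + t\<^sup>2)"
      unfolding D_def using 6 7 by (simp add: divide_simps mult.commute mult.left_commute)
    from mult_left_mono[OF this, of "Im z"] show ?thesis using z by (simp add: poisson_def)
  qed
  have est: "norm (poisson_int f z - f x) \<le> e / 2 + Im z * D * I" if "0 < Im z" "cmod (z - of_real x) < d / 2" for z
  proof -
    have eq: "poisson_int f z - f x = poisson_int g z"
    proof -
      have "poisson_int f z - poisson_int (\<lambda>_. f x) z = poisson_int g z"
        unfolding poisson_int_def g_def scaleR_diff_right
        by (rule Bochner_Integration.integral_diff[symmetric])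
           (use integrable_poisson[OF f that(1)] integrable_poisson_kernel[OF that(1)] in auto)
      then show ?thesis using poisson_int_const[OF that(1), of "f x"] by simp
    qed
    have i1: "integrable lebesgue (\<lambda>t. e / 2 * poisson z t)"
      using integrable_poisson_kernel[OF that(1)] by simp
    have i2: "integrable lebesgue (\<lambda>t. Im z * D * (norm (g t) / (1 + t\<^sup>2)))"
      using g unfolding poisson_integrable_def by (intro integrable_mult_right) auto
    have "norm (poisson_int g z) \<le> (LINT t|lebesgue. e / 2 * poisson z t + Im z * D * (norm (g t) / (1 + t\<^sup>2)))"
      unfolding poisson_int_def
    proof (rule norm_integral_le_AE[OF _ _ AE_I2])
      fix t
      show "norm (poisson z t *\<^sub>R g t) \<le> e / 2 * poisson z t + Im z * D * (norm (g t) / (1 + t\<^sup>2))"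
      proof (cases "\<bar>t - x\<bar> < d")
        case True
        have "norm (poisson z t *\<^sub>R g t) \<le> e / 2 * poisson z t"
          using d(2)[OF True] poisson_nonneg[OF that(1), of t] mult_right_mono[of "norm (g t)" "e/2" "poisson z t"]
          by (simp add: g_def mult.commute)
        moreover have "0 \<le> Im z * D * (norm (g t) / (1 + t\<^sup>2))" using that D0 by simp
        ultimately show ?thesis by linarith
      next
        case False
        have "norm (poisson z t *\<^sub>R g t) \<le> Im z * D / (1 + t\<^sup>2) * norm (g t)"
          using mult_right_mono[OF far[OF that, of t], of "norm (g t)"] False poisson_nonneg[OF that(1), of t] by simp
        moreover have "0 \<le> e / 2 * poisson z t" using e poisson_nonneg[OF that(1)] by simp
        ultimately show ?thesis by simp
      qed
    qed (intro integrable_poisson[OF g that(1)] Bochner_Integration.integrable_add i1 i2)+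
    also have "\<dots> = e / 2 * (LINT t|lebesgue. poisson z t) + Im z * D * I"
      unfolding I_def Bochner_Integration.integral_add[OF i1 i2] by (simp only: integral_mult_right_zero)
    finally show ?thesis using integral_poisson[OF that(1)] eq by simp
  qed
  have "\<forall>\<^sub>F z in at (of_real x) within {z. 0 < Im z}. dist z (of_real x) < d / 2"
    using d by (intro tendstoD[OF tendsto_ident_at]) auto
  moreover have "((\<lambda>z. Im z * D * I) \<longlongrightarrow> Im (of_real x) * D * I) (at (of_real x) within {z. 0 < Im z})"
    by (intro tendsto_intros)
  then have "\<forall>\<^sub>F z in at (of_real x) within {z. 0 < Im z}. Im z * D * I < e / 2"
    using e by (intro order_tendstoD) auto
  moreover have "\<forall>\<^sub>F z in at (of_real x) within {z. 0 < Im z}. 0 < Im z"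
    by (simp add: eventually_at_filter)
  ultimately show "\<forall>\<^sub>F z in at (of_real x) within {z. 0 < Im z}. dist (poisson_int f z) (f x) < e"
    by eventually_elim (use est in \<open>force simp: dist_norm\<close>)
qed

section \<open>Mean growth and convergence in the mean\<close>

lemma open_upper_half_plane: "open upper_half_plane"
  unfolding upper_half_plane_def using open_halfspace_Im_gt[of 0] by simp

lemma convex_upper_half_plane: "convex upper_half_plane"
  unfolding upper_half_plane_def using convex_halfspace_Im_gt[of 0] by simp

lemma continuous_on_horizontal:
  assumes "F holomorphic_on upper_half_plane" "0 < y"
  shows "continuous_on UNIV (\<lambda>x. F (Complex x y))"
  unfolding Complex_eq
  by (rule continuous_on_compose2[OF holomorphic_on_imp_continuous_on[OF assms(1)]])
     (use assms(2) in \<open>auto intro!: continuous_intros simp: upper_half_plane_def\<close>)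

lemma horizontal_measurable:
  assumes "F holomorphic_on upper_half_plane" "0 < y"
  shows "(\<lambda>x. F (Complex x y)) \<in> borel_measurable lebesgue"
  by (rule continuous_imp_lebesgue_measurable[OF continuous_on_horizontal[OF assms]])

text \<open>A replacement for the mean value inequality over discs that involves no area integrals.
  A primitive \<open>Q\<close> turns the bound on means over unit intervals into a bound on the
  increments \<open>Q (w + of_real h) - Q w\<close>. Cauchy's inequality on a disc of radius
  \<open>Im z / 2\<close> then bounds the derivative of the increment,
  \<open>F (z + of_real h) - F z\<close>, by \<open>2 * M / Im z\<close>. Averaging over
  \<open>h\<close> in the unit interval bounds \<open>F z\<close> itself.\<close>

lemma local_mean_bound_imp_bound:
  fixes F :: "complex \<Rightarrow> complex"
  assumes hol: "F holomorphic_on upper_half_plane"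
    and M: "\<And>x y. 0 < y \<Longrightarrow> integral {x..x + 1} (\<lambda>s. cmod (F (Complex s y))) \<le> M"
    and z: "0 < Im z"
  shows "cmod (F z) \<le> M + 2 * M / Im z"
proof -
  obtain Q where Q: "\<And>w. w \<in> upper_half_plane \<Longrightarrow> (Q has_field_derivative F w) (at w)"
    using holomorphic_convex_primitive'[OF convex_upper_half_plane open_upper_half_plane hol]
    by (metis at_within_open open_upper_half_plane)
  have int: "(\<lambda>s. F (Complex s y)) integrable_on {a..b}" "(\<lambda>s. cmod (F (Complex s y))) integrable_on {a..b}" if "0 < y" for a b y
    using continuous_on_horizontal[OF hol that]
    by (auto intro!: integrable_continuous_real continuous_intros intro: continuous_on_subset)
  have diffQ: "cmod (Q (w + of_real h) - Q w) \<le> M" if w: "0 < Im w" and h: "0 \<le> h" "h \<le> 1" for w h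
  proof -
    have "((\<lambda>s. F (Complex s (Im w))) has_integral Q (Complex (Re w + h) (Im w)) - Q (Complex (Re w) (Im w))) {Re w..Re w + h}"
    proof (rule fundamental_theorem_of_calculus)
      fix s assume "s \<in> {Re w..Re w + h}"
      have "((Q \<circ> (\<lambda>s. of_real s + \<i> * of_real (Im w))) has_vector_derivative 1 * F (of_real s + \<i> * of_real (Im w))) (at s within {Re w..Re w + h})"
      proof (rule field_vector_diff_chain_within)
        show "((\<lambda>s. of_real s + \<i> * of_real (Im w)) has_vector_derivative 1) (at s within {Re w..Re w + h})"
          by (auto intro!: derivative_eq_intros)
        show "(Q has_field_derivative F (of_real s + \<i> * of_real (Im w))) (at (of_real s + \<i> * of_real (Im w)) within (\<lambda>s. of_real s + \<i> * of_real (Im w)) ` {Re w..Re w + h})"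
          by (rule has_field_derivative_at_within, rule Q) (use w in \<open>simp add: upper_half_plane_def\<close>)
      qed
      then show "((\<lambda>s. Q (Complex s (Im w))) has_vector_derivative F (Complex s (Im w))) (at s within {Re w..Re w + h})"
        by (simp add: Complex_eq o_def)
    qed (use h in simp)
    moreover have "Complex (Re w + h) (Im w) = w + of_real h" by (simp add: complex_eq_iff)
    ultimately have "Q (w + of_real h) - Q w = integral {Re w..Re w + h} (\<lambda>s. F (Complex s (Im w)))"
      by (simp add: integral_unique)
    also have "cmod \<dots> \<le> integral {Re w..Re w + h} (\<lambda>s. cmod (F (Complex s (Im w))))"
      by (rule integral_norm_bound_integral[OF int(1)[OF w] int(2)[OF w]]) simp
    also have "\<dots> \<le> integral {Re w..Re w + 1} (\<lambda>s. cmod (F (Complex s (Im w))))"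
      by (rule integral_subset_le[OF _ int(2)[OF w] int(2)[OF w]]) (use h in auto)
    also have "\<dots> \<le> M" by (rule M[OF w])
    finally show ?thesis .
  qed
  define y where "y = Im z"
  have y: "y > 0" using z y_def by simp
  have shift: "cmod (F z) \<le> cmod (F (z + of_real h)) + 2 * M / y" if h: "0 \<le> h" "h \<le> 1" for h
  proof -
    define D where "D = (\<lambda>w. Q (w + of_real h) - Q w)"
    have in_half: "w \<in> upper_half_plane" if "cmod (z - w) \<le> y / 2" for w
      using abs_Im_le_cmod[of "z - w"] that y by (simp add: upper_half_plane_def y_def)
    have dD: "(D has_field_derivative (F (w + of_real h) - F w)) (at w)" if "w \<in> upper_half_plane" for w
    proof -
      have "((\<lambda>w. Q (w + of_real h)) has_field_derivative F (w + of_real h)) (at w)"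
        unfolding DERIV_shift[symmetric] by (rule Q) (use that in \<open>simp add: upper_half_plane_def\<close>)
      then show ?thesis unfolding D_def by (intro DERIV_diff Q that)
    qed
    have holD: "D holomorphic_on upper_half_plane"
      using dD by (metis field_differentiable_at_within field_differentiable_def holomorphic_on_def)
    have "cmod ((deriv ^^ 1) D z) \<le> fact 1 * M / (y / 2) ^ 1"
    proof (rule Cauchy_inequality)
      show "D holomorphic_on ball z (y / 2)"
        by (rule holomorphic_on_subset[OF holD]) (auto intro!: in_half simp: dist_norm)
      show "continuous_on (cball z (y / 2)) D"
        by (rule continuous_on_subset[OF holomorphic_on_imp_continuous_on[OF holD]]) (auto intro!: in_half simp: dist_norm)
      show "cmod (D w) \<le> M" if "cmod (z - w) = y / 2" for w
        unfolding D_def using in_half[of w] that h by (intro diffQ) (auto simp: upper_half_plane_def)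
    qed (use y in simp)
    moreover have "deriv D z = F (z + of_real h) - F z"
      by (rule DERIV_imp_deriv[OF dD]) (use z in \<open>simp add: upper_half_plane_def\<close>)
    ultimately have "cmod (F (z + of_real h) - F z) \<le> 2 * M / y" by (simp add: mult.commute)
    then show ?thesis using norm_triangle_ineq2[of "F z" "F (z + of_real h)"] by (simp add: norm_minus_commute)
  qed
  have "integral {Re z..Re z + 1} (\<lambda>s. cmod (F z) - 2 * M / y) \<le> integral {Re z..Re z + 1} (\<lambda>s. cmod (F (Complex s y)))"
  proof (rule integral_le)
    fix s assume s: "s \<in> {Re z..Re z + 1}"
    have "z + of_real (s - Re z) = Complex s y" by (simp add: complex_eq_iff y_def)
    with shift[of "s - Re z"] s show "cmod (F z) - 2 * M / y \<le> cmod (F (Complex s y))" by auto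
  qed (use int y in auto)
  also have "\<dots> \<le> M" by (rule M[OF y])
  finally show ?thesis by (simp add: y_def)
qed

text \<open>The bound concerns the integral of the power rather than its root, and is stated for a
  nonnegative integral, so that Fatou's lemma and pointwise comparison apply directly and
  integrability comes as a consequence.\<close>

definition hardy_bound :: "real \<Rightarrow> real \<Rightarrow> (complex \<Rightarrow> complex) \<Rightarrow> bool" where
  "hardy_bound p K F \<longleftrightarrow> F holomorphic_on upper_half_plane \<and>
     (\<forall>y>0. (\<integral>\<^sup>+x. ennreal (cmod (F (Complex x y)) powr p) \<partial>lebesgue) \<le> ennreal K)"

text \<open>Boundedness of each upward shift of \<open>F\<close>, as the Poisson formula requires;
  the bounds may blow up towards the real axis.\<close>

definition bounded_above_lines :: "(complex \<Rightarrow> complex) \<Rightarrow> bool" where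
  "bounded_above_lines F \<longleftrightarrow> (\<forall>e>0. \<exists>B. \<forall>z. e \<le> Im z \<longrightarrow> cmod (F z) \<le> B)"

lemma le_one_plus_powr: "0 \<le> (a::real) \<Longrightarrow> 1 \<le> p \<Longrightarrow> a \<le> 1 + a powr p"
proof (cases "a \<le> 1")
  case False
  assume "0 \<le> a" "1 \<le> p"
  then have "a powr 1 \<le> a powr p" using False by (intro powr_mono) auto
  then show ?thesis using False by simp
next
  case True then show ?thesis using powr_ge_zero[of a p] by linarith
qed

lemma hardy_bound_integrable:
  assumes "hardy_bound p K F" "0 < y"
  shows "integrable lebesgue (\<lambda>x. cmod (F (Complex x y)) powr p)"
proof (rule integrableI_bounded)
  have "(\<lambda>x. F (Complex x y)) \<in> borel_measurable lebesgue"
    using horizontal_measurable assms by (simp add: hardy_bound_def)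
  then show "(\<lambda>x. cmod (F (Complex x y)) powr p) \<in> borel_measurable lebesgue" by measurable
  show "(\<integral>\<^sup>+ x. ennreal (norm (cmod (F (Complex x y)) powr p)) \<partial>lebesgue) < \<infinity>"
    using assms by (auto simp: hardy_bound_def intro: le_less_trans)
qed

lemma hardy_bound_integral_le:
  assumes "hardy_bound p K F" "0 < y" "0 \<le> K"
  shows "(LINT x|lebesgue. cmod (F (Complex x y)) powr p) \<le> K"
proof -
  have "ennreal (LINT x|lebesgue. cmod (F (Complex x y)) powr p) \<le> ennreal K"
    using assms by (subst nn_integral_eq_integral[symmetric]) (auto simp: hardy_bound_def hardy_bound_integrable)
  then show ?thesis using assms by simp
qed

text \<open>The inequality \<open>a \<le> 1 + a powr p\<close>, in place of Hoelder's, bounds the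
  means over unit intervals by \<open>1 + K\<close> at every height, and
  \<open>local_mean_bound_imp_bound\<close> applies.\<close>

lemma hardy_bound_imp_bounded_above_lines:
  assumes H: "hardy_bound p K F" and p: "1 \<le> p" and K: "0 \<le> K"
  shows "bounded_above_lines F"
  unfolding bounded_above_lines_def
proof (intro allI impI)
  fix e :: real assume e: "0 < e"
  have hol: "F holomorphic_on upper_half_plane" using H by (simp add: hardy_bound_def)
  have M: "integral {x..x + 1} (\<lambda>s. cmod (F (Complex s y))) \<le> 1 + K" if y: "0 < y" for x y
  proof -
    have c: "continuous_on A (\<lambda>s. F (Complex s y))" for A
      using continuous_on_horizontal[OF hol y] continuous_on_subset by blast
    have i: "set_integrable lebesgue {x..x + 1} (\<lambda>s. cmod (F (Complex s y)))"
      by (intro absolutely_integrable_continuous_real continuous_on_norm c)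
    have "integral {x..x + 1} (\<lambda>s. cmod (F (Complex s y))) = (LINT s:{x..x + 1}|lebesgue. cmod (F (Complex s y)))"
      using set_lebesgue_integral_eq_integral(2)[OF i] by simp
    also have "\<dots> \<le> (LINT s|lebesgue. indicat_real {x..x + 1} s + cmod (F (Complex s y)) powr p)"
      unfolding set_lebesgue_integral_def
    proof (rule integral_mono)
      show "integrable lebesgue (\<lambda>s. indicat_real {x..x + 1} s *\<^sub>R cmod (F (Complex s y)))"
        using i by (simp add: set_integrable_def)
      show "integrable lebesgue (\<lambda>s. indicat_real {x..x + 1} s + cmod (F (Complex s y)) powr p)"
        using hardy_bound_integrable[OF H y] by (auto intro!: Bochner_Integration.integrable_add)
      fix s show "indicat_real {x..x + 1} s *\<^sub>R cmod (F (Complex s y)) \<le> indicat_real {x..x + 1} s + cmod (F (Complex s y)) powr p"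
        using le_one_plus_powr[OF _ p, of "cmod (F (Complex s y))"] by (auto simp: indicator_def)
    qed
    also have "\<dots> = 1 + (LINT s|lebesgue. cmod (F (Complex s y)) powr p)"
      using hardy_bound_integrable[OF H y] by (subst Bochner_Integration.integral_add) auto
    also have "\<dots> \<le> 1 + K" using hardy_bound_integral_le[OF H y K] by simp
    finally show ?thesis .
  qed
  have "cmod (F z) \<le> (1 + K) + 2 * (1 + K) / e" if "e \<le> Im z" for z
  proof -
    have "cmod (F z) \<le> (1 + K) + 2 * (1 + K) / Im z"
      by (rule local_mean_bound_imp_bound[OF hol M]) (use that e in auto)
    also have "2 * (1 + K) / Im z \<le> 2 * (1 + K) / e" using that e K by (intro divide_left_mono) auto
    finally show ?thesis by simp
  qed
  then show "\<exists>B. \<forall>z. e \<le> Im z \<longrightarrow> cmod (F z) \<le> B" by blast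
qed

lemma poisson_formula_shift:
  assumes hol: "F holomorphic_on upper_half_plane" and bd: "bounded_above_lines F" and e: "0 < e" and z: "0 < Im z"
  shows "F (z + \<i> * of_real e) = poisson_int (\<lambda>t. F (Complex t e)) z"
proof -
  obtain B where B: "\<And>z. e \<le> Im z \<Longrightarrow> cmod (F z) \<le> B" using bd e by (auto simp: bounded_above_lines_def)
  have "(\<lambda>z. F (z + \<i> * of_real e)) z = poisson_int (\<lambda>t. F (of_real t + \<i> * of_real e)) z"
  proof (rule poisson_formula[OF e _ _ z])
    have "(F \<circ> (\<lambda>z. z + \<i> * of_real e)) holomorphic_on {z. - e < Im z}"
      by (rule holomorphic_on_compose_gen[OF _ hol]) (auto intro!: holomorphic_intros simp: upper_half_plane_def)
    then show "(\<lambda>z. F (z + \<i> * of_real e)) holomorphic_on {z. - e < Im z}" by (simp add: o_def)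
  qed (auto intro: B)
  then show ?thesis by (simp add: Complex_eq)
qed

lemma poisson_formula_horizontal:
  assumes "F holomorphic_on upper_half_plane" "bounded_above_lines F" "0 < e" "0 < y"
  shows "F (Complex x (e + y)) = poisson_int (\<lambda>t. F (Complex t e)) (Complex x y)"
  using poisson_formula_shift[OF assms(1-3), of "Complex x y"] assms(4) by (simp add: Complex_eq algebra_simps)

lemma horizontal_poisson_integrable:
  assumes "F holomorphic_on upper_half_plane" "bounded_above_lines F" "0 < e"
  shows "poisson_integrable (\<lambda>t. F (Complex t e))"
proof -
  obtain B where "\<And>z. e \<le> Im z \<Longrightarrow> cmod (F z) \<le> B" using assms by (auto simp: bounded_above_lines_def)
  then show ?thesis
    by (intro poisson_integrable_bounded[where B = B] horizontal_measurable assms) auto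
qed

section \<open>The Poisson semigroup and convergence in the square mean\<close>

lemma borel_measurable_cnj [measurable]: "f \<in> borel_measurable M \<Longrightarrow> (\<lambda>x. cnj (f x)) \<in> borel_measurable M"
  by (rule borel_measurable_continuous_on[where f = cnj]) (auto intro!: continuous_intros)

lemma cnj_poisson_int: "cnj (poisson_int f z) = poisson_int (\<lambda>t. cnj (f t)) z"
proof -
  have "cnj (poisson_int f z) = (LINT t|lebesgue. cnj (poisson z t *\<^sub>R f t))"
    unfolding poisson_int_def by (rule Bochner_Integration.integral_cnj[symmetric])
  then show ?thesis by (simp add: poisson_int_def scaleR_conv_of_real)
qed

lemma nn_integral_poisson_multc:
  assumes "0 < y" shows "(\<integral>\<^sup>+t. ennreal (poisson (Complex x y) t) * c \<partial>lebesgue) = c"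
  using nn_integral_multc[of "\<lambda>t. ennreal (poisson (Complex x y) t)" lebesgue c] nn_integral_poisson[of "Complex x y"] assms
  by simp

text \<open>Symmetry of the kernel and Fubini. Integrability on the product follows from
  \<open>a * b \<le> a\<^sup>2 + b\<^sup>2\<close> together with mass 1 of the kernel in each
  variable separately.\<close>

lemma poisson_self_adjoint:
  fixes f g :: "real \<Rightarrow> complex"
  assumes f: "f \<in> borel_measurable lebesgue" "integrable lebesgue (\<lambda>x. (cmod (f x))\<^sup>2)"
    and g: "g \<in> borel_measurable lebesgue" "integrable lebesgue (\<lambda>x. (cmod (g x))\<^sup>2)" and y: "0 < y"
  shows "(LINT x|lebesgue. f x * cnj (poisson_int g (Complex x y))) = (LINT t|lebesgue. poisson_int f (Complex t y) * cnj (g t))"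
proof -
  note [measurable] = f(1) g(1)
  let ?h = "\<lambda>x t. f x * (of_real (poisson (Complex x y) t) * cnj (g t))"
  have int: "integrable (lebesgue \<Otimes>\<^sub>M lebesgue) (case_prod ?h)"
  proof (rule integrableI_bounded)
    show "case_prod ?h \<in> borel_measurable (lebesgue \<Otimes>\<^sub>M lebesgue)"
      unfolding case_prod_beta by measurable
    have "(\<integral>\<^sup>+ p. ennreal (norm (case_prod ?h p)) \<partial>(lebesgue \<Otimes>\<^sub>M lebesgue))
      \<le> (\<integral>\<^sup>+ p. ennreal (poisson (Complex (fst p) y) (snd p)) * ennreal ((cmod (f (fst p)))\<^sup>2)
          + ennreal (poisson (Complex (snd p) y) (fst p)) * ennreal ((cmod (g (snd p)))\<^sup>2) \<partial>(lebesgue \<Otimes>\<^sub>M lebesgue))"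
    proof (rule nn_integral_mono)
      fix p :: "real \<times> real"
      define P where "P = poisson (Complex (fst p) y) (snd p)"
      have P: "0 \<le> P" "poisson (Complex (snd p) y) (fst p) = P" unfolding P_def using y by (auto intro: poisson_nonneg simp: poisson_swap)
      define a b where "a = cmod (f (fst p))" and "b = cmod (g (snd p))"
      have ab: "0 \<le> a" "0 \<le> b" by (auto simp: a_def b_def)
      have "a * b \<le> a\<^sup>2 + b\<^sup>2"
        using sum_squares_bound[of a b] mult_nonneg_nonneg[OF ab] by linarith
      then have "a * (P * b) \<le> P * a\<^sup>2 + P * b\<^sup>2"
        using P mult_left_mono[of "a * b" "a\<^sup>2 + b\<^sup>2" P] by (simp add: algebra_simps)
      then have "norm (case_prod ?h p) \<le> P * a\<^sup>2 + P * b\<^sup>2"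
        using P by (simp add: case_prod_beta norm_mult P_def[symmetric] a_def b_def)
      then show "ennreal (norm (case_prod ?h p)) \<le> ennreal (poisson (Complex (fst p) y) (snd p)) * ennreal ((cmod (f (fst p)))\<^sup>2)
          + ennreal (poisson (Complex (snd p) y) (fst p)) * ennreal ((cmod (g (snd p)))\<^sup>2)"
        unfolding P(2) P_def[symmetric] a_def[symmetric] b_def[symmetric] using P(1)
        by (subst (1 2) ennreal_mult[symmetric]; simp add: ennreal_plus[symmetric] ennreal_leI del: ennreal_plus)
    qed
    also have "\<dots> = (\<integral>\<^sup>+x. (\<integral>\<^sup>+t. ennreal (poisson (Complex x y) t) * ennreal ((cmod (f x))\<^sup>2) \<partial>lebesgue) \<partial>lebesgue)
        + (\<integral>\<^sup>+t. (\<integral>\<^sup>+x. ennreal (poisson (Complex t y) x) * ennreal ((cmod (g t))\<^sup>2) \<partial>lebesgue) \<partial>lebesgue)"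
    proof (subst nn_integral_add)
      have "(\<integral>\<^sup>+ p. ennreal (poisson (Complex (fst p) y) (snd p)) * ennreal ((cmod (f (fst p)))\<^sup>2) \<partial>(lebesgue \<Otimes>\<^sub>M lebesgue))
        = (\<integral>\<^sup>+x. (\<integral>\<^sup>+t. ennreal (poisson (Complex x y) t) * ennreal ((cmod (f x))\<^sup>2) \<partial>lebesgue) \<partial>lebesgue)"
        using sigma_finite_measure.nn_integral_fst[OF sigma_finite_lebesgue, of "\<lambda>p. ennreal (poisson (Complex (fst p) y) (snd p)) * ennreal ((cmod (f (fst p)))\<^sup>2)" lebesgue]
        by simp
      moreover have "(\<integral>\<^sup>+ p. ennreal (poisson (Complex (snd p) y) (fst p)) * ennreal ((cmod (g (snd p)))\<^sup>2) \<partial>(lebesgue \<Otimes>\<^sub>M lebesgue))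
        = (\<integral>\<^sup>+t. (\<integral>\<^sup>+x. ennreal (poisson (Complex t y) x) * ennreal ((cmod (g t))\<^sup>2) \<partial>lebesgue) \<partial>lebesgue)"
        using lebesgue_pair.nn_integral_snd[of "\<lambda>p. ennreal (poisson (Complex (snd p) y) (fst p)) * ennreal ((cmod (g (snd p)))\<^sup>2)"]
        by (simp add: case_prod_beta)
      ultimately show "(\<integral>\<^sup>+ p. ennreal (poisson (Complex (fst p) y) (snd p)) * ennreal ((cmod (f (fst p)))\<^sup>2) \<partial>(lebesgue \<Otimes>\<^sub>M lebesgue))
        + (\<integral>\<^sup>+ p. ennreal (poisson (Complex (snd p) y) (fst p)) * ennreal ((cmod (g (snd p)))\<^sup>2) \<partial>(lebesgue \<Otimes>\<^sub>M lebesgue)) =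
        (\<integral>\<^sup>+x. (\<integral>\<^sup>+t. ennreal (poisson (Complex x y) t) * ennreal ((cmod (f x))\<^sup>2) \<partial>lebesgue) \<partial>lebesgue)
        + (\<integral>\<^sup>+t. (\<integral>\<^sup>+x. ennreal (poisson (Complex t y) x) * ennreal ((cmod (g t))\<^sup>2) \<partial>lebesgue) \<partial>lebesgue)" by simp
    qed measurable
    also have "\<dots> = (\<integral>\<^sup>+x. ennreal ((cmod (f x))\<^sup>2) \<partial>lebesgue) + (\<integral>\<^sup>+t. ennreal ((cmod (g t))\<^sup>2) \<partial>lebesgue)"
      by (simp only: nn_integral_poisson_multc[OF y])
    also have "\<dots> < \<infinity>"
      unfolding nn_integral_eq_integral[OF f(2), simplified] nn_integral_eq_integral[OF g(2), simplified]
      by simp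
    finally show "(\<integral>\<^sup>+ p. ennreal (norm (case_prod ?h p)) \<partial>(lebesgue \<Otimes>\<^sub>M lebesgue)) < \<infinity>" .
  qed
  have a: "f x * cnj (poisson_int g (Complex x y)) = (LINT t|lebesgue. ?h x t)" for x
    unfolding cnj_poisson_int by (simp add: poisson_int_def scaleR_conv_of_real)
  have b: "(LINT x|lebesgue. ?h x t) = poisson_int f (Complex t y) * cnj (g t)" for t
  proof -
    have "?h x t = (of_real (poisson (Complex t y) x) * f x) * cnj (g t)" for x
      unfolding poisson_swap[of x y t] by simp
    then have "(LINT x|lebesgue. ?h x t) = (LINT x|lebesgue. (of_real (poisson (Complex t y) x) * f x) * cnj (g t))"
      by presburger
    then show ?thesis
      unfolding Bochner_Integration.integral_mult_left_zero poisson_int_def scaleR_conv_of_real .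
  qed
  show ?thesis
    unfolding a b[symmetric] by (rule lebesgue_pair.Fubini_integral[OF int, symmetric])
qed

lemma integrable_mult_squares:
  fixes f g :: "'a \<Rightarrow> complex"
  assumes "f \<in> borel_measurable M" "g \<in> borel_measurable M"
    and "integrable M (\<lambda>x. (cmod (f x))\<^sup>2)" "integrable M (\<lambda>x. (cmod (g x))\<^sup>2)"
  shows "integrable M (\<lambda>x. f x * g x)"
proof (rule Bochner_Integration.integrable_bound)
  show "integrable M (\<lambda>x. (cmod (f x))\<^sup>2 + (cmod (g x))\<^sup>2)" using assms by simp
  show "(\<lambda>x. f x * g x) \<in> borel_measurable M" using assms by measurable
  show "AE x in M. norm (f x * g x) \<le> norm ((cmod (f x))\<^sup>2 + (cmod (g x))\<^sup>2)"
  proof (rule AE_I2)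
    fix x
    have "0 \<le> cmod (f x) * cmod (g x)" by simp
    then show "norm (f x * g x) \<le> norm ((cmod (f x))\<^sup>2 + (cmod (g x))\<^sup>2)"
      using sum_squares_bound[of "cmod (f x)" "cmod (g x)"] unfolding norm_mult real_norm_def by linarith
  qed
qed

lemma integrable_cmod_diff_square:
  fixes f g :: "'a \<Rightarrow> complex"
  assumes "f \<in> borel_measurable M" "g \<in> borel_measurable M"
    and "integrable M (\<lambda>x. (cmod (f x))\<^sup>2)" "integrable M (\<lambda>x. (cmod (g x))\<^sup>2)"
  shows "integrable M (\<lambda>x. (cmod (f x - g x))\<^sup>2)"
    and "(LINT x|M. (cmod (f x - g x))\<^sup>2) = (LINT x|M. (cmod (f x))\<^sup>2) + (LINT x|M. (cmod (g x))\<^sup>2) - 2 * Re (LINT x|M. f x * cnj (g x))"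
proof -
  have eq: "(cmod (f x - g x))\<^sup>2 = (cmod (f x))\<^sup>2 + (cmod (g x))\<^sup>2 - 2 * Re (f x * cnj (g x))" for x
    unfolding cmod_power2 by (simp add: power2_eq_square algebra_simps)
  have i: "integrable M (\<lambda>x. f x * cnj (g x))"
    by (rule integrable_mult_squares) (use assms in \<open>auto intro: borel_measurable_cnj\<close>)
  then have i2: "integrable M (\<lambda>x. 2 * Re (f x * cnj (g x)))" by (intro integrable_mult_right integrable_Re)
  have i3: "integrable M (\<lambda>x. (cmod (f x))\<^sup>2 + (cmod (g x))\<^sup>2)" using assms by simp
  show "integrable M (\<lambda>x. (cmod (f x - g x))\<^sup>2)"
    unfolding eq by (rule Bochner_Integration.integrable_diff[OF i3 i2])
  show "(LINT x|M. (cmod (f x - g x))\<^sup>2) = (LINT x|M. (cmod (f x))\<^sup>2) + (LINT x|M. (cmod (g x))\<^sup>2) - 2 * Re (LINT x|M. f x * cnj (g x))"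
    unfolding eq Bochner_Integration.integral_diff[OF i3 i2] Bochner_Integration.integral_add[OF assms(3,4)]
    using integral_Re[OF i] by (simp only: integral_mult_right_zero)
qed

lemma hardy_bound_2_integrable:
  assumes "hardy_bound 2 K A" "0 < e" shows "integrable lebesgue (\<lambda>x. (cmod (A (Complex x e)))\<^sup>2)"
  using hardy_bound_integrable[OF assms] by simp

text \<open>The inner product of two horizontal restrictions depends only on the sum of their heights,
  because the Poisson semigroup is self-adjoint; together with monotonicity of the norms this
  makes the restrictions converge in the mean.\<close>

lemma hardy_2_cauchy:
  assumes H: "hardy_bound 2 K A" and K: "0 \<le> K" and e: "0 < e"
  obtains d where "0 < d" "\<And>s t. \<lbrakk>0 < s; s < d; 0 < t; t < d\<rbrakk> \<Longrightarrow> (LINT x|lebesgue. (cmod (A (Complex x s) - A (Complex x t)))\<^sup>2) < e"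
proof -
  have hol: "A holomorphic_on upper_half_plane" using H by (simp add: hardy_bound_def)
  have bd: "bounded_above_lines A" by (rule hardy_bound_imp_bounded_above_lines[OF H _ K]) simp
  have m: "(\<lambda>x. A (Complex x s)) \<in> borel_measurable lebesgue" if "0 < s" for s
    by (rule horizontal_measurable[OF hol that])
  have i: "integrable lebesgue (\<lambda>x. (cmod (A (Complex x s)))\<^sup>2)" if "0 < s" for s
    by (rule hardy_bound_2_integrable[OF H that])
  define N where "N s = (LINT x|lebesgue. (cmod (A (Complex x s)))\<^sup>2)" for s
  have NK: "N s \<le> K" if "0 < s" for s
    using hardy_bound_integral_le[OF H that K] by (simp add: N_def)
  \<comment> \<open>Going up is taking a Poisson integral, so the norms decrease with the
    height.\<close>
  have mono: "N s \<le> N t" if "0 < t" "t < s" for s t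
  proof -
    have st: "t + (s - t) = s" by simp
    have "(\<integral>\<^sup>+x. ennreal (cmod (poisson_int (\<lambda>u. A (Complex u t)) (Complex x (s - t))) powr 2) \<partial>lebesgue)
        \<le> (\<integral>\<^sup>+u. ennreal (cmod (A (Complex u t)) powr 2) \<partial>lebesgue)"
      by (rule poisson_int_Lp_contraction) (use that in \<open>auto intro: horizontal_poisson_integrable[OF hol bd]\<close>)
    then have "(\<integral>\<^sup>+x. ennreal ((cmod (A (Complex x s)))\<^sup>2) \<partial>lebesgue) \<le> (\<integral>\<^sup>+u. ennreal ((cmod (A (Complex u t)))\<^sup>2) \<partial>lebesgue)"
      using that poisson_formula_horizontal[OF hol bd, of t "s - t"] by simp
    moreover have "0 \<le> N t" unfolding N_def by (intro Bochner_Integration.integral_nonneg) simp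
    ultimately show ?thesis
      unfolding N_def using that i[of s] i[of t] by (simp add: nn_integral_eq_integral)
  qed
  \<comment> \<open>With \<open>h\<close> half the difference of the heights, the upper restriction
    is the Poisson integral at height \<open>h\<close> of the middle one. Moving this operator to
    the other factor lifts the lower restriction to the middle as well.\<close>
  have inner: "(LINT x|lebesgue. A (Complex x s) * cnj (A (Complex x t))) = of_real (N ((s + t) / 2))" if "0 < t" "t < s" for s t
  proof -
    define r where "r = (s + t) / 2"
    define h where "h = (s - t) / 2"
    have rh: "r + h = s" "t + h = r" "0 < r" "0 < h" using that by (auto simp: r_def h_def field_simps)
    have "(LINT x|lebesgue. A (Complex x s) * cnj (A (Complex x t)))
      = (LINT x|lebesgue. poisson_int (\<lambda>u. A (Complex u r)) (Complex x h) * cnj (A (Complex x t)))"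
      using poisson_formula_horizontal[OF hol bd rh(3,4)] rh(1) by simp
    also have "\<dots> = (LINT x|lebesgue. A (Complex x r) * cnj (poisson_int (\<lambda>u. A (Complex u t)) (Complex x h)))"
      by (rule poisson_self_adjoint[symmetric]) (use m i rh that in auto)
    also have "\<dots> = (LINT x|lebesgue. A (Complex x r) * cnj (A (Complex x r)))"
      using poisson_formula_horizontal[OF hol bd that(1) rh(4)] rh(2) by simp
    also have "\<dots> = of_real (N r)"
      by (simp add: N_def complex_norm_square[symmetric] del: of_real_power)
    finally show ?thesis by (simp add: r_def)
  qed
  have diff: "(LINT x|lebesgue. (cmod (A (Complex x s) - A (Complex x t)))\<^sup>2) \<le> N t - N s" if "0 < t" "t < s" for s t
  proof -
    have s0: "0 < s" using that by simp
    have "(LINT x|lebesgue. (cmod (A (Complex x s) - A (Complex x t)))\<^sup>2) = N s + N t - 2 * N ((s + t) / 2)"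
      using integrable_cmod_diff_square(2)[OF m[OF s0] m[OF that(1)] i[OF s0] i[OF that(1)]] inner[OF that]
      by (simp add: N_def)
    also have "\<dots> \<le> N t - N s" using mono[of "(s + t) / 2" s] that by simp
    finally show ?thesis .
  qed
  \<comment> \<open>By monotonicity the norms increase to their finite supremum \<open>L\<close> as
    the height tends to 0, so that their differences, and with them the distances, become
    small.\<close>
  define L where "L = (SUP s\<in>{0<..}. N s)"
  have bdd: "bdd_above (N ` {0<..})" using NK by (auto simp: bdd_above_def)
  have "\<exists>d\<in>{0<..}. L - e < N d"
    using less_cSUP_iff[of "{0<..}" N "L - e"] bdd e by (auto simp: L_def)
  then obtain d where d: "0 < d" "L - e < N d" by auto
  show ?thesis
  proof (rule that[OF d(1)])
    fix s t assume st: "0 < s" "s < d" "0 < t" "t < d"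
    have le: "N u \<le> L" if "0 < u" for u unfolding L_def using that by (intro cSUP_upper bdd) auto
    have *: "(LINT x|lebesgue. (cmod (A (Complex x s) - A (Complex x t)))\<^sup>2) < e" if "0 < t" "t < s" "s < d" for s t
      using diff[OF that(1,2)] mono[of s d] le[of t] that d(2) by simp
    consider "s = t" | "t < s" | "s < t" by linarith
    then show "(LINT x|lebesgue. (cmod (A (Complex x s) - A (Complex x t)))\<^sup>2) < e"
    proof cases
      case 3 then show ?thesis using *[of s t] st by (simp add: norm_minus_commute)
    qed (use * st e in auto)
  qed
qed

text \<open>A weighted substitute for the Cauchy--Schwarz inequality without square roots of
  integrals; the parameter \<open>s\<close> is chosen afterwards to balance the two terms.\<close>

lemma integral_mult_le_squares:
  fixes f g :: "'a \<Rightarrow> complex"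
  assumes "f \<in> borel_measurable M" "g \<in> borel_measurable M"
    and "integrable M (\<lambda>x. (cmod (f x))\<^sup>2)" "integrable M (\<lambda>x. (cmod (g x))\<^sup>2)" and s: "0 < s"
  shows "(LINT x|M. cmod (f x * g x)) \<le> s * (LINT x|M. (cmod (f x))\<^sup>2) + (LINT x|M. (cmod (g x))\<^sup>2) / s"
proof -
  have "(LINT x|M. cmod (f x * g x)) \<le> (LINT x|M. s * (cmod (f x))\<^sup>2 + (cmod (g x))\<^sup>2 / s)"
  proof (rule integral_mono)
    fix x
    define a b where "a = cmod (f x)" and "b = cmod (g x)"
    have "2 * (sqrt s * a) * (b / sqrt s) \<le> (sqrt s * a)\<^sup>2 + (b / sqrt s)\<^sup>2" by (rule sum_squares_bound)
    then have "2 * (a * b) \<le> s * a\<^sup>2 + b\<^sup>2 / s" using s by (simp add: power_mult_distrib power_divide)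
    moreover have "0 \<le> a * b" by (simp add: a_def b_def)
    ultimately have "a * b \<le> s * a\<^sup>2 + b\<^sup>2 / s" by linarith
    then show "cmod (f x * g x) \<le> s * (cmod (f x))\<^sup>2 + (cmod (g x))\<^sup>2 / s"
      by (simp add: norm_mult a_def b_def)
  qed (use assms integrable_mult_squares[OF assms(1-4)] in auto)
  also have "\<dots> = s * (LINT x|M. (cmod (f x))\<^sup>2) + (LINT x|M. (cmod (g x))\<^sup>2) / s"
    using assms by (subst Bochner_Integration.integral_add) auto
  finally show ?thesis .
qed

lemma hardy_2_product_cauchy:
  assumes A: "hardy_bound 2 K A" and B: "hardy_bound 2 K B" and K: "0 < K" and e: "0 < e"
  obtains d where "0 < d" "\<And>s t. \<lbrakk>0 < s; s < d; 0 < t; t < d\<rbrakk> \<Longrightarrow>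
    (LINT x|lebesgue. cmod (A (Complex x s) * B (Complex x s) - A (Complex x t) * B (Complex x t))) < e"
proof -
  have K0: "0 \<le> K" using K by simp
  \<comment> \<open>With this weight the two terms that carry a full norm are at most
    \<open>e / 4\<close> each; asking the squared distances to be below \<open>c * (e / 8)\<close>
    makes the other two less than \<open>e / 8\<close> each.\<close>
  define c where "c = e / (4 * K)"
  have c: "0 < c" using K e by (simp add: c_def)
  have ce: "0 < c * (e / 8)" using c e by simp
  obtain d1 where d1: "0 < d1" "\<And>s t. \<lbrakk>0 < s; s < d1; 0 < t; t < d1\<rbrakk> \<Longrightarrow> (LINT x|lebesgue. (cmod (A (Complex x s) - A (Complex x t)))\<^sup>2) < c * (e / 8)"
    using hardy_2_cauchy[OF A K0 ce] by blast
  obtain d2 where d2: "0 < d2" "\<And>s t. \<lbrakk>0 < s; s < d2; 0 < t; t < d2\<rbrakk> \<Longrightarrow> (LINT x|lebesgue. (cmod (B (Complex x s) - B (Complex x t)))\<^sup>2) < c * (e / 8)"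
    using hardy_2_cauchy[OF B K0 ce] by blast
  have mA: "(\<lambda>x. A (Complex x s)) \<in> borel_measurable lebesgue" and mB: "(\<lambda>x. B (Complex x s)) \<in> borel_measurable lebesgue" if "0 < s" for s
    using horizontal_measurable that A B by (auto simp: hardy_bound_def)
  have iA: "integrable lebesgue (\<lambda>x. (cmod (A (Complex x s)))\<^sup>2)" and iB: "integrable lebesgue (\<lambda>x. (cmod (B (Complex x s)))\<^sup>2)" if "0 < s" for s
    using hardy_bound_2_integrable that A B by auto
  have nA: "(LINT x|lebesgue. (cmod (A (Complex x s)))\<^sup>2) \<le> K" and nB: "(LINT x|lebesgue. (cmod (B (Complex x s)))\<^sup>2) \<le> K" if "0 < s" for s
    using hardy_bound_integral_le[OF A that K0] hardy_bound_integral_le[OF B that K0] by auto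
  show ?thesis
  proof (rule that[of "min d1 d2"])
    fix s t assume st: "0 < s" "s < min d1 d2" "0 < t" "t < min d1 d2"
    define U V where "U = (\<lambda>x. A (Complex x s) - A (Complex x t))" and "V = (\<lambda>x. B (Complex x s) - B (Complex x t))"
    have mUV: "U \<in> borel_measurable lebesgue" "V \<in> borel_measurable lebesgue" unfolding U_def V_def using mA mB st by auto
    have iU: "integrable lebesgue (\<lambda>x. (cmod (U x))\<^sup>2)" "integrable lebesgue (\<lambda>x. (cmod (V x))\<^sup>2)"
      unfolding U_def V_def
      by (rule integrable_cmod_diff_square(1)[OF mA[OF st(1)] mA[OF st(3)] iA[OF st(1)] iA[OF st(3)]],
          rule integrable_cmod_diff_square(1)[OF mB[OF st(1)] mB[OF st(3)] iB[OF st(1)] iB[OF st(3)]])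
    have j1: "integrable lebesgue (\<lambda>x. B (Complex x s) * U x)"
      by (rule integrable_mult_squares[OF mB mUV(1) iB iU(1)]) (rule st)+
    have j2: "integrable lebesgue (\<lambda>x. A (Complex x t) * V x)"
      by (rule integrable_mult_squares[OF mA mUV(2) iA iU(2)]) (rule st)+
    have eq: "A (Complex x s) * B (Complex x s) - A (Complex x t) * B (Complex x t) = B (Complex x s) * U x + A (Complex x t) * V x" for x
      by (simp add: U_def V_def algebra_simps)
    have "(LINT x|lebesgue. cmod (A (Complex x s) * B (Complex x s) - A (Complex x t) * B (Complex x t)))
      = (LINT x|lebesgue. cmod (B (Complex x s) * U x + A (Complex x t) * V x))"
      unfolding eq ..
    also have "\<dots> \<le> (LINT x|lebesgue. cmod (B (Complex x s) * U x) + cmod (A (Complex x t) * V x))"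
      using j1 j2 by (intro integral_mono integrable_norm Bochner_Integration.integrable_add norm_triangle_ineq)
    also have "\<dots> = (LINT x|lebesgue. cmod (B (Complex x s) * U x)) + (LINT x|lebesgue. cmod (A (Complex x t) * V x))"
      using j1 j2 by (intro Bochner_Integration.integral_add integrable_norm)
    also have "(LINT x|lebesgue. cmod (B (Complex x s) * U x)) \<le> c * (LINT x|lebesgue. (cmod (B (Complex x s)))\<^sup>2) + (LINT x|lebesgue. (cmod (U x))\<^sup>2) / c"
      by (rule integral_mult_le_squares[OF mB mUV(1) iB iU(1) c]) (rule st)+
    also have "(LINT x|lebesgue. cmod (A (Complex x t) * V x)) \<le> c * (LINT x|lebesgue. (cmod (A (Complex x t)))\<^sup>2) + (LINT x|lebesgue. (cmod (V x))\<^sup>2) / c"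
      by (rule integral_mult_le_squares[OF mA mUV(2) iA iU(2) c]) (rule st)+
    finally have le: "(LINT x|lebesgue. cmod (A (Complex x s) * B (Complex x s) - A (Complex x t) * B (Complex x t)))
      \<le> c * (LINT x|lebesgue. (cmod (B (Complex x s)))\<^sup>2) + (LINT x|lebesgue. (cmod (U x))\<^sup>2) / c
        + (c * (LINT x|lebesgue. (cmod (A (Complex x t)))\<^sup>2) + (LINT x|lebesgue. (cmod (V x))\<^sup>2) / c)" by simp
    have "c * (LINT x|lebesgue. (cmod (B (Complex x s)))\<^sup>2) \<le> e / 4" "c * (LINT x|lebesgue. (cmod (A (Complex x t)))\<^sup>2) \<le> e / 4"
      using mult_left_mono[OF nB[OF st(1)], of c] mult_left_mono[OF nA[OF st(3)], of c] c K by (auto simp: c_def)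
    moreover have "(LINT x|lebesgue. (cmod (U x))\<^sup>2) / c < e / 8" "(LINT x|lebesgue. (cmod (V x))\<^sup>2) / c < e / 8"
      using d1(2)[of s t] d2(2)[of s t] st c by (auto simp: U_def V_def divide_less_eq mult.commute)
    ultimately show "(LINT x|lebesgue. cmod (A (Complex x s) * B (Complex x s) - A (Complex x t) * B (Complex x t))) < e"
      using le e by linarith
  qed (use d1 d2 in auto)
qed

lemma L1_cauchy_converges:
  fixes f :: "nat \<Rightarrow> 'a \<Rightarrow> 'b::{banach,second_countable_topology}"
  assumes int: "\<And>n. integrable M (f n)"
    and cauchy: "\<And>e. 0 < e \<Longrightarrow> \<exists>N. \<forall>m\<ge>N. \<forall>n\<ge>N. (LINT x|M. norm (f m x - f n x)) < e"
  obtains r :: "nat \<Rightarrow> nat" and g where "strict_mono r" "integrable M g"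
    "(\<lambda>n. LINT x|M. norm (f (r n) x - g x)) \<longlonglongrightarrow> 0" "AE x in M. (\<lambda>n. f (r n) x) \<longlonglongrightarrow> g x"
proof -
  have "\<exists>N. \<forall>m\<ge>N. \<forall>n\<ge>N. (LINT x|M. norm (f m x - f n x)) < (1/2)^k" for k :: nat
    by (rule cauchy) simp
  then obtain N where N: "\<And>k m n. N k \<le> m \<Longrightarrow> N k \<le> n \<Longrightarrow> (LINT x|M. norm (f m x - f n x)) < (1/2)^k"
    by metis
  \<comment> \<open>Adding up the thresholds makes \<open>r\<close> strictly increasing and
    \<open>r j\<close> at least \<open>N k\<close> for all \<open>k \<le> j\<close>, so that the
    consecutive differences along \<open>r\<close> are geometrically small in the mean.\<close>
  define r where "r k = k + (\<Sum>i\<le>k. N i)" for k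
  have r: "strict_mono r" unfolding strict_mono_Suc_iff r_def by simp
  have rN: "N k \<le> r j" if "k \<le> j" for k j
    unfolding r_def using member_le_sum[of k "{..j}" N] that by (simp add: trans_le_add2)
  define u where "u k x = f (r (Suc k)) x - f (r k) x" for k x
  have ui: "integrable M (u k)" for k unfolding u_def using int by auto
  have ub: "(LINT x|M. norm (u k x)) \<le> (1/2)^k" for k
    unfolding u_def using N[of k "r (Suc k)" "r k"] rN by (simp add: less_imp_le)
  have sum: "AE x in M. summable (\<lambda>k. norm (u k x))"
  proof -
    have "(\<integral>\<^sup>+x. (\<Sum>k. ennreal (norm (u k x))) \<partial>M) = (\<Sum>k. \<integral>\<^sup>+x. ennreal (norm (u k x)) \<partial>M)"
      using ui by (intro nn_integral_suminf) auto
    also have "\<dots> \<le> (\<Sum>k. ennreal ((1/2)^k))"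
      using ui ub by (intro suminf_le) (auto simp: nn_integral_eq_integral)
    also have "\<dots> = ennreal (\<Sum>k. (1/2)^k)" by (intro suminf_ennreal2) auto
    finally have "(\<integral>\<^sup>+x. (\<Sum>k. ennreal (norm (u k x))) \<partial>M) \<noteq> \<infinity>" by (auto simp: top_unique)
    then have "AE x in M. (\<Sum>k. ennreal (norm (u k x))) \<noteq> \<infinity>"
      using ui by (intro nn_integral_PInf_AE) auto
    then show ?thesis by eventually_elim (auto intro: summable_suminf_not_top)
  qed
  define g where "g x = f (r 0) x + (\<Sum>k. u k x)" for x
  have gi: "integrable M g" unfolding g_def
  proof (intro Bochner_Integration.integrable_add int integrable_suminf ui sum)
    show "summable (\<lambda>k. LINT x|M. norm (u k x))"
      by (rule summable_comparison_test'[of "\<lambda>k. (1/2)^k" 0]) (use ub in \<open>auto simp: abs_of_nonneg\<close>)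
  qed
  have lim: "AE x in M. (\<lambda>n. f (r n) x) \<longlonglongrightarrow> g x"
    using sum
  proof eventually_elim
    case (elim x)
    then have "(\<lambda>n. \<Sum>k<n. u k x) \<longlonglongrightarrow> (\<Sum>k. u k x)" by (rule summable_LIMSEQ[OF summable_norm_cancel])
    then have "(\<lambda>n. f (r 0) x + (\<Sum>k<n. u k x)) \<longlonglongrightarrow> g x" unfolding g_def by (intro tendsto_intros)
    moreover have "f (r 0) x + (\<Sum>k<n. u k x) = f (r n) x" for n
      unfolding u_def using sum_lessThan_telescope[of "\<lambda>k. f (r k) x" n] by simp
    ultimately show ?case by simp
  qed
  \<comment> \<open>Fatou's lemma in the second index turns the Cauchy estimate into one for the
    distance to the limit.\<close>
  have "(LINT x|M. norm (f (r n) x - g x)) \<le> (1/2)^n" for n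
  proof -
    have "(\<integral>\<^sup>+x. ennreal (norm (f (r n) x - g x)) \<partial>M) = (\<integral>\<^sup>+x. liminf (\<lambda>m. ennreal (norm (f (r n) x - f (r m) x))) \<partial>M)"
    proof (rule nn_integral_cong_AE)
      show "AE x in M. ennreal (norm (f (r n) x - g x)) = liminf (\<lambda>m. ennreal (norm (f (r n) x - f (r m) x)))"
        using lim
      proof eventually_elim
        case (elim x)
        then have "(\<lambda>m. ennreal (norm (f (r n) x - f (r m) x))) \<longlonglongrightarrow> ennreal (norm (f (r n) x - g x))"
          by (intro tendsto_intros)
        then show ?case using lim_imp_Liminf[OF sequentially_bot] by metis
      qed
    qed
    also have "\<dots> \<le> liminf (\<lambda>m. \<integral>\<^sup>+x. ennreal (norm (f (r n) x - f (r m) x)) \<partial>M)"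
      using int by (intro nn_integral_liminf) auto
    also have "\<dots> \<le> ennreal ((1/2)^n)"
    proof (rule Liminf_le)
      show "\<forall>\<^sub>F m in sequentially. (\<integral>\<^sup>+x. ennreal (norm (f (r n) x - f (r m) x)) \<partial>M) \<le> ennreal ((1/2)^n)"
        using eventually_ge_at_top[of n]
      proof eventually_elim
        case (elim m)
        have "(\<integral>\<^sup>+x. ennreal (norm (f (r n) x - f (r m) x)) \<partial>M) = ennreal (LINT x|M. norm (f (r n) x - f (r m) x))"
          by (rule nn_integral_eq_integral) (use int in auto)
        also have "\<dots> \<le> ennreal ((1/2)^n)"
          by (rule ennreal_leI, rule less_imp_le, rule N) (use elim rN in auto)
        finally show ?case .
      qed
    qed simp
    finally have "(\<integral>\<^sup>+x. ennreal (norm (f (r n) x - g x)) \<partial>M) \<le> ennreal ((1/2)^n)" .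
    moreover have "(\<integral>\<^sup>+x. ennreal (norm (f (r n) x - g x)) \<partial>M) = ennreal (LINT x|M. norm (f (r n) x - g x))"
      by (rule nn_integral_eq_integral) (use int gi in auto)
    ultimately have "ennreal (LINT x|M. norm (f (r n) x - g x)) \<le> ennreal ((1/2)^n)" by (simp only:)
    then show ?thesis by (rule ennreal_le_iff[THEN iffD1, rotated]) simp
  qed
  moreover have "0 \<le> (LINT x|M. norm (f (r n) x - g x))" for n
    by (rule Bochner_Integration.integral_nonneg) (rule norm_ge_zero)
  ultimately have "(\<lambda>n. LINT x|M. norm (f (r n) x - g x)) \<longlonglongrightarrow> 0"
    by (intro real_tendsto_sandwich[OF always_eventually always_eventually tendsto_const LIMSEQ_power_zero[of "1/2::real"]] allI) simp_all
  then show ?thesis by (rule that[OF r gi _ lim])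
qed

section \<open>Cauchy transforms and factorization\<close>

lemma integrable_cauchy_kernel:
  assumes c: "c \<in> borel_measurable lebesgue" "integrable lebesgue (\<lambda>t. cmod (c t) / cmod (of_real t + \<i>))"
    and z: "0 < Im z"
  shows "integrable lebesgue (\<lambda>t. c t / (of_real t - z))"
proof (rule Bochner_Integration.integrable_bound)
  note [measurable] = c(1) of_real_lebesgue_measurable
  show "integrable lebesgue (\<lambda>t. kernel_const z * (cmod (c t) / cmod (of_real t + \<i>)))"
    using c(2) by (rule integrable_mult_right)
  show "(\<lambda>t. c t / (of_real t - z)) \<in> borel_measurable lebesgue" by measurable
  show "AE t in lebesgue. norm (c t / (of_real t - z)) \<le> norm (kernel_const z * (cmod (c t) / cmod (of_real t + \<i>)))"
  proof (rule AE_I2)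
    fix t
    have "0 < cmod (of_real t - z)" "0 < cmod (of_real t + \<i>)"
      using of_real_diff_nonzero[OF z, of t] by (auto simp: complex_eq_iff)
    then have "1 / cmod (of_real t - z) \<le> kernel_const z / cmod (of_real t + \<i>)"
      using kernel_bound[OF z, of t] by (simp add: divide_simps mult.commute)
    then have "cmod (c t) * (1 / cmod (of_real t - z)) \<le> cmod (c t) * (kernel_const z / cmod (of_real t + \<i>))"
      by (rule mult_left_mono) simp
    moreover have "0 \<le> kernel_const z" using kernel_const_ge1[OF z] by simp
    ultimately show "norm (c t / (of_real t - z)) \<le> norm (kernel_const z * (cmod (c t) / cmod (of_real t + \<i>)))"
      by (simp add: norm_divide norm_mult mult.commute)
  qed
qed

text \<open>Differentiation under the integral with an explicit remainder: the difference quotient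
  minus the candidate derivative is exactly \<open>h\<close> times an absolutely convergent
  integral, which is bounded uniformly for \<open>cmod h < y / 2\<close>.\<close>

lemma cauchy_transform_holomorphic:
  assumes c: "c \<in> borel_measurable lebesgue" "integrable lebesgue (\<lambda>t. cmod (c t) / cmod (of_real t + \<i>))"
  shows "(\<lambda>z. LINT t|lebesgue. c t / (of_real t - z)) holomorphic_on upper_half_plane"
proof -
  note [measurable] = c(1) of_real_lebesgue_measurable
  define C where "C z = (LINT t|lebesgue. c t / (of_real t - z))" for z
  have "\<exists>D. (C has_field_derivative D) (at z)" if z: "0 < Im z" for z
  proof -
    define y where "y = Im z"
    have y: "0 < y" using z y_def by simp
    define I where "I = (LINT t|lebesgue. cmod (c t) / cmod (of_real t + \<i>))"
    have i1: "integrable lebesgue (\<lambda>t. c t / (of_real t - z))" by (rule integrable_cauchy_kernel[OF c z])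
    have i2: "integrable lebesgue (\<lambda>t. c t / (of_real t - z) ^ 2)"
    proof (rule Bochner_Integration.integrable_bound)
      show "integrable lebesgue (\<lambda>t. 1 / y * norm (c t / (of_real t - z)))"
        using i1 by (intro integrable_mult_right integrable_norm)
      show "(\<lambda>t. c t / (of_real t - z) ^ 2) \<in> borel_measurable lebesgue" by measurable
      show "AE t in lebesgue. norm (c t / (of_real t - z) ^ 2) \<le> norm (1 / y * norm (c t / (of_real t - z)))"
      proof (rule AE_I2)
        fix t
        have "0 < cmod (of_real t - z)" "y \<le> cmod (of_real t - z)"
          using of_real_diff_nonzero[OF z, of t] cmod_of_real_diff_ge[OF z, of t] by (auto simp: y_def)
        then have "1 / cmod (of_real t - z) \<le> 1 / y" using y by (simp add: divide_simps)
        then have "cmod (c t / (of_real t - z)) * (1 / cmod (of_real t - z)) \<le> cmod (c t / (of_real t - z)) * (1 / y)"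
          by (rule mult_left_mono) simp
        then show "norm (c t / (of_real t - z) ^ 2) \<le> norm (1 / y * norm (c t / (of_real t - z)))"
          using y by (simp add: norm_divide norm_mult power2_eq_square mult.commute)
      qed
    qed
    define D where "D = (LINT t|lebesgue. c t / (of_real t - z) ^ 2)"
    \<comment> \<open>Of the three kernel factors in the remainder one is compared with
      \<open>1 / cmod (of_real t + \<i>)\<close>, the second is at most \<open>1 / y\<close>, and
      the one at the shifted point is at most \<open>2 / y\<close>.\<close>
    define M where "M = 2 * kernel_const z * I / y\<^sup>2"
    have est: "cmod ((C (z + h) - C z) / h - D) \<le> M * cmod h" if h: "h \<noteq> 0" "cmod h < y / 2" for h
    proof -
      have zh: "y / 2 \<le> Im (z + h)" "0 < Im (z + h)" using abs_Im_le_cmod[of h] h y by (auto simp: y_def)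
      have i3: "integrable lebesgue (\<lambda>t. c t / (of_real t - (z + h)))" by (rule integrable_cauchy_kernel[OF c zh(2)])
      have eq: "(c t / (of_real t - (z + h)) - c t / (of_real t - z)) / h - c t / (of_real t - z) ^ 2
          = h * (c t / ((of_real t - z) ^ 2 * (of_real t - (z + h))))" for t
      proof -
        have alg: "(c t / (a - h) - c t / a) / h - c t / a ^ 2 = h * (c t / (a ^ 2 * (a - h)))" if "a \<noteq> 0" "a - h \<noteq> 0" for a
          using that h(1) by (simp add: divide_simps power2_eq_square) (simp add: algebra_simps)
        show ?thesis
          using alg[of "of_real t - z"] of_real_diff_nonzero[OF z, of t] of_real_diff_nonzero[OF zh(2), of t]
          by (simp add: diff_diff_eq)
      qed
      have i4: "integrable lebesgue (\<lambda>t. h * (c t / ((of_real t - z) ^ 2 * (of_real t - (z + h)))))"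
        unfolding eq[symmetric] using i1 i2 i3
        by (intro Bochner_Integration.integrable_diff integrable_divide) auto
      have "(C (z + h) - C z) / h - D = (LINT t|lebesgue. (c t / (of_real t - (z + h)) - c t / (of_real t - z)) / h - c t / (of_real t - z) ^ 2)"
        unfolding C_def D_def using i1 i2 i3 by simp
      also have "\<dots> = (LINT t|lebesgue. h * (c t / ((of_real t - z) ^ 2 * (of_real t - (z + h)))))" unfolding eq ..
      also have "cmod \<dots> \<le> (LINT t|lebesgue. cmod h * (2 * kernel_const z / y\<^sup>2) * (cmod (c t) / cmod (of_real t + \<i>)))"
      proof (rule norm_integral_le_AE[OF i4 _ AE_I2])
        show "integrable lebesgue (\<lambda>t. cmod h * (2 * kernel_const z / y\<^sup>2) * (cmod (c t) / cmod (of_real t + \<i>)))"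
          using c(2) by (rule integrable_mult_right)
        fix t
        have p: "0 < cmod (of_real t - z)" "0 < cmod (of_real t + \<i>)" "0 < cmod (of_real t - (z + h))"
          using of_real_diff_nonzero[OF z, of t] of_real_diff_nonzero[OF zh(2), of t] by (auto simp: complex_eq_iff)
        have q: "y \<le> cmod (of_real t - z)" "y / 2 \<le> cmod (of_real t - (z + h))"
          using cmod_of_real_diff_ge[OF z, of t] cmod_of_real_diff_ge[OF zh(2), of t] zh(1) by (auto simp: y_def)
        have a: "1 / cmod (of_real t - z) \<le> kernel_const z / cmod (of_real t + \<i>)"
          using kernel_bound[OF z, of t] p by (simp add: divide_simps mult.commute)
        have b: "1 / cmod (of_real t - z) \<le> 1 / y" using q p y by (simp add: divide_simps)
        have d: "1 / cmod (of_real t - (z + h)) \<le> 2 / y" using q p y by (simp add: divide_simps)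
        have "1 / cmod (of_real t - z) * (1 / cmod (of_real t - z)) * (1 / cmod (of_real t - (z + h)))
            \<le> kernel_const z / cmod (of_real t + \<i>) * (1 / y) * (2 / y)"
          using y kernel_const_ge1[OF z] by (intro mult_mono a b d) auto
        then have "cmod h * cmod (c t) * (1 / cmod (of_real t - z) * (1 / cmod (of_real t - z)) * (1 / cmod (of_real t - (z + h))))
            \<le> cmod h * cmod (c t) * (kernel_const z / cmod (of_real t + \<i>) * (1 / y) * (2 / y))"
          by (rule mult_left_mono) simp
        then show "cmod (h * (c t / ((of_real t - z) ^ 2 * (of_real t - (z + h)))))
            \<le> cmod h * (2 * kernel_const z / y\<^sup>2) * (cmod (c t) / cmod (of_real t + \<i>))"
          by (simp add: norm_mult norm_divide norm_power power2_eq_square mult_ac)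
      qed
      also have "\<dots> = M * cmod h" unfolding M_def I_def integral_mult_right_zero by simp
      finally show ?thesis .
    qed
    have "((\<lambda>h. (C (z + h) - C z) / h - D) \<longlongrightarrow> 0) (at 0)"
    proof (rule Lim_null_comparison)
      show "\<forall>\<^sub>F h in at 0. norm ((C (z + h) - C z) / h - D) \<le> M * cmod h"
        using est y by (auto simp: eventually_at intro!: exI[of _ "y / 2"])
      have "((\<lambda>h. M * cmod h) \<longlongrightarrow> M * cmod 0) (at 0)" by (intro tendsto_intros)
      then show "((\<lambda>h. M * cmod h) \<longlongrightarrow> 0) (at 0)" by simp
    qed
    then have "(C has_field_derivative D) (at z)" unfolding DERIV_def using LIM_zero_iff by blast
    then show ?thesis by blast
  qed
  then show ?thesis
    unfolding C_def[symmetric] using open_upper_half_plane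
    by (auto simp: holomorphic_on_open upper_half_plane_def)
qed

text \<open>A maximum principle for \<open>sqrt \<bar>F\<bar>\<close>, which is subharmonic: at an interior maximum of the
  difference with a harmonic function \<open>F\<close> does not vanish, so that a local holomorphic square root
  reduces the claim to the maximum modulus principle.  The term with \<open>ln\<close> forces the maximum to be
  attained.\<close>

lemma sqrt_cmod_le_harmonic_majorant:
  assumes holF: "F holomorphic_on upper_half_plane" and contF: "continuous_on {z. 0 \<le> Im z} F"
    and B: "\<And>z. 0 \<le> Im z \<Longrightarrow> cmod (F z) \<le> B"
    and hol\<Phi>: "\<Phi> holomorphic_on upper_half_plane" and contU: "continuous_on {z. 0 \<le> Im z} U"
    and U\<Phi>: "\<And>z. 0 < Im z \<Longrightarrow> U z = Re (\<Phi> z)" and U0: "\<And>z. 0 \<le> Im z \<Longrightarrow> 0 \<le> U z"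
    and bdry: "\<And>x. sqrt (cmod (F (of_real x))) \<le> U (of_real x)"
    and z: "0 < Im z"
  shows "sqrt (cmod (F z)) \<le> Re (\<Phi> z)"
proof (rule ccontr)
  assume "\<not> ?thesis"
  then have neg: "U z < sqrt (cmod (F z))" using U\<Phi>[OF z] by simp
  have ge1: "1 \<le> cmod (w + \<i>)" if "0 \<le> Im w" for w
    using abs_Im_le_cmod[of "w + \<i>"] that by simp
  define l where "l = ln (cmod (z + \<i>)) + 1"
  \<comment> \<open>With this choice the logarithmic penalty at \<open>z\<close> uses up at most
    half of the assumed excess, so that \<open>v z\<close> stays positive; the summand 1 in
    \<open>l\<close> secures a positive denominator.\<close>
  define d where "d = (sqrt (cmod (F z)) - U z) / (2 * l)"
  have lnz: "0 < l" using ge1[of z] z by (simp add: l_def add_nonneg_pos)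
  have d: "0 < d" using neg lnz by (simp add: d_def)
  define v where "v = (\<lambda>w. sqrt (cmod (F w)) - U w - d * ln (cmod (w + \<i>)))"
  have "d * ln (cmod (z + \<i>)) \<le> d * l" using d by (simp add: l_def)
  also have "\<dots> = (sqrt (cmod (F z)) - U z) / 2" using lnz by (simp add: d_def)
  finally have vz: "0 < v z" using neg by (simp add: v_def)
  have contv: "continuous_on {w. 0 \<le> Im w} v" unfolding v_def
    using contF contU ge1 by (intro continuous_intros) force+
  \<comment> \<open>Outside this radius the penalty alone is at least \<open>sqrt B\<close>, so
    positive values of \<open>v\<close> occur only in a compact set.\<close>
  define R where "R = 1 + exp (sqrt B / d)"
  have far: "v w \<le> 0" if "0 \<le> Im w" "R \<le> cmod w" for w
  proof -
    have "exp (sqrt B / d) \<le> cmod (w + \<i>)"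
      using that norm_triangle_ineq2[of w "- \<i>"] by (simp add: R_def)
    then have "sqrt B / d \<le> ln (cmod (w + \<i>))" using ge1[OF that(1)] by (subst ln_ge_iff) auto
    then have "sqrt B \<le> d * ln (cmod (w + \<i>))" using d by (simp add: divide_simps mult.commute)
    moreover have "sqrt (cmod (F w)) \<le> sqrt B" using B[OF that(1)] by simp
    ultimately show ?thesis using U0[OF that(1)] unfolding v_def by linarith
  qed
  define K where "K = {w. 0 \<le> Im w} \<inter> cball 0 R"
  have K: "compact K" unfolding K_def
    using closed_halfspace_Im_ge[of 0] by (intro closed_Int_compact) auto
  have near: "w \<in> K" if "0 \<le> Im w" "0 < v w" for w
  proof -
    have "\<not> R \<le> cmod w" using far[OF that(1)] that by auto
    then show ?thesis using that by (simp add: K_def)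
  qed
  have zK: "z \<in> K" by (rule near) (use vz z in auto)
  have contK: "continuous_on K v" by (rule continuous_on_subset[OF contv]) (simp add: K_def)
  obtain z1 where z1: "z1 \<in> K" "\<And>w. w \<in> K \<Longrightarrow> v w \<le> v z1"
    using continuous_attains_sup[OF K _ contK] zK by auto
  define m where "m = v z1"
  have m: "0 < m" using z1(2)[OF zK] vz by (simp add: m_def)
  have max: "v w \<le> m" if "0 \<le> Im w" for w
  proof (cases "w \<in> K")
    case True then show ?thesis using z1 by (simp add: m_def)
  next
    case False then show ?thesis using far[OF that] that m by (auto simp: K_def)
  qed
  \<comment> \<open>Among the maximum points one with largest real part is selected: once the
    maximum is seen to spread over a whole disc, a point further to the right contradicts this
    choice.\<close>
  define S where "S = {w \<in> K. v w = m}"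
  have "compact S"
  proof -
    have "closedin (top_of_set K) (K \<inter> v -` {m})"
      by (rule continuous_closedin_preimage[OF contK]) simp
    moreover have "K \<inter> v -` {m} = S" by (auto simp: S_def)
    ultimately show ?thesis using K closedin_compact by metis
  qed
  moreover have "z1 \<in> S" using z1 by (simp add: S_def m_def)
  ultimately obtain z0 where z0: "z0 \<in> S" "\<And>w. w \<in> S \<Longrightarrow> Re w \<le> Re z0"
    using continuous_attains_sup[of S Re, OF _ _ continuous_on_Re[OF continuous_on_id]] by auto
  have vz0: "v z0 = m" and Im0: "0 \<le> Im z0" using z0(1) by (auto simp: S_def K_def)
  have Imz0: "0 < Im z0"
  proof (rule ccontr)
    assume "\<not> 0 < Im z0"
    then have r: "z0 = of_real (Re z0)" using Im0 by (simp add: complex_eq_iff)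
    have "0 \<le> d * ln (cmod (z0 + \<i>))" using d ge1[OF Im0] by simp
    then have "v z0 \<le> 0" using bdry[of "Re z0"] r by (simp add: v_def)
    then show False using m vz0 by simp
  qed
  have F0: "F z0 \<noteq> 0"
  proof
    assume "F z0 = 0"
    moreover have "0 \<le> d * ln (cmod (z0 + \<i>))" using d ge1[OF Im0] by simp
    ultimately show False using vz0 m U0[OF Im0] by (simp add: v_def)
  qed
  have "isCont F z0"
    using holomorphic_on_imp_continuous_on[OF holF] open_upper_half_plane Imz0
    by (simp add: continuous_on_eq_continuous_at upper_half_plane_def)
  then obtain r1 where r1: "0 < r1" "\<And>w. dist w z0 < r1 \<Longrightarrow> dist (F w) (F z0) < cmod (F z0)"
    using F0 by (metis continuous_at_eps_delta dist_commute zero_less_norm_iff)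
  define r where "r = min r1 (Im z0)"
  have r: "0 < r" using r1 Imz0 by (simp add: r_def)
  have ballU: "0 < Im w" if "w \<in> ball z0 r" for w
    using that abs_Im_le_cmod[of "z0 - w"] by (auto simp: r_def dist_norm)
  \<comment> \<open>Up to a unimodular constant a holomorphic square root of \<open>F\<close> near
    \<open>z0\<close>, positive at \<open>z0\<close>: on the small ball \<open>F w / F z0\<close>
    lies in the right half-plane, away from the branch cut.\<close>
  define g where "g = (\<lambda>w. of_real (sqrt (cmod (F z0))) * csqrt (F w / F z0))"
  have pos: "0 < Re (F w / F z0)" if "w \<in> ball z0 r" for w
  proof -
    have "cmod (F w - F z0) < cmod (F z0)" using r1(2)[of w] that by (simp add: r_def dist_norm norm_minus_commute)
    then have "cmod (F w / F z0 - 1) < 1" using F0 by (simp add: diff_divide_distrib[symmetric] norm_divide divide_simps)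
    then show ?thesis using abs_Re_le_cmod[of "F w / F z0 - 1"] by simp
  qed
  have cg: "cmod (g w) = sqrt (cmod (F w))" for w
    using F0 by (simp add: g_def norm_mult norm_divide real_sqrt_divide)
  have g0: "g z0 = of_real (sqrt (cmod (F z0)))" using F0 by (simp add: g_def)
  \<comment> \<open>\<open>1 - \<i> * w\<close> equals \<open>- \<i> * (w + \<i>)\<close> and has
    positive real part, so its logarithm is holomorphic with real part
    \<open>ln (cmod (w + \<i>))\<close>. Hence the modulus of \<open>E\<close> at \<open>w\<close>
    is at most \<open>exp (v w)\<close>, with equality at \<open>z0\<close>.\<close>
  define E where "E = (\<lambda>w. exp (g w - \<Phi> w - of_real d * Ln (1 - \<i> * w)))"
  have L: "Re (Ln (1 - \<i> * w)) = ln (cmod (w + \<i>))" if "0 < Im w" for w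
  proof -
    have eq: "1 - \<i> * w = - \<i> * (w + \<i>)" by (simp add: algebra_simps)
    have "1 - \<i> * w \<noteq> 0" using that by (auto simp: complex_eq_iff)
    then have "Re (Ln (1 - \<i> * w)) = ln (cmod (1 - \<i> * w))" by simp
    also have "cmod (1 - \<i> * w) = cmod (w + \<i>)" unfolding eq by (simp only: norm_mult norm_minus_cancel norm_ii mult_1)
    finally show ?thesis .
  qed
  have cE: "cmod (E w) = exp (Re (g w) - U w - d * ln (cmod (w + \<i>)))" if "0 < Im w" for w
    using L[OF that] U\<Phi>[OF that] by (simp add: E_def)
  have holE: "E holomorphic_on ball z0 r"
  proof -
    have sub: "ball z0 r \<subseteq> upper_half_plane" using ballU by (auto simp: upper_half_plane_def)
    have "F w / F z0 \<notin> \<real>\<^sub>\<le>\<^sub>0" if "w \<in> ball z0 r" for w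
      using pos[OF that] by (auto simp: complex_nonpos_Reals_iff)
    moreover have "1 - \<i> * w \<notin> \<real>\<^sub>\<le>\<^sub>0" if "w \<in> ball z0 r" for w
      using ballU[OF that] by (auto simp: complex_nonpos_Reals_iff)
    ultimately show ?thesis
      unfolding E_def g_def using F0
      by (intro holomorphic_intros holomorphic_on_subset[OF hol\<Phi> sub] holomorphic_on_subset[OF holF sub]) auto
  qed
  have "E constant_on ball z0 r"
  proof (rule maximum_modulus_principle[OF holE _ _ open_ball order_refl])
    fix w assume w: "w \<in> ball z0 r"
    have "Re (g w) \<le> sqrt (cmod (F w))" using complex_Re_le_cmod[of "g w"] cg by simp
    then have "cmod (E w) \<le> exp (v w)" using cE[OF ballU[OF w]] by (simp add: v_def)
    also have "\<dots> \<le> exp (v z0)" using max[of w] ballU[OF w] vz0 by simp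
    also have "\<dots> = cmod (E z0)" using cE[OF Imz0] g0 by (simp add: v_def)
    finally show "cmod (E w) \<le> cmod (E z0)" .
  qed (use r in auto)
  then have const: "E w = E z0" if "w \<in> ball z0 r" for w
    using that r unfolding constant_on_def by (metis centre_in_ball)
  define w where "w = z0 + of_real (r / 2)"
  have w: "w \<in> ball z0 r" using r by (simp add: w_def dist_norm)
  have "exp m = cmod (E z0)" using cE[OF Imz0] g0 vz0 by (simp add: v_def)
  also have "\<dots> = cmod (E w)" using const[OF w] by simp
  also have "\<dots> \<le> exp (v w)" using complex_Re_le_cmod[of "g w"] cg cE[OF ballU[OF w]] by (simp add: v_def)
  finally have "m \<le> v w" by simp
  then have "v w = m" using max[of w] ballU[OF w] by simp
  moreover have "w \<in> K" using near[of w] ballU[OF w] calculation m by simp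
  ultimately have "Re w \<le> Re z0" by (intro z0(2)) (simp add: S_def)
  then show False using r by (simp add: w_def)
qed

text \<open>Twice the usual Cauchy integral: with the denominator \<open>pi * \<i>\<close> the real
  part is exactly the Poisson integral of \<open>w\<close>, and the imaginary part is a harmonic
  conjugate of it.\<close>

definition cauchy_transform :: "(real \<Rightarrow> real) \<Rightarrow> complex \<Rightarrow> complex" where
  "cauchy_transform w z = (LINT t|lebesgue. of_real (w t) / (of_real t - z)) / (pi * \<i>)"

lemma cauchy_weight:
  assumes w: "w \<in> borel_measurable lebesgue" "integrable lebesgue (\<lambda>t. (w t)\<^sup>2)"
  shows "(\<lambda>t. complex_of_real (w t)) \<in> borel_measurable lebesgue"
    "integrable lebesgue (\<lambda>t. cmod (complex_of_real (w t)) / cmod (of_real t + \<i>))"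
proof -
  note [measurable] = w(1) of_real_lebesgue_measurable
  show m: "(\<lambda>t. complex_of_real (w t)) \<in> borel_measurable lebesgue" by measurable
  show "integrable lebesgue (\<lambda>t. cmod (complex_of_real (w t)) / cmod (of_real t + \<i>))"
  proof (rule Bochner_Integration.integrable_bound)
    show "integrable lebesgue (\<lambda>t. (w t)\<^sup>2 + 1 / (1 + t\<^sup>2))"
      using w(2) integrable_inverse_1_plus_square_lebesgue by (rule Bochner_Integration.integrable_add)
    show "(\<lambda>t. cmod (complex_of_real (w t)) / cmod (of_real t + \<i>)) \<in> borel_measurable lebesgue"
      by measurable
    show "AE t in lebesgue. norm (cmod (complex_of_real (w t)) / cmod (of_real t + \<i>)) \<le> norm ((w t)\<^sup>2 + 1 / (1 + t\<^sup>2))"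
    proof (rule AE_I2)
      fix t
      define a b where "a = \<bar>w t\<bar>" and "b = 1 / cmod (of_real t + \<i>)"
      have "0 \<le> a * b" by (simp add: a_def b_def)
      then have "a * b \<le> a\<^sup>2 + b\<^sup>2" using sum_squares_bound[of a b] by linarith
      moreover have "b\<^sup>2 = 1 / (1 + t\<^sup>2)" by (simp add: b_def power_divide cmod_of_real_plus_i_square)
      moreover have "a\<^sup>2 = (w t)\<^sup>2" by (simp add: a_def)
      ultimately show "norm (cmod (complex_of_real (w t)) / cmod (of_real t + \<i>)) \<le> norm ((w t)\<^sup>2 + 1 / (1 + t\<^sup>2))"
        by (simp add: a_def b_def)
    qed
  qed
qed

lemma cauchy_transform_hol:
  assumes "w \<in> borel_measurable lebesgue" "integrable lebesgue (\<lambda>t. (w t)\<^sup>2)"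
  shows "cauchy_transform w holomorphic_on upper_half_plane"
  unfolding cauchy_transform_def
  by (intro holomorphic_intros cauchy_transform_holomorphic cauchy_weight assms) simp

lemma Re_cauchy_transform:
  assumes w: "w \<in> borel_measurable lebesgue" "integrable lebesgue (\<lambda>t. (w t)\<^sup>2)" and z: "0 < Im z"
  shows "Re (cauchy_transform w z) = poisson_int w z"
proof -
  have i: "integrable lebesgue (\<lambda>t. of_real (w t) / (of_real t - z))"
    by (rule integrable_cauchy_kernel[OF cauchy_weight[OF w] z])
  have "Re (cauchy_transform w z) = Re ((LINT t|lebesgue. of_real (w t) / (of_real t - z)) * (1 / (pi * \<i>)))"
    by (simp add: cauchy_transform_def)
  also have "\<dots> = Re (LINT t|lebesgue. of_real (w t) / (of_real t - z) * (1 / (pi * \<i>)))"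
    by (simp only: integral_mult_left_zero)
  also have "\<dots> = (LINT t|lebesgue. Re (of_real (w t) / (of_real t - z) * (1 / (pi * \<i>))))"
    by (rule integral_Re[symmetric]) (rule integrable_mult_left[OF i])
  also have "\<dots> = poisson_int w z"
    unfolding poisson_int_def
  proof (rule Bochner_Integration.integral_cong[OF refl])
    fix t
    have "of_real (w t) / (of_real t - z) * (1 / (pi * \<i>)) = of_real (w t / pi) * (- \<i> * inverse (of_real t - z))"
      by (simp add: divide_simps)
    also have "Re \<dots> = w t / pi * Im (inverse (of_real t - z))" by simp
    also have "Im (inverse (of_real t - z)) = Im z / (cmod (of_real t - z))\<^sup>2"
      by (simp add: cmod_power2)
    finally show "Re (of_real (w t) / (of_real t - z) * (1 / (pi * \<i>))) = poisson z t *\<^sub>R w t"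
      by (simp add: poisson_def)
  qed
  finally show ?thesis .
qed

text \<open>The bound involves \<open>w\<close> only through its square integral. This makes a
  family of such transforms locally uniformly bounded, so that Montel's theorem applies.\<close>

lemma cauchy_transform_bound:
  assumes w: "w \<in> borel_measurable lebesgue" "integrable lebesgue (\<lambda>t. (w t)\<^sup>2)" and z: "0 < Im z"
  shows "cmod (cauchy_transform w z) \<le> (LINT t|lebesgue. (w t)\<^sup>2) + pi / Im z"
proof -
  have i: "integrable lebesgue (\<lambda>t. of_real (w t) / (of_real t - z))"
    by (rule integrable_cauchy_kernel[OF cauchy_weight[OF w] z])
  have ip: "integrable lebesgue (\<lambda>t. pi / Im z * poisson z t)" using integrable_poisson_kernel[OF z] by simp
  have "cmod (LINT t|lebesgue. of_real (w t) / (of_real t - z)) \<le> (LINT t|lebesgue. (w t)\<^sup>2 + pi / Im z * poisson z t)"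
  proof (rule norm_integral_le_AE[OF i Bochner_Integration.integrable_add[OF w(2) ip] AE_I2])
    fix t
    define a b where "a = \<bar>w t\<bar>" and "b = 1 / cmod (of_real t - z)"
    have "0 \<le> a * b" by (simp add: a_def b_def)
    then have "a * b \<le> a\<^sup>2 + b\<^sup>2" using sum_squares_bound[of a b] by linarith
    moreover have "b\<^sup>2 = pi / Im z * poisson z t" using z by (simp add: b_def power_divide poisson_def)
    moreover have "a\<^sup>2 = (w t)\<^sup>2" by (simp add: a_def)
    ultimately show "cmod (of_real (w t) / (of_real t - z)) \<le> (w t)\<^sup>2 + pi / Im z * poisson z t"
      by (simp add: a_def b_def norm_divide)
  qed
  also have "\<dots> = (LINT t|lebesgue. (w t)\<^sup>2) + pi / Im z"
    using integral_poisson[OF z] unfolding Bochner_Integration.integral_add[OF w(2) ip] by simp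
  finally have *: "cmod (LINT t|lebesgue. of_real (w t) / (of_real t - z)) \<le> (LINT t|lebesgue. (w t)\<^sup>2) + pi / Im z" .
  have "cmod (cauchy_transform w z) = cmod (LINT t|lebesgue. of_real (w t) / (of_real t - z)) / pi"
    by (simp add: cauchy_transform_def norm_divide norm_mult)
  also have "\<dots> \<le> cmod (LINT t|lebesgue. of_real (w t) / (of_real t - z))"
    using pi_gt3 by (simp add: divide_le_eq mult_le_cancel_left1)
  finally show ?thesis using * by simp
qed

text \<open>For \<open>w\<close> of bounded support the square of its Cauchy transform decays like \<open>1 / z\<^sup>2\<close>, so its
  integral along horizontal lines vanishes: real and imaginary parts have the same norm there.\<close>

lemma cauchy_transform_L2_compact:
  assumes w: "w \<in> borel_measurable lebesgue" "integrable lebesgue (\<lambda>t. (w t)\<^sup>2)"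
    and supp: "\<And>t. R < \<bar>t\<bar> \<Longrightarrow> w t = 0" and R: "0 \<le> R" and wi: "integrable lebesgue w" and y: "0 < y"
  shows "(\<integral>\<^sup>+x. ennreal ((cmod (cauchy_transform w (Complex x y)))\<^sup>2) \<partial>lebesgue) \<le> ennreal (2 * (LINT t|lebesgue. (w t)\<^sup>2))"
proof -
  define \<Phi> where "\<Phi> = cauchy_transform w"
  have hol: "\<Phi> holomorphic_on upper_half_plane" unfolding \<Phi>_def by (rule cauchy_transform_hol[OF w])
  \<comment> \<open>For \<open>t\<close> in the support of \<open>w\<close> and
    \<open>y / 2 \<le> Im z\<close> the triangle inequality gives
    \<open>cmod (z + \<i>) \<le> c * cmod (of_real t - z)\<close>, the source of the decay at
    infinity.\<close>
  define c where "c = 1 + (R + 1) / (y / 2)"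
  have c: "0 < c" using R y by (simp add: c_def add_pos_nonneg)
  define D where "D = c * (LINT t|lebesgue. \<bar>w t\<bar>)"
  have bound: "cmod (\<Phi> z) \<le> D / cmod (z + \<i>)" if z: "y / 2 \<le> Im z" for z
  proof -
    have z0: "0 < Im z" using z y by linarith
    have nz: "0 < cmod (z + \<i>)" using z0 by (auto simp: complex_eq_iff)
    have i: "integrable lebesgue (\<lambda>t. of_real (w t) / (of_real t - z))"
      by (rule integrable_cauchy_kernel[OF cauchy_weight[OF w] z0])
    have "cmod (LINT t|lebesgue. of_real (w t) / (of_real t - z)) \<le> (LINT t|lebesgue. c / cmod (z + \<i>) * \<bar>w t\<bar>)"
    proof (rule norm_integral_le_AE[OF i _ AE_I2])
      show "integrable lebesgue (\<lambda>t. c / cmod (z + \<i>) * \<bar>w t\<bar>)" using wi by simp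
      fix t
      show "cmod (of_real (w t) / (of_real t - z)) \<le> c / cmod (z + \<i>) * \<bar>w t\<bar>"
      proof (cases "w t = 0")
        case False
        then have t: "\<bar>t\<bar> \<le> R" using supp[of t] by linarith
        have ge: "y / 2 \<le> cmod (of_real t - z)" using cmod_of_real_diff_ge[OF z0, of t] z by linarith
        have "cmod (z + \<i>) \<le> cmod (of_real t - z) + cmod (of_real t + \<i>)"
          using norm_triangle_ineq4[of "of_real t + \<i>" "of_real t - z"] by (simp add: algebra_simps)
        also have "cmod (of_real t + \<i>) \<le> R + 1" using norm_triangle_ineq[of "of_real t" \<i>] t by simp
        also have "R + 1 \<le> (R + 1) / (y / 2) * cmod (of_real t - z)"
        proof -
          have "1 \<le> cmod (of_real t - z) / (y / 2)" using ge y by (simp add: divide_simps)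
          then have "(R + 1) * 1 \<le> (R + 1) * (cmod (of_real t - z) / (y / 2))"
            by (rule mult_left_mono) (use R in simp)
          then show ?thesis by (simp only: mult_1_right times_divide_eq_right times_divide_eq_left)
        qed
        finally have "cmod (z + \<i>) \<le> c * cmod (of_real t - z)" by (simp add: c_def algebra_simps)
        moreover have "0 < cmod (of_real t - z)" using of_real_diff_nonzero[OF z0, of t] by simp
        ultimately have "1 / cmod (of_real t - z) \<le> c / cmod (z + \<i>)" using nz by (simp add: divide_simps mult.commute)
        from mult_right_mono[OF this, of "\<bar>w t\<bar>"] show ?thesis by (simp add: norm_divide)
      qed simp
    qed
    also have "\<dots> = D / cmod (z + \<i>)" unfolding integral_mult_right_zero by (simp add: D_def)
    finally have *: "cmod (LINT t|lebesgue. of_real (w t) / (of_real t - z)) \<le> D / cmod (z + \<i>)" .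
    have "cmod (\<Phi> z) = cmod (LINT t|lebesgue. of_real (w t) / (of_real t - z)) / pi"
      by (simp add: \<Phi>_def cauchy_transform_def norm_divide norm_mult)
    also have "\<dots> \<le> cmod (LINT t|lebesgue. of_real (w t) / (of_real t - z))"
      using pi_gt3 by (simp add: divide_le_eq mult_le_cancel_left1)
    finally show ?thesis using * by simp
  qed
  have bound2: "cmod ((\<Phi> (z + \<i> * of_real y))\<^sup>2) \<le> D\<^sup>2 / (cmod (z + \<i>))\<^sup>2" if "0 \<le> Im z" for z
  proof -
    have le: "cmod (z + \<i>) \<le> cmod (z + \<i> * of_real y + \<i>)"
    proof -
      have "(Im z + 1)\<^sup>2 \<le> (Im z + y + 1)\<^sup>2" using that y by (intro power_mono) auto
      then show ?thesis by (simp add: cmod_def)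
    qed
    have nz: "0 < cmod (z + \<i>)" using that by (auto simp: complex_eq_iff)
    have D0: "0 \<le> D" unfolding D_def using c by (intro mult_nonneg_nonneg Bochner_Integration.integral_nonneg) auto
    have "cmod (\<Phi> (z + \<i> * of_real y)) \<le> D / cmod (z + \<i> * of_real y + \<i>)"
      by (rule bound) (use that y in auto)
    also have "\<dots> \<le> D / cmod (z + \<i>)" using le nz D0 less_le_trans[OF nz le] by (intro divide_left_mono mult_pos_pos)
    finally show ?thesis unfolding norm_power power_divide[symmetric] by (intro power_mono) auto
  qed
  have "(LINT t|lebesgue. (\<Phi> (of_real t + \<i> * of_real y))\<^sup>2) = 0"
  proof (rule cauchy_vanishing[of y])
    have "(\<Phi> \<circ> (\<lambda>z. z + \<i> * of_real y)) holomorphic_on {z. - y < Im z}"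
      by (rule holomorphic_on_compose_gen[OF _ hol]) (auto intro!: holomorphic_intros simp: upper_half_plane_def)
    then show "(\<lambda>z. (\<Phi> (z + \<i> * of_real y))\<^sup>2) holomorphic_on {z. - y < Im z}"
      by (intro holomorphic_intros) (simp add: o_def)
  qed (use bound2 y in auto)
  then have zero: "(LINT x|lebesgue. (\<Phi> (Complex x y))\<^sup>2) = 0" by (simp add: Complex_eq)
  have m: "(\<lambda>x. \<Phi> (Complex x y)) \<in> borel_measurable lebesgue" by (rule horizontal_measurable[OF hol y])
  have isq: "integrable lebesgue (\<lambda>x. (\<Phi> (Complex x y))\<^sup>2)"
  proof (rule Bochner_Integration.integrable_bound)
    show "integrable lebesgue (\<lambda>x. D\<^sup>2 * (1 / (1 + x\<^sup>2)))"
      using integrable_inverse_1_plus_square_lebesgue by (rule integrable_mult_right)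
    show "(\<lambda>x. (\<Phi> (Complex x y))\<^sup>2) \<in> borel_measurable lebesgue" using m by measurable
    show "AE x in lebesgue. norm ((\<Phi> (Complex x y))\<^sup>2) \<le> norm (D\<^sup>2 * (1 / (1 + x\<^sup>2)))"
      using bound2[of "of_real _"] by (intro AE_I2) (simp add: Complex_eq cmod_of_real_plus_i_square)
  qed
  have U: "Re (\<Phi> (Complex x y)) = poisson_int w (Complex x y)" for x
    unfolding \<Phi>_def by (rule Re_cauchy_transform[OF w]) (use y in simp)
  have isq2: "integrable lebesgue (\<lambda>x. (cmod (\<Phi> (Complex x y)))\<^sup>2)"
    using integrable_norm[OF isq] by (simp add: norm_power)
  have "(LINT x|lebesgue. Re ((\<Phi> (Complex x y))\<^sup>2)) = 0" using integral_Re[OF isq] zero by simp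
  moreover have eq: "(cmod a)\<^sup>2 = 2 * (Re a)\<^sup>2 - Re (a\<^sup>2)" for a
    unfolding cmod_power2 by (simp add: power2_eq_square)
  have iRe: "integrable lebesgue (\<lambda>x. (Re (\<Phi> (Complex x y)))\<^sup>2)"
  proof (rule Bochner_Integration.integrable_bound[OF isq2])
    show "(\<lambda>x. (Re (\<Phi> (Complex x y)))\<^sup>2) \<in> borel_measurable lebesgue" using m by measurable
    show "AE x in lebesgue. norm ((Re (\<Phi> (Complex x y)))\<^sup>2) \<le> norm ((cmod (\<Phi> (Complex x y)))\<^sup>2)"
      by (intro AE_I2) (simp add: cmod_power2)
  qed
  ultimately have "(LINT x|lebesgue. (cmod (\<Phi> (Complex x y)))\<^sup>2) = 2 * (LINT x|lebesgue. (Re (\<Phi> (Complex x y)))\<^sup>2)"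
    unfolding eq using integrable_Re[OF isq] by (subst Bochner_Integration.integral_diff) auto
  also have "(LINT x|lebesgue. (Re (\<Phi> (Complex x y)))\<^sup>2) \<le> (LINT t|lebesgue. (w t)\<^sup>2)"
  proof -
    have "(\<integral>\<^sup>+x. ennreal (norm (poisson_int w (Complex x y)) powr 2) \<partial>lebesgue) \<le> (\<integral>\<^sup>+t. ennreal (norm (w t) powr 2) \<partial>lebesgue)"
      by (rule poisson_int_Lp_contraction[OF y _ integrable_imp_poisson_integrable[OF wi]]) simp
    then have "(\<integral>\<^sup>+x. ennreal ((Re (\<Phi> (Complex x y)))\<^sup>2) \<partial>lebesgue) \<le> (\<integral>\<^sup>+t. ennreal ((w t)\<^sup>2) \<partial>lebesgue)"
      by (simp add: U)
    then have "ennreal (LINT x|lebesgue. (Re (\<Phi> (Complex x y)))\<^sup>2) \<le> ennreal (LINT t|lebesgue. (w t)\<^sup>2)"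
      using nn_integral_eq_integral[OF iRe] nn_integral_eq_integral[OF w(2)] by simp
    then show ?thesis by (subst (asm) ennreal_le_iff) auto
  qed
  finally show ?thesis
    using nn_integral_eq_integral[OF isq2] unfolding \<Phi>_def by (simp add: ennreal_leI)
qed

lemma nn_integral_Fatou_le:
  assumes m: "\<And>n. f n \<in> borel_measurable M" and lim: "AE x in M. (\<lambda>n. f n x) \<longlonglongrightarrow> g x"
    and le: "\<And>n. (\<integral>\<^sup>+x. f n x \<partial>M) \<le> c"
  shows "(\<integral>\<^sup>+x. g x \<partial>M) \<le> (c::ennreal)"
proof -
  have "(\<integral>\<^sup>+x. g x \<partial>M) = (\<integral>\<^sup>+x. liminf (\<lambda>n. f n x) \<partial>M)"
  proof (rule nn_integral_cong_AE)
    show "AE x in M. g x = liminf (\<lambda>n. f n x)"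
      using lim by eventually_elim (metis lim_imp_Liminf sequentially_bot)
  qed
  also have "\<dots> \<le> liminf (\<lambda>n. \<integral>\<^sup>+x. f n x \<partial>M)" by (rule nn_integral_liminf[OF m])
  also have "\<dots> \<le> c" by (rule Liminf_le) (simp_all add: le)
  finally show ?thesis .
qed

text \<open>Truncation to \<open>{- real n..real n}\<close>: boundedness makes the truncated weights
  integrable, their transforms converge pointwise by dominated convergence, and Fatou's lemma
  carries the uniform bound over.\<close>

lemma cauchy_transform_L2:
  assumes w: "w \<in> borel_measurable lebesgue" "integrable lebesgue (\<lambda>t. (w t)\<^sup>2)"
    and bd: "\<And>t. \<bar>w t\<bar> \<le> B" and y: "0 < y"
  shows "(\<integral>\<^sup>+x. ennreal ((cmod (cauchy_transform w (Complex x y)))\<^sup>2) \<partial>lebesgue) \<le> ennreal (2 * (LINT t|lebesgue. (w t)\<^sup>2))"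
proof -
  define v where "v n t = indicat_real {- real n..real n} t * w t" for n t
  have v2: "(v n t)\<^sup>2 \<le> (w t)\<^sup>2" for n t by (auto simp: v_def indicator_def)
  have vm: "v n \<in> borel_measurable lebesgue" for n unfolding v_def[abs_def] using w(1) by measurable
  have vi2: "integrable lebesgue (\<lambda>t. (v n t)\<^sup>2)" for n
  proof (rule Bochner_Integration.integrable_bound[OF w(2)])
    show "(\<lambda>t. (v n t)\<^sup>2) \<in> borel_measurable lebesgue" using vm[of n] by measurable
  qed (use v2 in auto)
  have vi: "integrable lebesgue (v n)" for n
    by (rule integrableI_bounded_set[where A = "{- real n..real n}" and B = B])
       (use vm bd in \<open>auto simp: v_def indicator_def\<close>)
  have le: "(\<integral>\<^sup>+x. ennreal ((cmod (cauchy_transform (v n) (Complex x y)))\<^sup>2) \<partial>lebesgue) \<le> ennreal (2 * (LINT t|lebesgue. (w t)\<^sup>2))" for n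
  proof -
    have "(\<integral>\<^sup>+x. ennreal ((cmod (cauchy_transform (v n) (Complex x y)))\<^sup>2) \<partial>lebesgue) \<le> ennreal (2 * (LINT t|lebesgue. (v n t)\<^sup>2))"
      by (rule cauchy_transform_L2_compact[OF vm vi2 _ _ vi y, of "real n"]) (auto simp: v_def indicator_def)
    also have "\<dots> \<le> ennreal (2 * (LINT t|lebesgue. (w t)\<^sup>2))"
      by (intro ennreal_leI mult_left_mono integral_mono vi2 w v2) simp
    finally show ?thesis .
  qed
  have lim: "(\<lambda>n. cauchy_transform (v n) z) \<longlonglongrightarrow> cauchy_transform w z" if z: "0 < Im z" for z
    unfolding cauchy_transform_def
  proof (intro tendsto_divide tendsto_const)
    have i: "integrable lebesgue (\<lambda>t. of_real (w t) / (of_real t - z))"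
      by (rule integrable_cauchy_kernel[OF cauchy_weight[OF w] z])
    show "(\<lambda>n. LINT t|lebesgue. complex_of_real (v n t) / (of_real t - z)) \<longlonglongrightarrow> (LINT t|lebesgue. complex_of_real (w t) / (of_real t - z))"
    proof (rule integral_dominated_convergence[OF _ _ integrable_norm[OF i]])
      show "AE t in lebesgue. (\<lambda>n. complex_of_real (v n t) / (of_real t - z)) \<longlonglongrightarrow> complex_of_real (w t) / (of_real t - z)"
      proof (rule AE_I2)
        fix t :: real
        obtain N :: nat where N: "\<bar>t\<bar> \<le> real N" using real_arch_simple by blast
        have "\<forall>\<^sub>F n in sequentially. complex_of_real (v n t) / (of_real t - z) = complex_of_real (w t) / (of_real t - z)"
          using eventually_ge_at_top[of N] by eventually_elim (use N in \<open>auto simp: v_def indicator_def\<close>)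
        then show "(\<lambda>n. complex_of_real (v n t) / (of_real t - z)) \<longlonglongrightarrow> complex_of_real (w t) / (of_real t - z)"
          by (rule tendsto_eventually)
      qed
      show "AE t in lebesgue. norm (complex_of_real (v n t) / (of_real t - z)) \<le> norm (complex_of_real (w t) / (of_real t - z))" for n
        by (intro AE_I2) (auto simp: v_def indicator_def)
      show "(\<lambda>t. complex_of_real (w t) / (of_real t - z)) \<in> borel_measurable lebesgue" using i by auto
      show "(\<lambda>t. complex_of_real (v n t) / (of_real t - z)) \<in> borel_measurable lebesgue" for n
        using integrable_cauchy_kernel[OF cauchy_weight[OF vm vi2] z] by auto
    qed
  qed simp
  show ?thesis
  proof (rule nn_integral_Fatou_le[OF _ _ le])
    show "(\<lambda>x. ennreal ((cmod (cauchy_transform (v n) (Complex x y)))\<^sup>2)) \<in> borel_measurable lebesgue" for n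
      using horizontal_measurable[OF cauchy_transform_hol[OF vm vi2] y, of n] by measurable
    show "AE x in lebesgue. (\<lambda>n. ennreal ((cmod (cauchy_transform (v n) (Complex x y)))\<^sup>2)) \<longlonglongrightarrow> ennreal ((cmod (cauchy_transform w (Complex x y)))\<^sup>2)"
      by (intro AE_I2 tendsto_intros lim) (use y in simp)
  qed
qed

text \<open>At a real point the closed half-plane is split into the open half-plane, where
  \<open>poisson_int_tendsto_boundary\<close> gives the limit, and the axis, where the limit is
  continuity of \<open>w\<close>.\<close>

lemma poisson_extension_continuous:
  fixes w :: "real \<Rightarrow> real"
  assumes c: "continuous_on upper_half_plane (poisson_int w)" and w: "continuous_on UNIV w" "poisson_integrable w"
  shows "continuous_on {z. 0 \<le> Im z} (\<lambda>z. if 0 < Im z then poisson_int w z else w (Re z))"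
    (is "continuous_on _ ?U")
  unfolding continuous_on_def
proof
  fix z assume "z \<in> {z. 0 \<le> Im z}"
  then consider "0 < Im z" | "Im z = 0" by force
  then show "(?U \<longlongrightarrow> ?U z) (at z within {z. 0 \<le> Im z})"
  proof cases
    case 1
    then have "isCont (poisson_int w) z"
      using c open_upper_half_plane by (auto simp: continuous_on_eq_continuous_at upper_half_plane_def)
    then have "(poisson_int w \<longlongrightarrow> ?U z) (at z)" using 1 by (simp add: isCont_def)
    moreover have "\<forall>\<^sub>F u in at z. u \<in> upper_half_plane"
      by (rule eventually_at_in_open') (use open_upper_half_plane 1 in \<open>auto simp: upper_half_plane_def\<close>)
    then have "\<forall>\<^sub>F u in at z. poisson_int w u = ?U u"
      by eventually_elim (simp add: upper_half_plane_def)
    ultimately have "(?U \<longlongrightarrow> ?U z) (at z)" by (rule Lim_transform_eventually)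
    then show ?thesis by (rule tendsto_within_subset) simp
  next
    case 2
    then have z: "z = of_real (Re z)" by (simp add: complex_eq_iff)
    have Uz: "?U z = w (Re z)" using 2 by simp
    have "isCont w (Re z)" using w(1) by (simp add: continuous_on_eq_continuous_at)
    then have "(poisson_int w \<longlongrightarrow> w (Re z)) (at z within {u. 0 < Im u})"
      using poisson_int_tendsto_boundary[OF w(2), of "Re z"] z by simp
    moreover have "\<forall>\<^sub>F u in at z within {u. 0 < Im u}. poisson_int w u = ?U u"
      by (simp add: eventually_at_filter)
    ultimately have 1: "(?U \<longlongrightarrow> ?U z) (at z within {u. 0 < Im u})"
      unfolding Uz by (rule Lim_transform_eventually)
    have "isCont (\<lambda>u. w (Re u)) z"
      using continuous_on_compose2[OF w(1) continuous_on_Re[OF continuous_on_id], of UNIV]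
      by (simp add: continuous_on_eq_continuous_at)
    then have "((\<lambda>u. w (Re u)) \<longlongrightarrow> w (Re z)) (at z within {u. Im u = 0})"
      unfolding isCont_def by (rule tendsto_within_subset) simp
    moreover have "\<forall>\<^sub>F u in at z within {u. Im u = 0}. w (Re u) = ?U u"
      by (simp add: eventually_at_filter)
    ultimately have 2: "(?U \<longlongrightarrow> ?U z) (at z within {u. Im u = 0})"
      unfolding Uz by (rule Lim_transform_eventually)
    have "{u. 0 \<le> Im u} = {u. 0 < Im u} \<union> {u. Im u = 0}" by auto
    then show ?thesis using 1 2 by (simp add: at_within_union filterlim_sup)
  qed
qed

section \<open>Holomorphic majorants and factorization in exponent 1\<close>

lemma hardy_1_integrable:
  assumes "hardy_bound 1 K F" "0 < y" shows "integrable lebesgue (\<lambda>x. F (Complex x y))"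
proof -
  have "integrable lebesgue (\<lambda>x. cmod (F (Complex x y)))" using hardy_bound_integrable[OF assms] by simp
  moreover have "(\<lambda>x. F (Complex x y)) \<in> borel_measurable lebesgue"
    using horizontal_measurable assms by (simp add: hardy_bound_def)
  ultimately show ?thesis using integrable_norm_iff by blast
qed

text \<open>On the line at height \<open>e\<close> the function \<open>sqrt (cmod (F z))\<close> is
  continuous and bounded, as the maximum principle demands of the boundary data, and its square has
  integral at most \<open>K\<close>. The resulting bounds do not involve \<open>e\<close>, so that
  \<open>e\<close> can tend to 0.\<close>

lemma hardy_1_shifted_majorant:
  assumes H: "hardy_bound 1 K F" and K: "0 \<le> K" and e: "0 < e"
  defines "w \<equiv> \<lambda>t. sqrt (cmod (F (Complex t e)))"
  shows "cauchy_transform w holomorphic_on upper_half_plane"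
    and "\<And>z. 0 < Im z \<Longrightarrow> sqrt (cmod (F (z + \<i> * of_real e))) \<le> Re (cauchy_transform w z)"
    and "\<And>z. 0 < Im z \<Longrightarrow> cmod (cauchy_transform w z) \<le> K + pi / Im z"
    and "\<And>y. 0 < y \<Longrightarrow> (\<integral>\<^sup>+x. ennreal ((cmod (cauchy_transform w (Complex x y)))\<^sup>2) \<partial>lebesgue) \<le> ennreal (2 * K)"
proof -
  have hol: "F holomorphic_on upper_half_plane" using H by (simp add: hardy_bound_def)
  have "bounded_above_lines F" by (rule hardy_bound_imp_bounded_above_lines[OF H _ K]) simp
  then obtain B where B: "\<And>z. e \<le> Im z \<Longrightarrow> cmod (F z) \<le> B" using e by (auto simp: bounded_above_lines_def)
  have wc: "continuous_on UNIV w"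
    unfolding w_def by (intro continuous_intros continuous_on_horizontal[OF hol e])
  have wm: "w \<in> borel_measurable lebesgue" by (rule continuous_imp_lebesgue_measurable[OF wc])
  have w2: "(\<lambda>t. (w t)\<^sup>2) = (\<lambda>t. cmod (F (Complex t e)))" by (simp add: w_def)
  have wi: "integrable lebesgue (\<lambda>t. (w t)\<^sup>2)"
    unfolding w2 by (rule integrable_norm[OF hardy_1_integrable[OF H e]])
  have wK: "(LINT t|lebesgue. (w t)\<^sup>2) \<le> K"
    unfolding w2 using hardy_bound_integral_le[OF H e K] by simp
  have wB: "\<bar>w t\<bar> \<le> sqrt B" for t using B[of "Complex t e"] by (simp add: w_def)
  have wp: "poisson_integrable w" by (rule poisson_integrable_bounded[OF wm, of "sqrt B"]) (simp add: wB)
  show hol\<Phi>: "cauchy_transform w holomorphic_on upper_half_plane" by (rule cauchy_transform_hol[OF wm wi])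
  show "cmod (cauchy_transform w z) \<le> K + pi / Im z" if "0 < Im z" for z
    using cauchy_transform_bound[OF wm wi that] wK by linarith
  show "(\<integral>\<^sup>+x. ennreal ((cmod (cauchy_transform w (Complex x y)))\<^sup>2) \<partial>lebesgue) \<le> ennreal (2 * K)" if "0 < y" for y
    using cauchy_transform_L2[OF wm wi wB that] by (rule order_trans) (intro ennreal_leI mult_left_mono wK, simp)
  have Re\<Phi>: "Re (cauchy_transform w z) = poisson_int w z" if "0 < Im z" for z
    by (rule Re_cauchy_transform[OF wm wi that])
  define U where "U = (\<lambda>z. if 0 < Im z then poisson_int w z else w (Re z))"
  have "continuous_on upper_half_plane (\<lambda>z. Re (cauchy_transform w z))"
    by (intro continuous_intros holomorphic_on_imp_continuous_on hol\<Phi>)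
  then have cp: "continuous_on upper_half_plane (poisson_int w)"
    by (rule continuous_on_eq) (simp add: Re\<Phi> upper_half_plane_def)
  have contU: "continuous_on {z. 0 \<le> Im z} U"
    unfolding U_def by (rule poisson_extension_continuous[OF cp wc wp])
  have sub: "(\<lambda>z. z + \<i> * of_real e) ` {z. 0 \<le> Im z} \<subseteq> upper_half_plane"
    using e by (auto simp: upper_half_plane_def)
  show "sqrt (cmod (F (z + \<i> * of_real e))) \<le> Re (cauchy_transform w z)" if "0 < Im z" for z
  proof (rule sqrt_cmod_le_harmonic_majorant[where F = "\<lambda>z. F (z + \<i> * of_real e)" and U = U and B = B, OF _ _ _ hol\<Phi> contU _ _ _ that])
    have "(F \<circ> (\<lambda>z. z + \<i> * of_real e)) holomorphic_on upper_half_plane"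
      by (rule holomorphic_on_compose_gen[OF _ hol]) (use e in \<open>auto intro!: holomorphic_intros simp: upper_half_plane_def\<close>)
    then show "(\<lambda>z. F (z + \<i> * of_real e)) holomorphic_on upper_half_plane" by (simp add: o_def)
    show "continuous_on {z. 0 \<le> Im z} (\<lambda>z. F (z + \<i> * of_real e))"
      by (rule continuous_on_compose2[OF holomorphic_on_imp_continuous_on[OF hol] _ sub]) (intro continuous_intros)
    show "0 \<le> U z" if "0 \<le> Im z" for z
      unfolding U_def using poisson_int_nonneg[of z w] by (simp add: w_def)
    show "sqrt (cmod (F (complex_of_real x + \<i> * complex_of_real e))) \<le> U (complex_of_real x)" for x
      by (simp add: U_def w_def Complex_eq)
  qed (use B e Re\<Phi> in \<open>auto simp: U_def\<close>)
qed

text \<open>Montel's theorem provides a limit of the majorants of the shifted functions. The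
  pointwise inequality survives by continuity of \<open>F\<close>, the bound in the mean by Fatou's
  lemma.\<close>

lemma hardy_1_majorant:
  assumes H: "hardy_bound 1 K F" and K: "0 \<le> K"
  obtains \<Phi> where "\<Phi> holomorphic_on upper_half_plane"
    "\<And>z. 0 < Im z \<Longrightarrow> sqrt (cmod (F z)) \<le> Re (\<Phi> z)"
    "\<And>y. 0 < y \<Longrightarrow> (\<integral>\<^sup>+x. ennreal ((cmod (\<Phi> (Complex x y)))\<^sup>2) \<partial>lebesgue) \<le> ennreal (2 * K)"
proof -
  have hol: "F holomorphic_on upper_half_plane" using H by (simp add: hardy_bound_def)
  define e where "e n = 1 / real (Suc n)" for n
  have e: "0 < e n" for n by (simp add: e_def)
  define P where "P n = cauchy_transform (\<lambda>t. sqrt (cmod (F (Complex t (e n)))))" for n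
  note P = hardy_1_shifted_majorant[OF H K e, folded P_def]
  obtain \<Phi> r where \<Phi>: "\<Phi> holomorphic_on upper_half_plane" "strict_mono (r :: nat \<Rightarrow> nat)"
      "\<And>x. x \<in> upper_half_plane \<Longrightarrow> ((\<lambda>n. P (r n) x) \<longlongrightarrow> \<Phi> x) sequentially"
  proof (rule Montel[OF open_upper_half_plane, of "range P" P])
    fix C assume C: "compact C" "C \<subseteq> upper_half_plane"
    show "\<exists>B. \<forall>h\<in>range P. \<forall>z\<in>C. cmod (h z) \<le> B"
    proof (cases "C = {}")
      case False
      obtain u where u: "u \<in> C" "\<And>z. z \<in> C \<Longrightarrow> Im u \<le> Im z"
        using continuous_attains_inf[OF C(1) False continuous_on_Im[OF continuous_on_id]] by auto
      have "cmod (P n z) \<le> K + pi / Im u" if "z \<in> C" for n z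
      proof -
        have pos: "0 < Im z" "0 < Im u" using that u C by (auto simp: upper_half_plane_def)
        have "cmod (P n z) \<le> K + pi / Im z" by (rule P(3)[OF pos(1)])
        also have "pi / Im z \<le> pi / Im u" using pos u(2)[OF that] by (intro divide_left_mono) auto
        finally show ?thesis by simp
      qed
      then show ?thesis by blast
    qed simp
  qed (use P(1) in auto)
  show thesis
  proof (rule that[OF \<Phi>(1)])
    fix z assume z: "0 < Im z"
    have "isCont F z" using holomorphic_on_imp_continuous_on[OF hol] open_upper_half_plane z
      by (simp add: continuous_on_eq_continuous_at upper_half_plane_def)
    moreover have "(\<lambda>n. z + \<i> * of_real (e (r n))) \<longlonglongrightarrow> z + \<i> * of_real 0"
    proof (intro tendsto_intros)
      have "e \<longlonglongrightarrow> 0" unfolding e_def using LIMSEQ_inverse_real_of_nat by (simp add: inverse_eq_divide)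
      then show "(\<lambda>n. e (r n)) \<longlonglongrightarrow> 0" using LIMSEQ_subseq_LIMSEQ[OF _ \<Phi>(2)] by (auto simp: o_def)
    qed
    ultimately have l1: "(\<lambda>n. F (z + \<i> * of_real (e (r n)))) \<longlonglongrightarrow> F z"
      using isCont_tendsto_compose by fastforce
    have l2: "(\<lambda>n. P (r n) z) \<longlonglongrightarrow> \<Phi> z" by (rule \<Phi>(3)) (use z in \<open>simp add: upper_half_plane_def\<close>)
    show "sqrt (cmod (F z)) \<le> Re (\<Phi> z)"
      by (rule LIMSEQ_le[OF tendsto_real_sqrt[OF tendsto_norm[OF l1]] tendsto_Re[OF l2]]) (use P(2)[OF z] in auto)
  next
    fix y :: real assume y: "0 < y"
    show "(\<integral>\<^sup>+x. ennreal ((cmod (\<Phi> (Complex x y)))\<^sup>2) \<partial>lebesgue) \<le> ennreal (2 * K)"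
    proof (rule nn_integral_Fatou_le[OF _ _ P(4)[OF y, of "r _"]])
      show "(\<lambda>x. ennreal ((cmod (P (r n) (Complex x y)))\<^sup>2)) \<in> borel_measurable lebesgue" for n
        using horizontal_measurable[OF P(1) y, of "r n"] by measurable
      show "AE x in lebesgue. (\<lambda>n. ennreal ((cmod (P (r n) (Complex x y)))\<^sup>2)) \<longlonglongrightarrow> ennreal ((cmod (\<Phi> (Complex x y)))\<^sup>2)"
        by (intro AE_I2 tendsto_intros \<Phi>(3)) (use y in \<open>simp add: upper_half_plane_def\<close>)
    qed
  qed
qed

lemma hardy_bound_mono:
  assumes "hardy_bound p K B" "A holomorphic_on upper_half_plane" "0 \<le> p"
    and "\<And>z. 0 < Im z \<Longrightarrow> cmod (A z) \<le> cmod (B z)"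
  shows "hardy_bound p K A"
  unfolding hardy_bound_def
proof (intro conjI allI impI)
  fix y :: real assume y: "0 < y"
  have "(\<integral>\<^sup>+ x. ennreal (cmod (A (Complex x y)) powr p) \<partial>lebesgue) \<le> (\<integral>\<^sup>+ x. ennreal (cmod (B (Complex x y)) powr p) \<partial>lebesgue)"
    by (intro nn_integral_mono ennreal_leI powr_mono2 assms) (use y in auto)
  also have "\<dots> \<le> ennreal K" using assms(1) y by (simp add: hardy_bound_def)
  finally show "(\<integral>\<^sup>+ x. ennreal (cmod (A (Complex x y)) powr p) \<partial>lebesgue) \<le> ennreal K" .
qed fact

text \<open>Dividing by the square root of a holomorphic majorant replaces the inner-outer factorization.\<close>

lemma hardy_1_factorization:
  assumes H: "hardy_bound 1 K F" and K: "0 \<le> K"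
  obtains A B L where "hardy_bound 2 L A" "hardy_bound 2 L B" "0 < L" "\<And>z. 0 < Im z \<Longrightarrow> F z = A z * B z"
proof -
  have hol: "F holomorphic_on upper_half_plane" using H by (simp add: hardy_bound_def)
  obtain \<Phi> where \<Phi>: "\<Phi> holomorphic_on upper_half_plane"
    "\<And>z. 0 < Im z \<Longrightarrow> sqrt (cmod (F z)) \<le> Re (\<Phi> z)"
    "\<And>y. 0 < y \<Longrightarrow> (\<integral>\<^sup>+x. ennreal ((cmod (\<Phi> (Complex x y)))\<^sup>2) \<partial>lebesgue) \<le> ennreal (2 * K)"
    using hardy_1_majorant[OF H K] by blast
  \<comment> \<open>The added term has strictly positive real part and is square integrable along
    lines. It removes the zeros of \<open>\<Phi>\<close>, possible only where \<open>F\<close>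
    vanishes, without leaving exponent 2.\<close>
  define B where "B z = \<Phi> z + \<i> / (z + \<i>)" for z
  have nz: "z + \<i> \<noteq> 0" if "0 < Im z" for z using that by (auto simp: complex_eq_iff)
  have ReB: "Re (\<Phi> z) < Re (B z)" if z: "0 < Im z" for z
  proof -
    have "Re (\<i> / (z + \<i>)) = (Im z + 1) / (cmod (z + \<i>))\<^sup>2"
      by (simp add: Re_divide cmod_power2)
    also have "\<dots> > 0" using z nz[OF z] by simp
    finally show ?thesis by (simp add: B_def)
  qed
  have Bpos: "0 < Re (B z)" "sqrt (cmod (F z)) \<le> cmod (B z)" if z: "0 < Im z" for z
  proof -
    show "0 < Re (B z)" using ReB[OF z] \<Phi>(2)[OF z] real_sqrt_ge_zero[OF norm_ge_zero, of "F z"] by linarith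
    show "sqrt (cmod (F z)) \<le> cmod (B z)" using ReB[OF z] \<Phi>(2)[OF z] complex_Re_le_cmod[of "B z"] by linarith
  qed
  have holB: "B holomorphic_on upper_half_plane"
    unfolding B_def by (intro holomorphic_intros \<Phi>) (use nz in \<open>auto simp: upper_half_plane_def\<close>)
  define I where "I = (LINT t|lebesgue. 1 / (1 + t\<^sup>2 :: real))"
  have I0: "0 \<le> I" unfolding I_def by (intro Bochner_Integration.integral_nonneg) auto
  \<comment> \<open>From \<open>(a + b)\<^sup>2 \<le> 2 * a\<^sup>2 + 2 * b\<^sup>2\<close>, with
    \<open>2 * K\<close> for \<open>\<Phi>\<close> and \<open>I\<close> for the added term; the 1
    makes \<open>L\<close> positive.\<close>
  define L where "L = 2 * (2 * K) + 2 * I + 1"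
  have L: "0 < L" using K I0 by (simp add: L_def)
  have HB: "hardy_bound 2 L B"
    unfolding hardy_bound_def
  proof (intro conjI allI impI holB)
    fix y :: real assume y: "0 < y"
    have [measurable]: "(\<lambda>x. \<Phi> (Complex x y)) \<in> borel_measurable lebesgue" by (rule horizontal_measurable[OF \<Phi>(1) y])
    have le: "(cmod (B (Complex x y)))\<^sup>2 \<le> 2 * (cmod (\<Phi> (Complex x y)))\<^sup>2 + 2 * (1 / (1 + x\<^sup>2))" for x
    proof -
      define a b where "a = cmod (\<Phi> (Complex x y))" and "b = cmod (\<i> / (Complex x y + \<i>))"
      have "cmod (B (Complex x y)) \<le> a + b" unfolding B_def a_def b_def by (rule norm_triangle_ineq)
      then have "(cmod (B (Complex x y)))\<^sup>2 \<le> (a + b)\<^sup>2" by (rule power_mono) simp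
      also have "\<dots> \<le> 2 * a\<^sup>2 + 2 * b\<^sup>2" using sum_squares_bound[of a b] by (simp add: power2_sum)
      also have "b\<^sup>2 \<le> 1 / (1 + x\<^sup>2)"
      proof -
        have "1 \<le> (y + 1)\<^sup>2" using y by (simp add: one_le_power)
        moreover have "(cmod (Complex x y + \<i>))\<^sup>2 = x\<^sup>2 + (y + 1)\<^sup>2" by (simp add: cmod_power2)
        ultimately have "1 + x\<^sup>2 \<le> (cmod (Complex x y + \<i>))\<^sup>2" by simp
        moreover have "0 < 1 + x\<^sup>2" by (simp add: add_pos_nonneg)
        ultimately show ?thesis by (simp add: b_def norm_divide power_divide divide_left_mono frac_le)
      qed
      finally show ?thesis by (simp add: a_def)
    qed
    have "(\<integral>\<^sup>+ x. ennreal (cmod (B (Complex x y)) powr 2) \<partial>lebesgue)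
      \<le> (\<integral>\<^sup>+ x. 2 * ennreal ((cmod (\<Phi> (Complex x y)))\<^sup>2) + ennreal (2 * (1 / (1 + x\<^sup>2))) \<partial>lebesgue)"
    proof (rule nn_integral_mono)
      fix x
      have "ennreal (cmod (B (Complex x y)) powr 2) \<le> ennreal (2 * (cmod (\<Phi> (Complex x y)))\<^sup>2 + 2 * (1 / (1 + x\<^sup>2)))"
        using le[of x] by (intro ennreal_leI) simp
      also have "\<dots> = ennreal (2 * (cmod (\<Phi> (Complex x y)))\<^sup>2) + ennreal (2 * (1 / (1 + x\<^sup>2)))"
        by (rule ennreal_plus) auto
      also have "ennreal (2 * (cmod (\<Phi> (Complex x y)))\<^sup>2) = 2 * ennreal ((cmod (\<Phi> (Complex x y)))\<^sup>2)"
        by (simp add: ennreal_mult)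
      finally show "ennreal (cmod (B (Complex x y)) powr 2) \<le> 2 * ennreal ((cmod (\<Phi> (Complex x y)))\<^sup>2) + ennreal (2 * (1 / (1 + x\<^sup>2)))" .
    qed
    also have "\<dots> = 2 * (\<integral>\<^sup>+ x. ennreal ((cmod (\<Phi> (Complex x y)))\<^sup>2) \<partial>lebesgue) + (\<integral>\<^sup>+ x. ennreal (2 * (1 / (1 + x\<^sup>2))) \<partial>lebesgue)"
      by (subst nn_integral_add) (auto simp: nn_integral_cmult)
    also have "(\<integral>\<^sup>+ x. ennreal (2 * (1 / (1 + x\<^sup>2))) \<partial>lebesgue) = ennreal (2 * I)"
      using integrable_inverse_1_plus_square_lebesgue unfolding I_def integral_mult_right_zero[symmetric]
      by (intro nn_integral_eq_integral integrable_mult_right) auto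
    also have "2 * (\<integral>\<^sup>+ x. ennreal ((cmod (\<Phi> (Complex x y)))\<^sup>2) \<partial>lebesgue) + ennreal (2 * I) \<le> 2 * ennreal (2 * K) + ennreal (2 * I)"
      by (intro add_mono mult_left_mono \<Phi>(3) y) auto
    also have "\<dots> = ennreal (2 * (2 * K) + 2 * I)" using K I0 by (simp add: ennreal_mult ennreal_plus)
    also have "\<dots> \<le> ennreal L" by (rule ennreal_leI) (simp add: L_def)
    finally show "(\<integral>\<^sup>+ x. ennreal (cmod (B (Complex x y)) powr 2) \<partial>lebesgue) \<le> ennreal L" .
  qed
  have Bnz: "B z \<noteq> 0" if "0 < Im z" for z using Bpos(1)[OF that] by auto
  define A where "A z = F z / B z" for z
  \<comment> \<open>As \<open>cmod (F z) \<le> (cmod (B z))\<^sup>2\<close>, the quotient is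
    dominated by \<open>B\<close> and inherits its bound.\<close>
  have HA: "hardy_bound 2 L A"
  proof (rule hardy_bound_mono[OF HB])
    show "A holomorphic_on upper_half_plane"
      unfolding A_def by (intro holomorphic_intros hol holB) (use Bnz in \<open>auto simp: upper_half_plane_def\<close>)
    fix z assume z: "0 < Im z"
    have "cmod (F z) = (sqrt (cmod (F z)))\<^sup>2" by simp
    also have "\<dots> \<le> (cmod (B z))\<^sup>2" by (rule power_mono[OF Bpos(2)[OF z]]) simp
    finally show "cmod (A z) \<le> cmod (B z)" using Bnz[OF z] by (simp add: A_def norm_divide divide_le_eq power2_eq_square)
  qed simp
  show thesis by (rule that[OF HA HB L]) (use Bnz in \<open>simp add: A_def\<close>)
qed

text \<open>The factorization makes the restrictions of \<open>F\<close> a Cauchy family in the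
  mean. The heights are kept at most 1 so that weights evaluated on these lines can be dominated
  uniformly.\<close>

lemma hardy_1_L1_limit:
  assumes H: "hardy_bound 1 K F" and K: "0 \<le> K"
  obtains e :: "nat \<Rightarrow> real" and g where "\<And>n. 0 < e n" "\<And>n. e n \<le> 1" "e \<longlonglongrightarrow> 0" "integrable lebesgue g"
    "(\<lambda>n. LINT x|lebesgue. cmod (F (Complex x (e n)) - g x)) \<longlonglongrightarrow> 0"
    "AE x in lebesgue. (\<lambda>n. F (Complex x (e n))) \<longlonglongrightarrow> g x"
proof (rule hardy_1_factorization[OF H K])
  fix A B :: "complex \<Rightarrow> complex" and L :: real
  assume AB: "hardy_bound 2 L A" "hardy_bound 2 L B" "0 < L" "\<And>z. 0 < Im z \<Longrightarrow> F z = A z * B z"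
  define d where "d n = 1 / real (Suc n)" for n
  have d: "0 < d n" "d n \<le> 1" for n by (auto simp: d_def)
  have d0: "d \<longlonglongrightarrow> 0" unfolding d_def using LIMSEQ_inverse_real_of_nat by (simp add: inverse_eq_divide)
  have int: "integrable lebesgue (\<lambda>x. F (Complex x (d n)))" for n by (rule hardy_1_integrable[OF H d(1)])
  have cau: "\<exists>N. \<forall>m\<ge>N. \<forall>n\<ge>N. (LINT x|lebesgue. cmod (F (Complex x (d m)) - F (Complex x (d n)))) < c" if c: "0 < c" for c
  proof (rule hardy_2_product_cauchy[OF AB(1-3) c])
    fix b assume b: "0 < b" "\<And>s t. \<lbrakk>0 < s; s < b; 0 < t; t < b\<rbrakk> \<Longrightarrow>
      (LINT x|lebesgue. cmod (A (Complex x s) * B (Complex x s) - A (Complex x t) * B (Complex x t))) < c"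
    obtain N where N: "\<And>n. n \<ge> N \<Longrightarrow> d n < b"
      using order_tendstoD(2)[OF d0 b(1)] unfolding eventually_sequentially by blast
    have eq: "F (Complex x (d n)) = A (Complex x (d n)) * B (Complex x (d n))" for x n
      by (rule AB(4)) (use d in simp)
    have "(LINT x|lebesgue. cmod (F (Complex x (d m)) - F (Complex x (d n)))) < c" if "m \<ge> N" "n \<ge> N" for m n
      unfolding eq by (rule b(2)) (use N that d in auto)
    then show ?thesis by blast
  qed
  show thesis
  proof (rule L1_cauchy_converges[OF int cau])
    fix r :: "nat \<Rightarrow> nat" and g
    assume rg: "strict_mono r" "integrable lebesgue g"
      "(\<lambda>n. LINT x|lebesgue. cmod (F (Complex x (d (r n))) - g x)) \<longlonglongrightarrow> 0"
      "AE x in lebesgue. (\<lambda>n. F (Complex x (d (r n)))) \<longlonglongrightarrow> g x"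
    have "(\<lambda>n. d (r n)) \<longlonglongrightarrow> 0" using LIMSEQ_subseq_LIMSEQ[OF d0 rg(1)] by (simp add: o_def)
    then show thesis by (rule that[of "\<lambda>n. d (r n)" g, OF d _ rg(2-4)])
  qed
qed

text \<open>The error \<open>h n x * (u n x - g x)\<close> is small in the mean by the common bound
  \<open>C\<close>, and only \<open>h n x * g x\<close>, which has a dominating function, is left to
  dominated convergence.\<close>

lemma L1_limit_mult_bounded:
  fixes u :: "nat \<Rightarrow> real \<Rightarrow> complex" and h :: "nat \<Rightarrow> real \<Rightarrow> complex"
  assumes u: "\<And>n. integrable M (u n)" "integrable M g" "(\<lambda>n. LINT x|M. cmod (u n x - g x)) \<longlonglongrightarrow> 0"
    and h: "\<And>n. h n \<in> borel_measurable M" "k \<in> borel_measurable M" "\<And>n x. cmod (h n x) \<le> C" "\<And>x. (\<lambda>n. h n x) \<longlonglongrightarrow> k x"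
  shows "(\<lambda>n. LINT x|M. h n x * u n x) \<longlonglongrightarrow> (LINT x|M. k x * g x)"
proof -
  have int: "integrable M (\<lambda>x. h n x * v x)" if v: "integrable M v" for n and v :: "real \<Rightarrow> complex"
  proof (rule Bochner_Integration.integrable_bound)
    show "integrable M (\<lambda>x. C * cmod (v x))" using v by simp
    show "(\<lambda>x. h n x * v x) \<in> borel_measurable M" using h(1)[of n] v by measurable
    show "AE x in M. norm (h n x * v x) \<le> norm (C * cmod (v x))"
    proof (rule AE_I2)
      fix x
      have "cmod (h n x) * cmod (v x) \<le> C * cmod (v x)" by (rule mult_right_mono[OF h(3)]) simp
      then show "norm (h n x * v x) \<le> norm (C * cmod (v x))" by (simp add: norm_mult)
    qed
  qed
  have "(\<lambda>n. LINT x|M. h n x * g x) \<longlonglongrightarrow> (LINT x|M. k x * g x)"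
  proof (rule integral_dominated_convergence[where w = "\<lambda>x. C * cmod (g x)"])
    show "(\<lambda>x. k x * g x) \<in> borel_measurable M" using h(2) u(2) by measurable
    show "(\<lambda>x. h n x * g x) \<in> borel_measurable M" for n using int[OF u(2), of n] by auto
    show "integrable M (\<lambda>x. C * cmod (g x))" using u(2) by simp
    show "AE x in M. (\<lambda>n. h n x * g x) \<longlonglongrightarrow> k x * g x" by (intro AE_I2 tendsto_intros h(4))
    show "AE x in M. norm (h n x * g x) \<le> C * cmod (g x)" for n
      by (intro AE_I2) (simp add: norm_mult mult_right_mono h(3))
  qed
  moreover have "(\<lambda>n. (LINT x|M. h n x * u n x) - (LINT x|M. h n x * g x)) \<longlonglongrightarrow> 0"
  proof (rule Lim_null_comparison)
    show "\<forall>\<^sub>F n in sequentially. norm ((LINT x|M. h n x * u n x) - (LINT x|M. h n x * g x)) \<le> C * (LINT x|M. cmod (u n x - g x))"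
    proof (intro always_eventually allI)
      fix n
      have "(LINT x|M. h n x * u n x) - (LINT x|M. h n x * g x) = (LINT x|M. h n x * (u n x - g x))"
        using int[OF u(1)] int[OF u(2)] by (simp add: right_diff_distrib)
      also have "norm \<dots> \<le> (LINT x|M. C * cmod (u n x - g x))"
        by (rule norm_integral_le_AE) (use u int[of "\<lambda>x. u n x - g x"] in \<open>auto simp: norm_mult intro!: mult_right_mono h(3)\<close>)
      finally show "norm ((LINT x|M. h n x * u n x) - (LINT x|M. h n x * g x)) \<le> C * (LINT x|M. cmod (u n x - g x))"
        by (simp only: integral_mult_right_zero)
    qed
    show "(\<lambda>n. C * (LINT x|M. cmod (u n x - g x))) \<longlonglongrightarrow> 0" using tendsto_mult_right_zero[OF u(3)] .
  qed
  ultimately show ?thesis using tendsto_add by fastforce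
qed

section \<open>Nontangential limits\<close>

text \<open>The weak type (1,1) inequality for the Hardy--Littlewood maximal function, from Vitali's
  covering lemma.\<close>

lemma maximal_weak_type:
  fixes h :: "real \<Rightarrow> real"
  assumes h: "h \<in> borel_measurable lebesgue" "\<And>x. 0 \<le> h x" and fin: "(\<integral>\<^sup>+x. ennreal (h x) \<partial>lebesgue) \<le> ennreal N"
    and N: "0 \<le> N" and l: "0 < l"
  obtains W where "W \<in> sets lebesgue" "emeasure lebesgue W \<le> ennreal (10 * N / l)"
    "\<And>x r. x \<notin> W \<Longrightarrow> 0 < r \<Longrightarrow> (\<integral>\<^sup>+t. ennreal (h t) * indicator {x - r..x + r} t \<partial>lebesgue) \<le> ennreal (l * r)"
proof -
  define m where "m x r = (\<integral>\<^sup>+t. ennreal (h t) * indicator {x - r..x + r} t \<partial>lebesgue)" for x r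
  \<comment> \<open>The pairs of centre and radius at which the desired estimate fails; their radii
    are at most \<open>N / l\<close>, so that Vitali's lemma applies.\<close>
  define K where "K = {(x, r). 0 < r \<and> ennreal (l * r) < m x r}"
  have mN: "m x r \<le> ennreal N" for x r
    unfolding m_def using fin by (rule order_trans[rotated]) (auto intro!: nn_integral_mono simp: indicator_def)
  have rB: "0 < snd i \<and> snd i \<le> N / l" if i: "i \<in> K" for i
  proof -
    obtain x r where xr: "i = (x, r)" by (cases i)
    then have "0 < r" "ennreal (l * r) < ennreal N" using i mN[of x r] by (auto simp: K_def intro: less_le_trans)
    then show ?thesis using l N xr by (auto simp: ennreal_less_iff divide_simps mult.commute)
  qed
  have sub: "fst ` K \<subseteq> (\<Union>i\<in>K. cball (fst i) (snd i))" using rB by fastforce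
  obtain C where C: "countable C" "C \<subseteq> K" "pairwise (\<lambda>i j. disjnt (cball (fst i) (snd i)) (cball (fst j) (snd j))) C"
     "fst ` K \<subseteq> (\<Union>i\<in>C. cball (fst i) (5 * snd i))"
    by (rule Vitali_covering_lemma_cballs[OF sub rB])
  define W where "W = (\<Union>i\<in>C. cball (fst i) (5 * snd i))"
  have Wm: "W \<in> sets lebesgue" unfolding W_def using C(1) by (intro sets.countable_UN') auto
  have cb: "cball x r = {x - r..x + r}" for x r :: real by (auto simp: dist_real_def)
  \<comment> \<open>A sum over the countable family \<open>C\<close> is written as an integral over
    \<open>count_space C\<close>, so that Tonelli exchanges it with the Lebesgue integral. The
    constant 10 is the length of a fivefold enlarged interval divided by the original
    radius.\<close>
  have "emeasure lebesgue W \<le> (\<integral>\<^sup>+i. emeasure lebesgue (cball (fst i) (5 * snd i)) \<partial>count_space C)"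
  proof -
    have "emeasure lebesgue W = (\<integral>\<^sup>+x. indicator W x \<partial>lebesgue)" using Wm by simp
    also have "\<dots> \<le> (\<integral>\<^sup>+x. (\<integral>\<^sup>+i. indicator (cball (fst i) (5 * snd i)) x \<partial>count_space C) \<partial>lebesgue)"
    proof (rule nn_integral_mono)
      fix x show "indicator W x \<le> (\<integral>\<^sup>+i. indicator (cball (fst i) (5 * snd i)) x \<partial>count_space C)"
      proof (cases "x \<in> W")
        case True
        then obtain i where i: "i \<in> C" "x \<in> cball (fst i) (5 * snd i)" by (auto simp: W_def)
        show ?thesis using nn_integral_ge_point[OF i(1), of "\<lambda>i. indicator (cball (fst i) (5 * snd i)) x"] i(2) True by simp
      qed simp
    qed
    also have "\<dots> = (\<integral>\<^sup>+i. (\<integral>\<^sup>+x. indicator (cball (fst i) (5 * snd i)) x \<partial>lebesgue) \<partial>count_space C)"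
      by (rule nn_integral_count_space_nn_integral[OF C(1)]) (rule borel_measurable_indicator, simp)
    finally show ?thesis by simp
  qed
  also have "\<dots> \<le> (\<integral>\<^sup>+i. ennreal (10 / l) * m (fst i) (snd i) \<partial>count_space C)"
  proof (rule nn_integral_mono)
    fix i assume "i \<in> space (count_space C)"
    then have i: "i \<in> K" using C by auto
    have r: "0 < snd i" using rB[OF i] by simp
    have "emeasure lebesgue (cball (fst i) (5 * snd i)) = ennreal (10 * snd i)"
      unfolding cb using r by simp
    also have "\<dots> = ennreal (10 / l) * ennreal (l * snd i)"
      using l r by (simp add: ennreal_mult[symmetric])
    also have "\<dots> \<le> ennreal (10 / l) * m (fst i) (snd i)"
      using i by (intro mult_left_mono) (auto simp: K_def intro: less_imp_le)
    finally show "emeasure lebesgue (cball (fst i) (5 * snd i)) \<le> ennreal (10 / l) * m (fst i) (snd i)" .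
  qed
  also have "\<dots> = ennreal (10 / l) * (\<integral>\<^sup>+i. m (fst i) (snd i) \<partial>count_space C)"
    by (rule nn_integral_cmult) simp
  \<comment> \<open>The selected intervals are pairwise disjoint, so each \<open>t\<close> is
    counted at most once.\<close>
  also have "\<dots> \<le> ennreal (10 / l) * ennreal N"
  proof (rule mult_left_mono)
    have "(\<integral>\<^sup>+i. m (fst i) (snd i) \<partial>count_space C)
      = (\<integral>\<^sup>+t. (\<integral>\<^sup>+i. ennreal (h t) * indicator {fst i - snd i..fst i + snd i} t \<partial>count_space C) \<partial>lebesgue)"
      unfolding m_def
      by (intro nn_integral_count_space_nn_integral[OF C(1), symmetric] borel_measurable_times_ennreal
            measurable_compose[OF h(1) measurable_ennreal] borel_measurable_indicator) simp
    also have "\<dots> \<le> (\<integral>\<^sup>+t. ennreal (h t) \<partial>lebesgue)"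
    proof (rule nn_integral_mono)
      fix t
      show "(\<integral>\<^sup>+i. ennreal (h t) * indicator {fst i - snd i..fst i + snd i} t \<partial>count_space C) \<le> ennreal (h t)"
      proof (cases "\<exists>j\<in>C. t \<in> {fst j - snd j..fst j + snd j}")
        case True
        then obtain j where j: "j \<in> C" "t \<in> cball (fst j) (snd j)" by (auto simp: cb)
        have "i = j" if i: "i \<in> C" "t \<in> cball (fst i) (snd i)" for i
        proof (rule ccontr)
          assume "i \<noteq> j"
          then have "disjnt (cball (fst i) (snd i)) (cball (fst j) (snd j))" by (rule pairwiseD[OF C(3) i(1) j(1)])
          then show False using i(2) j(2) by (meson disjnt_iff)
        qed
        then have "ennreal (h t) * indicator {fst i - snd i..fst i + snd i} t \<le> ennreal (h t) * indicator {j} i" if "i \<in> C" for i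
          using that unfolding cb by (cases "t \<in> {fst i - snd i..fst i + snd i}") (simp_all only: indicator_simps, simp_all)
        then have "(\<integral>\<^sup>+i. ennreal (h t) * indicator {fst i - snd i..fst i + snd i} t \<partial>count_space C)
          \<le> (\<integral>\<^sup>+i. ennreal (h t) * indicator {j} i \<partial>count_space C)"
          by (intro nn_integral_mono) (simp only: space_count_space)
        also have "\<dots> = ennreal (h t) * emeasure (count_space C) {j}"
          by (rule nn_integral_cmult_indicator) (use j in simp)
        also have "emeasure (count_space C) {j} = 1"
          using j(1) by (subst emeasure_count_space_finite) auto
        also have "ennreal (h t) * 1 = ennreal (h t)" by (rule mult_1_right)
        finally show ?thesis .
      next
        case False
        then have "(\<integral>\<^sup>+i. ennreal (h t) * indicator {fst i - snd i..fst i + snd i} t \<partial>count_space C) = (\<integral>\<^sup>+i. 0 \<partial>count_space C)"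
          by (intro nn_integral_cong) (simp only: space_count_space, simp)
        then show ?thesis by simp
      qed
    qed
    also have "\<dots> \<le> ennreal N" by (rule fin)
    finally show "(\<integral>\<^sup>+i. m (fst i) (snd i) \<partial>count_space C) \<le> ennreal N" .
  qed simp
  also have "\<dots> = ennreal (10 * N / l)" using l N by (simp add: ennreal_mult[symmetric])
  finally have We: "emeasure lebesgue W \<le> ennreal (10 * N / l)" .
  have "m x r \<le> ennreal (l * r)" if "x \<notin> W" "0 < r" for x r
  proof (rule ccontr)
    assume "\<not> ?thesis"
    then have "(x, r) \<in> K" using that by (auto simp: K_def)
    then have "x \<in> W" using C(4) unfolding W_def by force
    then show False using that by simp
  qed
  then show thesis using that[OF Wm We] by (simp add: m_def)
qed

text \<open>One term of the series is enough. For the least \<open>k\<close> with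
  \<open>\<bar>s\<bar> \<le> 2 ^ k * y\<close> either \<open>k = 0\<close> and the left side is at
  most \<open>1 / y\<close>, or \<open>s\<^sup>2\<close> is at least
  \<open>4 ^ (k - 1) * y\<^sup>2\<close>, whence the constant 4.\<close>

lemma poisson_dyadic_bound:
  fixes s y :: real
  assumes y: "0 < y"
  shows "ennreal (y / (s\<^sup>2 + y\<^sup>2)) \<le> (\<Sum>k. ennreal (4 / (4 ^ k * y)) * indicator {- (2 ^ k * y)..2 ^ k * y} s)"
proof -
  obtain n :: nat where n: "\<bar>s\<bar> / y \<le> real n" using real_arch_simple by blast
  have "\<bar>s\<bar> \<le> 2 ^ n * y"
  proof -
    have "\<bar>s\<bar> / y \<le> 2 ^ n" using n of_nat_less_two_power[of n, where 'a = real] by linarith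
    then show ?thesis using y by (simp add: divide_simps)
  qed
  then have ex: "\<exists>k. \<bar>s\<bar> \<le> 2 ^ k * y" by blast
  define k where "k = (LEAST k. \<bar>s\<bar> \<le> 2 ^ k * y)"
  have k: "\<bar>s\<bar> \<le> 2 ^ k * y" unfolding k_def by (rule LeastI_ex[OF ex])
  have "y / (s\<^sup>2 + y\<^sup>2) \<le> 4 / (4 ^ k * y)"
  proof (cases k)
    case 0
    have "y / (s\<^sup>2 + y\<^sup>2) \<le> y / y\<^sup>2" using y by (intro divide_left_mono) (auto intro!: mult_pos_pos add_nonneg_pos)
    also have "\<dots> \<le> 4 / y" using y by (simp add: power2_eq_square divide_simps)
    finally show ?thesis using 0 by simp
  next
    case (Suc j)
    then have "\<not> \<bar>s\<bar> \<le> 2 ^ j * y" using not_less_Least[of j "\<lambda>k. \<bar>s\<bar> \<le> 2 ^ k * y"] by (simp add: k_def)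
    then have "(2 ^ j * y)\<^sup>2 \<le> \<bar>s\<bar>\<^sup>2" using y by (intro power_mono) auto
    moreover have "(2 ^ j * y)\<^sup>2 = 4 ^ j * y\<^sup>2"
    proof -
      have "(2::real) ^ j * 2 ^ j = 4 ^ j" by (simp flip: power_mult_distrib)
      then show ?thesis by (simp add: power2_eq_square)
    qed
    moreover have "0 \<le> y\<^sup>2" by simp
    ultimately have "4 ^ j * y\<^sup>2 \<le> s\<^sup>2 + y\<^sup>2" unfolding power2_abs by linarith
    moreover have "0 < 4 ^ j * y\<^sup>2" using y by simp
    ultimately have "y / (s\<^sup>2 + y\<^sup>2) \<le> y / (4 ^ j * y\<^sup>2)"
      using y less_le_trans by (intro divide_left_mono mult_pos_pos) (auto intro: add_nonneg_pos)
    also have "\<dots> = 4 / (4 ^ k * y)" using y Suc by (simp add: power2_eq_square)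
    finally show ?thesis .
  qed
  then have "ennreal (y / (s\<^sup>2 + y\<^sup>2)) \<le> ennreal (4 / (4 ^ k * y)) * indicator {- (2 ^ k * y)..2 ^ k * y} s"
    using k by (simp add: abs_le_iff minus_le_iff ennreal_leI)
  also have "\<dots> \<le> (\<Sum>k. ennreal (4 / (4 ^ k * y)) * indicator {- (2 ^ k * y)..2 ^ k * y} s)"
  proof -
    define f where "f k = ennreal (4 / (4 ^ k * y)) * indicator {- (2 ^ k * y)..2 ^ k * y} s" for k
    have "f k = sum f {k}" by simp
    also have "\<dots> \<le> suminf f" by (rule sum_le_suminf) auto
    finally show ?thesis unfolding f_def[abs_def] .
  qed
  finally show ?thesis .
qed

text \<open>In the cone the kernel at \<open>z\<close> is at most \<open>2 * a\<^sup>2 + 2\<close>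
  times \<open>y / ((t - x)\<^sup>2 + y\<^sup>2)\<close>, which is centred at \<open>x\<close>. Its
  dyadic decomposition meets intervals of radius \<open>2 ^ k * y\<close> about \<open>x\<close>
  with weights \<open>4 / (4 ^ k * y)\<close>, and the terms \<open>4 * l * (1 / 2) ^ k\<close> sum
  to \<open>8 * l\<close>.\<close>

lemma poisson_int_le_maximal:
  fixes h :: "real \<Rightarrow> complex"
  assumes h: "integrable lebesgue h" and l: "0 \<le> l"
    and max: "\<And>r. 0 < r \<Longrightarrow> (\<integral>\<^sup>+t. ennreal (cmod (h t)) * indicator {x - r..x + r} t \<partial>lebesgue) \<le> ennreal (l * r)"
    and a: "0 < a" and z: "z \<in> cone a x"
  shows "cmod (poisson_int h z) \<le> (2 * a\<^sup>2 + 2) * (8 * l)"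
proof -
  define y where "y = Im z"
  have y: "0 < y" and close: "\<bar>Re z - x\<bar> < a * y" using z by (auto simp: cone_def y_def)
  have hm: "h \<in> borel_measurable lebesgue" using h by auto
  have P: "poisson z t \<le> (2 * a\<^sup>2 + 2) * (y / ((t - x)\<^sup>2 + y\<^sup>2))" for t
  proof -
    have d: "(cmod (of_real t - z))\<^sup>2 = (t - Re z)\<^sup>2 + y\<^sup>2" by (simp add: cmod_power2 y_def)
    have "(t - x)\<^sup>2 \<le> 2 * (t - Re z)\<^sup>2 + 2 * (Re z - x)\<^sup>2"
      using zero_le_power2[of "(t - Re z) - (Re z - x)"] by (simp add: power2_eq_square algebra_simps)
    also have "(Re z - x)\<^sup>2 \<le> (a * y)\<^sup>2" using close by (metis abs_ge_zero less_imp_le power2_abs power_mono)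
    finally have "(t - x)\<^sup>2 + y\<^sup>2 \<le> 2 * (t - Re z)\<^sup>2 + (2 * a\<^sup>2 + 1) * y\<^sup>2" by (simp add: algebra_simps power_mult_distrib)
    also have "\<dots> \<le> (2 * a\<^sup>2 + 2) * (cmod (of_real t - z))\<^sup>2" unfolding d by (simp add: algebra_simps)
    finally have le: "(t - x)\<^sup>2 + y\<^sup>2 \<le> (2 * a\<^sup>2 + 2) * (cmod (of_real t - z))\<^sup>2" .
    have pos: "0 < (t - x)\<^sup>2 + y\<^sup>2" "0 < (cmod (of_real t - z))\<^sup>2" using y by (auto simp: d add_nonneg_pos)
    have "poisson z t \<le> y / (cmod (of_real t - z))\<^sup>2"
      unfolding poisson_def y_def[symmetric] using y pos pi_gt3 by (intro divide_left_mono) auto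
    also have "\<dots> \<le> (2 * a\<^sup>2 + 2) * (y / ((t - x)\<^sup>2 + y\<^sup>2))"
      using mult_left_mono[OF le, of y] y pos by (simp add: divide_simps mult_ac)
    finally show ?thesis .
  qed
  have "ennreal (cmod (poisson_int h z)) \<le> (\<integral>\<^sup>+t. ennreal (poisson z t * cmod (h t)) \<partial>lebesgue)"
    using poisson_jensen[of z 1 h] integrable_imp_poisson_integrable[OF h] y by (simp add: y_def)
  also have "\<dots> \<le> (\<integral>\<^sup>+t. ennreal (2 * a\<^sup>2 + 2) * (\<Sum>k. ennreal (4 / (4 ^ k * y)) * (ennreal (cmod (h t)) * indicator {x - 2 ^ k * y..x + 2 ^ k * y} t)) \<partial>lebesgue)"
  proof (rule nn_integral_mono)
    fix t
    have i: "indicator {x - r..x + r} t = (indicator {- r..r} (t - x) :: ennreal)" for r by (auto simp: indicator_def)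
    have "ennreal (poisson z t * cmod (h t)) \<le> ennreal ((2 * a\<^sup>2 + 2) * (y / ((t - x)\<^sup>2 + y\<^sup>2)) * cmod (h t))"
      by (intro ennreal_leI mult_right_mono P) simp
    also have "\<dots> = ennreal (2 * a\<^sup>2 + 2) * (ennreal (y / ((t - x)\<^sup>2 + y\<^sup>2)) * ennreal (cmod (h t)))"
    proof -
      have n: "0 \<le> y / ((t - x)\<^sup>2 + y\<^sup>2)" "0 \<le> 2 * a\<^sup>2 + 2" using y by auto
      show ?thesis
        by (simp only: ennreal_mult[OF mult_nonneg_nonneg[OF n(2,1)] norm_ge_zero] ennreal_mult[OF n(2,1)]) (simp only: mult.assoc)
    qed
    also have "\<dots> \<le> ennreal (2 * a\<^sup>2 + 2) * ((\<Sum>k. ennreal (4 / (4 ^ k * y)) * indicator {- (2 ^ k * y)..2 ^ k * y} (t - x)) * ennreal (cmod (h t)))"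
      by (intro mult_left_mono mult_right_mono poisson_dyadic_bound[OF y]) auto
    also have "\<dots> = ennreal (2 * a\<^sup>2 + 2) * (\<Sum>k. ennreal (4 / (4 ^ k * y)) * (ennreal (cmod (h t)) * indicator {x - 2 ^ k * y..x + 2 ^ k * y} t))"
      unfolding i by (subst ennreal_suminf_multc[symmetric]) (simp add: mult_ac)
    finally show "ennreal (poisson z t * cmod (h t)) \<le> \<dots>" .
  qed
  also have "\<dots> = ennreal (2 * a\<^sup>2 + 2) * (\<Sum>k. ennreal (4 / (4 ^ k * y)) * (\<integral>\<^sup>+t. ennreal (cmod (h t)) * indicator {x - 2 ^ k * y..x + 2 ^ k * y} t \<partial>lebesgue))"
    using hm by (simp add: nn_integral_cmult nn_integral_suminf)
  also have "\<dots> \<le> ennreal (2 * a\<^sup>2 + 2) * (\<Sum>k. ennreal (4 * l * (1 / 2) ^ k))"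
  proof (intro mult_left_mono suminf_le)
    fix k :: nat
    have "ennreal (4 / (4 ^ k * y)) * (\<integral>\<^sup>+t. ennreal (cmod (h t)) * indicator {x - 2 ^ k * y..x + 2 ^ k * y} t \<partial>lebesgue)
      \<le> ennreal (4 / (4 ^ k * y)) * ennreal (l * (2 ^ k * y))"
      by (intro mult_left_mono max) (use y in auto)
    also have "\<dots> = ennreal (4 / (4 ^ k * y) * (l * (2 ^ k * y)))"
      using y l by (intro ennreal_mult[symmetric]) auto
    also have "4 / (4 ^ k * y) * (l * (2 ^ k * y)) = 4 * l * (1 / 2) ^ k"
    proof -
      have "(4::real) ^ k = 2 ^ k * 2 ^ k" by (simp flip: power_mult_distrib)
      then show ?thesis using y by (simp add: power_one_over)
    qed
    finally show "ennreal (4 / (4 ^ k * y)) * (\<integral>\<^sup>+t. ennreal (cmod (h t)) * indicator {x - 2 ^ k * y..x + 2 ^ k * y} t \<partial>lebesgue)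
      \<le> ennreal (4 * l * (1 / 2) ^ k)" .
  qed auto
  also have "(\<Sum>k. ennreal (4 * l * (1 / 2) ^ k)) = ennreal (8 * l)"
  proof -
    have "(\<lambda>k. 4 * l * (1 / 2 :: real) ^ k) sums (4 * l * 2)"
      using sums_mult[OF geometric_sums[of "1/2::real"], of "4 * l"] by simp
    then show ?thesis using l by (subst suminf_ennreal2) (auto simp: sums_iff)
  qed
  also have "ennreal (2 * a\<^sup>2 + 2) * ennreal (8 * l) = ennreal ((2 * a\<^sup>2 + 2) * (8 * l))"
    using l by (intro ennreal_mult[symmetric]) auto
  finally show ?thesis using l by (subst (asm) ennreal_le_iff) auto
qed

lemma cone_mono: "a \<le> b \<Longrightarrow> cone a x \<subseteq> cone b x"
  using mult_right_mono[of a b] by (auto simp: cone_def intro: less_le_trans)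

text \<open>Cones increase with the aperture, so countably many of them suffice, as a union of null
  sets requires.\<close>

lemma has_nontangential_limit_iff_nat:
  "has_nontangential_limit F x L \<longleftrightarrow> (\<forall>n::nat. (F \<longlongrightarrow> L) (at (complex_of_real x) within cone (real (Suc n)) x))"
proof
  assume R: "\<forall>n::nat. (F \<longlongrightarrow> L) (at (complex_of_real x) within cone (real (Suc n)) x)"
  show "has_nontangential_limit F x L"
    unfolding has_nontangential_limit_def
  proof (intro allI impI)
    fix a :: real assume "0 < a"
    obtain n :: nat where "a \<le> real n" using real_arch_simple by blast
    then have "cone a x \<subseteq> cone (real (Suc n)) x" by (intro cone_mono) simp
    then show "(F \<longlongrightarrow> L) (at (complex_of_real x) within cone a x)"
      using R by (blast intro: tendsto_within_subset)
  qed
qed (simp add: has_nontangential_limit_def)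

text \<open>The set where \<open>P\<close> fails may be nonmeasurable; it is covered by the
  intersection of the sets \<open>W n\<close>, which is measurable and null.\<close>

lemma AE_from_small_sets:
  assumes "\<And>d::real. 0 < d \<Longrightarrow> \<exists>W\<in>sets M. emeasure M W \<le> ennreal d \<and> (\<forall>x\<in>space M. x \<notin> W \<longrightarrow> P x)"
  shows "AE x in M. P x"
proof -
  have "\<exists>W\<in>sets M. emeasure M W \<le> ennreal (1 / real (Suc n)) \<and> (\<forall>x\<in>space M. x \<notin> W \<longrightarrow> P x)" for n
    by (rule assms) simp
  then obtain W where W: "\<And>n. W n \<in> sets M" "\<And>n. emeasure M (W n) \<le> ennreal (1 / real (Suc n))"
    "\<And>n x. x \<in> space M \<Longrightarrow> x \<notin> W n \<Longrightarrow> P x" by metis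
  have "emeasure M (\<Inter>n. W n) \<le> ennreal (1 / real (Suc n))" for n
    using emeasure_mono[of "\<Inter>n. W n" "W n" M] W(1,2)[of n] by (auto intro: order_trans)
  moreover have "(\<lambda>n. ennreal (1 / real (Suc n))) \<longlonglongrightarrow> ennreal 0"
    by (intro tendsto_ennrealI) (use LIMSEQ_inverse_real_of_nat in \<open>simp add: inverse_eq_divide\<close>)
  ultimately have "emeasure M (\<Inter>n. W n) \<le> 0"
    by (intro LIMSEQ_le_const[where X = "\<lambda>n. ennreal (1 / real (Suc n))"]) auto
  moreover have "(\<Inter>n. W n) \<in> sets M" using W(1) by auto
  ultimately have "(\<Inter>n. W n) \<in> null_sets M" by auto
  then show ?thesis by (rule AE_I') (use W(3) in auto)
qed

text \<open>Approximating by the functions shifted upwards, which are continuous up to the boundary,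
  and controlling the error by the maximal inequality.\<close>

lemma nontangential_limit_of_L1_limit:
  fixes G :: "complex \<Rightarrow> complex"
  assumes hol: "G holomorphic_on upper_half_plane" and bd: "bounded_above_lines G"
    and e: "\<And>n. 0 < e n" and g: "integrable lebesgue g"
    and Gi: "\<And>n. integrable lebesgue (\<lambda>t. G (Complex t (e n)))"
    and rep: "\<And>z. 0 < Im z \<Longrightarrow> G z = poisson_int g z"
    and lim: "(\<lambda>n. LINT t|lebesgue. cmod (G (Complex t (e n)) - g t)) \<longlonglongrightarrow> 0"
  shows "AE x in lebesgue. has_nontangential_limit G x (g x)"
proof -
  have main: "AE x in lebesgue. \<exists>d>0. \<forall>z\<in>cone a x. dist z (of_real x) < d \<longrightarrow> dist (G z) (g x) \<le> 3 * c"
    if a: "0 < a" and c: "0 < c" for a c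
  proof (rule AE_from_small_sets)
    fix d :: real assume d: "0 < d"
    \<comment> \<open>\<open>k\<close> collects the constants of
      \<open>poisson_int_le_maximal\<close>, and \<open>l\<close> is set so that the bound there
      becomes \<open>c\<close>.\<close>
    define k where "k = (2 * a\<^sup>2 + 2) * 8"
    have k: "0 < k" by (simp add: k_def add_nonneg_pos)
    define l where "l = c / k"
    have l: "0 < l" using c k by (simp add: l_def)
    \<comment> \<open>The first bound keeps the exceptional set \<open>W\<close> of the maximal
      inequality within measure \<open>d / 2\<close>, the second does the same for the set
      \<open>V\<close> by Markov's inequality.\<close>
    define N where "N = min (d * l / 20) (d * c / 2)"
    have N: "0 < N" using d l c by (simp add: N_def)
    obtain n where n: "(LINT t|lebesgue. cmod (G (Complex t (e n)) - g t)) < N"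
      using order_tendstoD(2)[OF lim N] by (auto simp: eventually_sequentially)
    define h where "h t = g t - G (Complex t (e n))" for t
    have hi: "integrable lebesgue h" unfolding h_def using g Gi by simp
    have hm: "h \<in> borel_measurable lebesgue" using hi by auto
    have hN: "(\<integral>\<^sup>+t. ennreal (cmod (h t)) \<partial>lebesgue) \<le> ennreal N"
    proof -
      have "(\<integral>\<^sup>+t. ennreal (cmod (h t)) \<partial>lebesgue) = ennreal (LINT t|lebesgue. cmod (h t))"
        by (rule nn_integral_eq_integral[OF integrable_norm[OF hi]]) simp
      also have "\<dots> \<le> ennreal N"
        using n by (intro ennreal_leI) (simp add: h_def norm_minus_commute)
      finally show ?thesis .
    qed
    have hm': "(\<lambda>t. cmod (h t)) \<in> borel_measurable lebesgue" using hm by measurable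
    have "\<exists>W\<in>sets lebesgue. emeasure lebesgue W \<le> ennreal (10 * N / l) \<and>
      (\<forall>x r. x \<notin> W \<longrightarrow> 0 < r \<longrightarrow> (\<integral>\<^sup>+t. ennreal (cmod (h t)) * indicator {x - r..x + r} t \<partial>lebesgue) \<le> ennreal (l * r))"
    proof (rule maximal_weak_type[OF hm' norm_ge_zero hN less_imp_le[OF N] l])
      fix W :: "real set"
      assume W: "W \<in> sets lebesgue" "emeasure lebesgue W \<le> ennreal (10 * N / l)"
        "\<And>x r. x \<notin> W \<Longrightarrow> 0 < r \<Longrightarrow> (\<integral>\<^sup>+t. ennreal (cmod (h t)) * indicator {x - r..x + r} t \<partial>lebesgue) \<le> ennreal (l * r)"
      show ?thesis by (intro bexI[of _ W] conjI allI impI W)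
    qed
    then obtain W where W: "W \<in> sets lebesgue" "emeasure lebesgue W \<le> ennreal (10 * N / l)"
      "\<And>x r. x \<notin> W \<Longrightarrow> 0 < r \<Longrightarrow> (\<integral>\<^sup>+t. ennreal (cmod (h t)) * indicator {x - r..x + r} t \<partial>lebesgue) \<le> ennreal (l * r)"
      by blast
    define V where "V = {x \<in> space lebesgue. c \<le> cmod (h x)}"
    have Vm: "V \<in> sets lebesgue" unfolding V_def using hm by measurable
    have "emeasure lebesgue V \<le> ennreal (1 / c) * (\<integral>\<^sup>+t. ennreal (cmod (h t)) \<partial>lebesgue)"
    proof -
      have "emeasure lebesgue V = (\<integral>\<^sup>+t. indicator V t \<partial>lebesgue)" using Vm by simp
      also have "\<dots> \<le> (\<integral>\<^sup>+t. ennreal (1 / c) * ennreal (cmod (h t)) \<partial>lebesgue)"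
      proof (rule nn_integral_mono)
        fix t show "indicator V t \<le> ennreal (1 / c) * ennreal (cmod (h t))"
        proof (cases "t \<in> V")
          case True
          then have "1 \<le> 1 / c * cmod (h t)" using c by (simp add: V_def divide_simps)
          then have "ennreal 1 \<le> ennreal (1 / c * cmod (h t))" by (rule ennreal_leI)
          then show ?thesis using True c by (simp add: ennreal_mult[symmetric])
        qed simp
      qed
      also have "\<dots> = ennreal (1 / c) * (\<integral>\<^sup>+t. ennreal (cmod (h t)) \<partial>lebesgue)"
        by (rule nn_integral_cmult) (use hm in measurable)
      finally show ?thesis .
    qed
    also have "\<dots> \<le> ennreal (1 / c) * ennreal N" by (rule mult_left_mono[OF hN]) simp
    also have "\<dots> = ennreal (N / c)" using c N by (simp add: ennreal_mult[symmetric])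
    also have "\<dots> \<le> ennreal (d / 2)"
    proof (rule ennreal_leI)
      have "N \<le> d * c / 2" by (simp add: N_def)
      then show "N / c \<le> d / 2" using c by (simp add: divide_simps)
    qed
    finally have Ve: "emeasure lebesgue V \<le> ennreal (d / 2)" .
    have We: "emeasure lebesgue W \<le> ennreal (d / 2)"
    proof (rule order_trans[OF W(2) ennreal_leI])
      have "N \<le> d * l / 20" by (simp add: N_def)
      then show "10 * N / l \<le> d / 2" using l by (simp add: divide_simps)
    qed
    show "\<exists>W\<in>sets lebesgue. emeasure lebesgue W \<le> ennreal d \<and>
      (\<forall>x\<in>space lebesgue. x \<notin> W \<longrightarrow> (\<exists>d>0. \<forall>z\<in>cone a x. dist z (of_real x) < d \<longrightarrow> dist (G z) (g x) \<le> 3 * c))"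
    proof (intro bexI[of _ "W \<union> V"] conjI ballI impI)
      have "emeasure lebesgue (W \<union> V) \<le> emeasure lebesgue W + emeasure lebesgue V"
        by (rule emeasure_subadditive[OF W(1) Vm])
      also have "\<dots> \<le> ennreal (d / 2) + ennreal (d / 2)" by (rule add_mono[OF We Ve])
      also have "\<dots> = ennreal d" using d by (simp flip: ennreal_plus)
      finally show "emeasure lebesgue (W \<union> V) \<le> ennreal d" .
      fix x :: real assume "x \<notin> W \<union> V"
      then have xW: "x \<notin> W" and hx: "cmod (h x) < c" by (auto simp: V_def)
      have "isCont G (Complex x (e n))"
        using holomorphic_on_imp_continuous_on[OF hol] open_upper_half_plane e[of n]
        by (simp add: continuous_on_eq_continuous_at upper_half_plane_def)
      then obtain r where r: "0 < r" "\<And>w. dist w (Complex x (e n)) < r \<Longrightarrow> dist (G w) (G (Complex x (e n))) < c"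
        using c unfolding continuous_at_eps_delta by metis
      have "dist (G z) (g x) \<le> 3 * c" if z: "z \<in> cone a x" "dist z (of_real x) < r" for z
      proof -
        have Imz: "0 < Im z" using z by (simp add: cone_def)
        \<comment> \<open>The upward shift of \<open>G\<close> is a Poisson integral too, so the
          difference is the Poisson integral of the small function \<open>h\<close>. The other two
          errors come from continuity of \<open>G\<close> at an interior point and from
          \<open>x \<notin> V\<close>.\<close>
        have "G z - G (z + \<i> * of_real (e n)) = poisson_int h z"
          unfolding rep[OF Imz] poisson_formula_shift[OF hol bd e Imz] h_def[abs_def]
          by (rule poisson_int_diff[symmetric, OF integrable_imp_poisson_integrable[OF g] integrable_imp_poisson_integrable[OF Gi] Imz])
        also have "cmod \<dots> \<le> (2 * a\<^sup>2 + 2) * (8 * l)"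
          by (rule poisson_int_le_maximal[OF hi less_imp_le[OF l] W(3)[OF xW] a z(1)])
        also have "(2 * a\<^sup>2 + 2) * (8 * l) = k * l" by (simp add: k_def)
        also have "\<dots> = c" using k by (simp add: l_def)
        finally have 1: "dist (G z) (G (z + \<i> * of_real (e n))) \<le> c" by (simp add: dist_norm)
        have eq: "z + \<i> * of_real (e n) - Complex x (e n) = z - of_real x" by (simp add: complex_eq_iff)
        have 2: "dist (G (z + \<i> * of_real (e n))) (G (Complex x (e n))) < c"
          by (intro r(2)) (use z(2) in \<open>simp only: dist_norm eq\<close>)
        have 3: "dist (G (Complex x (e n))) (g x) < c" using hx by (simp add: h_def dist_norm norm_minus_commute)
        have "dist (G z) (g x) \<le> dist (G z) (G (z + \<i> * of_real (e n)))
            + dist (G (z + \<i> * of_real (e n))) (G (Complex x (e n))) + dist (G (Complex x (e n))) (g x)"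
          using dist_triangle[of "G z" "g x" "G (z + \<i> * of_real (e n))"]
            dist_triangle[of "G (z + \<i> * of_real (e n))" "g x" "G (Complex x (e n))"] by linarith
        then show ?thesis using 1 2 3 by linarith
      qed
      then show "\<exists>d>0. \<forall>z\<in>cone a x. dist z (of_real x) < d \<longrightarrow> dist (G z) (g x) \<le> 3 * c"
        using r(1) by blast
    qed (use W(1) Vm in auto)
  qed
  have "AE x in lebesgue. \<forall>n m :: nat. \<exists>d>0. \<forall>z\<in>cone (real (Suc n)) x. dist z (of_real x) < d \<longrightarrow> dist (G z) (g x) \<le> 3 * (1 / real (Suc m))"
    unfolding AE_all_countable by (intro allI main) auto
  then show ?thesis
  proof eventually_elim
    case (elim x)
    show ?case
      unfolding has_nontangential_limit_iff_nat
    proof (intro allI tendstoI)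
      fix n :: nat and c :: real assume c: "0 < c"
      obtain m :: nat where m: "3 / c < real (Suc m)" using reals_Archimedean2[of "3 / c"] by (metis less_trans of_nat_less_iff lessI)
      have mc: "3 * (1 / real (Suc m)) < c" using m c by (simp add: divide_simps mult.commute)
      obtain d where d: "0 < d" "\<And>z. z \<in> cone (real (Suc n)) x \<Longrightarrow> dist z (of_real x) < d \<Longrightarrow> dist (G z) (g x) \<le> 3 * (1 / real (Suc m))"
        using elim by blast
      show "\<forall>\<^sub>F z in at (complex_of_real x) within cone (real (Suc n)) x. dist (G z) (g x) < c"
        unfolding eventually_at using d mc by (intro exI[of _ d]) (auto intro: le_less_trans)
    qed
  qed
qed

section \<open>Poisson representation in all exponents\<close>

lemma horizontal_shift_tendsto:
  assumes hol: "F holomorphic_on upper_half_plane" and e: "e \<longlonglongrightarrow> 0" and z: "0 < Im z"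
  shows "(\<lambda>n. F (z + \<i> * of_real (e n))) \<longlonglongrightarrow> F z"
proof -
  have "isCont F z" using holomorphic_on_imp_continuous_on[OF hol] open_upper_half_plane z
    by (simp add: continuous_on_eq_continuous_at upper_half_plane_def)
  moreover have "(\<lambda>n. z + \<i> * of_real (e n)) \<longlonglongrightarrow> z + \<i> * of_real 0"
    by (intro tendsto_intros e)
  ultimately show ?thesis using isCont_tendsto_compose[of z F] by simp
qed

text \<open>Dividing by \<open>(z + \<i>)\<^sup>2\<close> reduces the boundary behaviour of all Hardy spaces to the case of
  exponent 1.\<close>

theorem hardy_poisson_representation:
  fixes F :: "complex \<Rightarrow> complex"
  assumes hol: "F holomorphic_on upper_half_plane" and bd: "bounded_above_lines F"
    and H: "hardy_bound 1 K (\<lambda>z. F z / (z + \<i>)\<^sup>2)" and K: "0 \<le> K"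
  obtains f where "poisson_integrable f" "\<And>z. 0 < Im z \<Longrightarrow> F z = poisson_int f z"
    "AE x in lebesgue. has_nontangential_limit F x (f x)"
proof -
  define G where "G z = F z / (z + \<i>)\<^sup>2" for z
  have HG: "hardy_bound 1 K G" using H by (simp add: G_def[abs_def])
  have holG: "G holomorphic_on upper_half_plane" using HG by (simp add: hardy_bound_def)
  have bdG: "bounded_above_lines G" by (rule hardy_bound_imp_bounded_above_lines[OF HG _ K]) simp
  have nz: "z + \<i> \<noteq> 0" if "0 \<le> Im z" for z using that by (auto simp: complex_eq_iff)
  have FG: "F z = G z * (z + \<i>)\<^sup>2" if "0 < Im z" for z using nz[of z] that by (simp add: G_def)
  show thesis
  proof (rule hardy_1_L1_limit[OF HG K])
    fix e :: "nat \<Rightarrow> real" and g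
    assume e: "\<And>n. 0 < e n" "\<And>n. e n \<le> 1" "e \<longlonglongrightarrow> 0" and g: "integrable lebesgue g"
      and lim: "(\<lambda>n. LINT x|lebesgue. cmod (G (Complex x (e n)) - g x)) \<longlonglongrightarrow> 0"
    have Gi: "integrable lebesgue (\<lambda>t. G (Complex t (e n)))" for n by (rule hardy_1_integrable[OF HG e(1)])
    have repG: "G z = poisson_int g z" if z: "0 < Im z" for z
    proof (rule LIMSEQ_unique[OF horizontal_shift_tendsto[OF holG e(3) z]])
      define C where "C = Im z * (kernel_const z)\<^sup>2 / pi"
      have C: "poisson z t \<le> C" for t
      proof -
        have "C * (1 / (1 + t\<^sup>2)) \<le> C * 1"
          using z by (intro mult_left_mono) (auto simp: C_def divide_le_eq add_pos_nonneg)
        then show ?thesis using poisson_le[OF z, of t] by (simp add: C_def)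
      qed
      have "(\<lambda>n. LINT t|lebesgue. of_real (poisson z t) * G (Complex t (e n))) \<longlonglongrightarrow> (LINT t|lebesgue. of_real (poisson z t) * g t)"
        by (rule L1_limit_mult_bounded[OF Gi g lim, where C = C])
           (use C poisson_nonneg[OF z] in \<open>auto intro!: borel_measurable_of_real\<close>)
      then show "(\<lambda>n. G (z + \<i> * of_real (e n))) \<longlonglongrightarrow> poisson_int g z"
        unfolding poisson_formula_shift[OF holG bdG e(1) z] poisson_int_def scaleR_conv_of_real .
    qed
    have AEG: "AE x in lebesgue. has_nontangential_limit G x (g x)"
      by (rule nontangential_limit_of_L1_limit[OF holG bdG e(1) g Gi repG lim])
    \<comment> \<open>This undoes the division on the boundary. The weight in
      \<open>poisson_integrable\<close> cancels the new factor exactly, which keeps \<open>f\<close>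
      in the class although it may fail to be integrable.\<close>
    define f where "f t = g t * (of_real t + \<i>)\<^sup>2" for t
    have gm: "g \<in> borel_measurable lebesgue" using g by auto
    note [measurable] = gm of_real_lebesgue_measurable
    have fm: "f \<in> borel_measurable lebesgue" unfolding f_def[abs_def] by measurable
    have fn: "norm (f t) / (1 + t\<^sup>2) = cmod (g t)" for t
      using add_pos_nonneg[of 1 "t\<^sup>2"] by (simp add: f_def norm_mult norm_power cmod_of_real_plus_i_square)
    show thesis
    proof (rule that)
      show pf: "poisson_integrable f" unfolding poisson_integrable_def fn using fm g by auto
      fix z :: complex assume z: "0 < Im z"
      show "F z = poisson_int f z"
      proof (rule LIMSEQ_unique[OF horizontal_shift_tendsto[OF hol e(3) z]])
        define C where "C = Im z * (kernel_const z)\<^sup>2 / pi"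
        \<comment> \<open>The growth of the squared factor is absorbed by the decay of the kernel:
          since \<open>e n \<le> 1\<close>, the shifted factor is at most
          \<open>2 * cmod (of_real t + \<i>)\<close> before squaring, which gives the uniform bound
          \<open>4 * C\<close>.\<close>
        define h where "h n t = of_real (poisson z t) * (Complex t (e n) + \<i>)\<^sup>2" for n t
        have "(\<lambda>n. LINT t|lebesgue. h n t * G (Complex t (e n))) \<longlonglongrightarrow> (LINT t|lebesgue. of_real (poisson z t) * (of_real t + \<i>)\<^sup>2 * g t)"
        proof (rule L1_limit_mult_bounded[OF Gi g lim, where C = "4 * C"])
          show "h n \<in> borel_measurable lebesgue" for n unfolding h_def[abs_def] Complex_eq by measurable
          show "(\<lambda>t. of_real (poisson z t) * (of_real t + \<i>)\<^sup>2) \<in> borel_measurable lebesgue" by measurable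
          show "(\<lambda>n. h n t) \<longlonglongrightarrow> of_real (poisson z t) * (of_real t + \<i>)\<^sup>2" for t
          proof -
            have "(\<lambda>n. of_real (poisson z t) * (of_real t + \<i> * of_real (e n) + \<i>)\<^sup>2) \<longlonglongrightarrow> of_real (poisson z t) * (of_real t + \<i> * of_real 0 + \<i>)\<^sup>2"
              by (intro tendsto_intros e)
            then show ?thesis by (simp add: h_def Complex_eq)
          qed
          fix n t
          have "cmod (Complex t (e n) + \<i>) \<le> 2 * cmod (of_real t + \<i>)"
          proof -
            have "Complex t (e n) + \<i> = (of_real t + \<i>) + \<i> * of_real (e n)" by (simp add: complex_eq_iff)
            then have "cmod (Complex t (e n) + \<i>) \<le> cmod (of_real t + \<i>) + cmod (\<i> * of_real (e n))"
              using norm_triangle_ineq by metis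
            also have "cmod (\<i> * of_real (e n)) = e n" using e(1)[of n] by (simp add: norm_mult)
            finally show ?thesis using e(2)[of n] abs_Im_le_cmod[of "of_real t + \<i>"] by simp
          qed
          then have "(cmod (Complex t (e n) + \<i>))\<^sup>2 \<le> (2 * cmod (of_real t + \<i>))\<^sup>2" by (rule power_mono) simp
          then have sq: "(cmod (Complex t (e n) + \<i>))\<^sup>2 \<le> 4 * (1 + t\<^sup>2)"
            by (simp add: power_mult_distrib cmod_of_real_plus_i_square)
          have "cmod (h n t) = poisson z t * (cmod (Complex t (e n) + \<i>))\<^sup>2"
            using poisson_nonneg[OF z, of t] by (simp add: h_def norm_mult norm_power)
          also have "\<dots> \<le> C * (1 / (1 + t\<^sup>2)) * (4 * (1 + t\<^sup>2))"
            using poisson_le[OF z, of t] sq poisson_nonneg[OF z, of t] z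
            by (intro mult_mono) (auto simp: C_def add_nonneg_nonneg)
          also have "\<dots> = 4 * C"
          proof -
            have eq: "C * (1 / q) * (4 * q) = 4 * C" if "q \<noteq> 0" for q using that by simp
            show ?thesis by (rule eq) (use add_pos_nonneg[of 1 "t\<^sup>2"] in auto)
          qed
          finally show "cmod (h n t) \<le> 4 * C" .
        qed
        then show "(\<lambda>n. F (z + \<i> * of_real (e n))) \<longlonglongrightarrow> poisson_int f z"
          unfolding poisson_formula_shift[OF hol bd e(1) z] poisson_int_def scaleR_conv_of_real
          by (simp add: FG e(1) h_def f_def mult_ac)
      qed
    next
      show "AE x in lebesgue. has_nontangential_limit F x (f x)"
        using AEG
      proof eventually_elim
        case (elim x)
        show ?case
          unfolding has_nontangential_limit_def
        proof (intro allI impI)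
          fix a :: real assume a: "0 < a"
          have "((\<lambda>z. G z * (z + \<i>)\<^sup>2) \<longlongrightarrow> g x * (of_real x + \<i>)\<^sup>2) (at (of_real x) within cone a x)"
            using elim a unfolding has_nontangential_limit_def by (intro tendsto_intros) auto
          moreover have "\<forall>\<^sub>F z in at (of_real x) within cone a x. G z * (z + \<i>)\<^sup>2 = F z"
            using FG by (auto simp: eventually_at_filter cone_def)
          ultimately show "(F \<longlongrightarrow> f x) (at (of_real x) within cone a x)"
            unfolding f_def by (rule Lim_transform_eventually)
        qed
      qed
    qed
  qed
qed

section \<open>Test functions and weak derivatives\<close>

text \<open>The classical flat function is the case \<open>k = 0\<close>. The power is included so
  that derivatives stay in the linear span of the family, at the origin as well.\<close>

definition bump :: "nat \<Rightarrow> real \<Rightarrow> real" where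
  "bump k x = (if 0 < x then inverse x ^ k * exp (- inverse x) else 0)"

lemma bump_tendsto_0: "(bump k \<longlongrightarrow> 0) (at 0)"
proof (rule filterlim_split_at)
  have "((\<lambda>_::real. 0::real) \<longlongrightarrow> 0) (at_left 0)" by simp
  moreover have "\<forall>\<^sub>F x in at_left 0. 0 = bump k x"
    unfolding eventually_at_filter by (simp add: bump_def)
  ultimately show "(bump k \<longlongrightarrow> 0) (at_left 0)" by (rule Lim_transform_eventually)
  have "((\<lambda>x. inverse x ^ k / exp (inverse x)) \<longlongrightarrow> (0::real)) (at_right 0)"
    by (rule filterlim_compose[OF tendsto_power_div_exp_0 filterlim_inverse_at_top_right])
  moreover have "\<forall>\<^sub>F x in at_right 0. inverse x ^ k / exp (inverse x) = bump k x"
    unfolding eventually_at_filter by (simp add: bump_def exp_minus divide_inverse)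
  ultimately show "(bump k \<longlongrightarrow> 0) (at_right 0)" by (rule Lim_transform_eventually)
qed

lemma bump_has_derivative: "(bump k has_real_derivative (bump (k + 2) x - k * bump (k + 1) x)) (at x)"
proof -
  consider "0 < x" | "x < 0" | "x = 0" by linarith
  then show ?thesis
  proof cases
    case 1
    have "((\<lambda>x. inverse x ^ k * exp (- inverse x)) has_real_derivative (bump (k + 2) x - k * bump (k + 1) x)) (at x)"
    proof (rule DERIV_cong)
      show "((\<lambda>x. inverse x ^ k * exp (- inverse x)) has_real_derivative
          (real k * (- (inverse x * inverse x) * inverse x ^ (k - Suc 0))) * exp (- inverse x)
          + exp (- inverse x) * (inverse x * inverse x) * inverse x ^ k) (at x)"
        using 1 by (auto intro!: derivative_eq_intros)
      show "(real k * (- (inverse x * inverse x) * inverse x ^ (k - Suc 0))) * exp (- inverse x)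
          + exp (- inverse x) * (inverse x * inverse x) * inverse x ^ k = bump (k + 2) x - k * bump (k + 1) x"
        using 1 by (cases k) (simp_all add: bump_def)
    qed
    moreover have "\<forall>\<^sub>F u in nhds x. u \<in> {0<..}" by (rule eventually_nhds_in_open) (use 1 in auto)
    then have "\<forall>\<^sub>F u in nhds x. inverse u ^ k * exp (- inverse u) = bump k u"
      by eventually_elim (simp add: bump_def)
    ultimately show ?thesis by (rule DERIV_cong_ev[OF refl _ refl, THEN iffD1, rotated])
  next
    case 2
    have "((\<lambda>x. 0) has_real_derivative (bump (k + 2) x - k * bump (k + 1) x)) (at x)"
      using 2 by (simp add: bump_def)
    moreover have "\<forall>\<^sub>F u in nhds x. u \<in> {..<0}" by (rule eventually_nhds_in_open) (use 2 in auto)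
    then have "\<forall>\<^sub>F u in nhds x. 0 = bump k u"
      by eventually_elim (simp add: bump_def)
    ultimately show ?thesis by (rule DERIV_cong_ev[OF refl _ refl, THEN iffD1, rotated])
  next
    case 3
    \<comment> \<open>Division by \<open>h\<close> only raises the exponent by one, so the
      derivative at 0 is a limit already known. For \<open>h = 0\<close> both sides are 0 by the
      convention for division by 0.\<close>
    have "(\<lambda>h. (bump k (0 + h) - bump k 0) / h) = bump (k + 1)"
      by (rule ext) (auto simp: bump_def divide_inverse)
    then have "(bump k has_real_derivative 0) (at 0)"
      unfolding DERIV_def using bump_tendsto_0[of "k + 1"] by simp
    then show ?thesis using 3 by (simp add: bump_def)
  qed
qed

definition smooth :: "(real \<Rightarrow> real) \<Rightarrow> bool" where
  "smooth \<phi> \<longleftrightarrow> (\<forall>k x. (deriv ^^ k) \<phi> field_differentiable at x)"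

lemma smooth_coinduct:
  assumes "f \<in> S" and "\<And>f. f \<in> S \<Longrightarrow> deriv f \<in> S \<and> (\<forall>x. f field_differentiable at x)"
  shows "smooth f"
proof -
  have "(deriv ^^ k) f \<in> S" for k by (induction k) (use assms in auto)
  then show ?thesis using assms by (simp add: smooth_def)
qed

lemma smooth_deriv: "smooth f \<Longrightarrow> smooth (deriv f)"
  unfolding smooth_def by (metis comp_apply funpow_Suc_right)

lemma smooth_differentiable: "smooth f \<Longrightarrow> f field_differentiable at x"
  unfolding smooth_def by (metis funpow_0)

lemma smooth_DERIV: "smooth f \<Longrightarrow> (f has_real_derivative deriv f x) (at x)"
  using smooth_differentiable DERIV_deriv_iff_field_differentiable by blast

lemma smooth_continuous: "smooth f \<Longrightarrow> continuous_on A f"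
  by (meson DERIV_continuous_on has_field_derivative_at_within smooth_DERIV)

text \<open>An algebra of functions closed under differentiation, hence consisting of smooth functions.\<close>

inductive_set smooth_alg :: "(real \<Rightarrow> real) set" where
  base: "smooth f \<Longrightarrow> f \<in> smooth_alg"
| bump: "(\<lambda>x. bump k (c * x + d)) \<in> smooth_alg"
| kernel: "0 < Im z \<Longrightarrow> (\<lambda>t. Im (c * inverse (of_real t - z) ^ k)) \<in> smooth_alg"
| add: "f \<in> smooth_alg \<Longrightarrow> g \<in> smooth_alg \<Longrightarrow> (\<lambda>x. f x + g x) \<in> smooth_alg"
| mult: "f \<in> smooth_alg \<Longrightarrow> g \<in> smooth_alg \<Longrightarrow> (\<lambda>x. f x * g x) \<in> smooth_alg"

lemma smooth_const: "smooth (\<lambda>x. c)"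
proof (rule smooth_coinduct[where S = "range (\<lambda>c x. c)"])
  fix f :: "real \<Rightarrow> real" assume "f \<in> range (\<lambda>c x. c)"
  then obtain c where "f = (\<lambda>x. c)" by auto
  then show "deriv f \<in> range (\<lambda>c x. c) \<and> (\<forall>x. f field_differentiable at x)" by auto
qed auto

lemma has_real_derivative_kernel:
  assumes "0 < Im z"
  shows "((\<lambda>t. Im (c * inverse (of_real t - z) ^ k)) has_real_derivative Im ((- of_nat k * c) * inverse (of_real t - z) ^ (k + 1))) (at t)"
proof -
  have nz: "of_real t - z \<noteq> 0" by (rule of_real_diff_nonzero[OF assms])
  have "((\<lambda>w. c * inverse (w - z) ^ k) has_field_derivative (- of_nat k * c) * inverse (of_real t - z) ^ (k + 1)) (at (of_real t))"
  proof -
    have "of_nat k * inverse (of_real t - z) ^ (k - Suc 0) * (inverse (of_real t - z) * inverse (of_real t - z)) = of_nat k * inverse (of_real t - z) ^ (k + 1)"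
      by (cases k) (auto simp: mult_ac)
    then show ?thesis using nz
      by (auto intro!: derivative_eq_intros simp: mult_ac)
  qed
  then have "((\<lambda>t. c * inverse (of_real t - z) ^ k) has_vector_derivative (- of_nat k * c) * inverse (of_real t - z) ^ (k + 1)) (at t)"
    by (rule has_vector_derivative_real_field)
  then have "((\<lambda>t. Im (c * inverse (of_real t - z) ^ k)) has_vector_derivative Im ((- of_nat k * c) * inverse (of_real t - z) ^ (k + 1))) (at t)"
    by (rule bounded_linear.has_vector_derivative[OF bounded_linear_Im])
  then show ?thesis by (simp only: has_real_derivative_iff_has_vector_derivative)
qed

lemma smooth_alg_closed:
  "f \<in> smooth_alg \<Longrightarrow> deriv f \<in> smooth_alg \<and> (\<forall>x. f field_differentiable at x)"
proof (induction rule: smooth_alg.induct)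
  case (base f)
  then show ?case by (auto intro: smooth_alg.base smooth_deriv smooth_differentiable)
next
  case (bump k c d)
  have D: "((\<lambda>x. bump k (c * x + d)) has_real_derivative (c * bump (k + 2) (c * x + d) + (- c * k) * bump (k + 1) (c * x + d))) (at x)" for x
    by (rule DERIV_cong[OF DERIV_chain2[OF bump_has_derivative, where Db = c]]) (auto intro!: derivative_eq_intros simp: algebra_simps)
  have "deriv (\<lambda>x. bump k (c * x + d)) = (\<lambda>x. c * bump (k + 2) (c * x + d) + (- c * k) * bump (k + 1) (c * x + d))"
    using D by (intro ext DERIV_imp_deriv)
  moreover have "(\<lambda>x. c * bump (k + 2) (c * x + d) + (- c * k) * bump (k + 1) (c * x + d)) \<in> smooth_alg"
    by (rule smooth_alg.add[OF smooth_alg.mult[OF smooth_alg.base[OF smooth_const] smooth_alg.bump]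
          smooth_alg.mult[OF smooth_alg.base[OF smooth_const] smooth_alg.bump]])
  ultimately show ?case using D by (simp only: field_differentiable_def) blast
next
  case (kernel z c k)
  note D = has_real_derivative_kernel[OF kernel]
  have "deriv (\<lambda>t. Im (c * inverse (of_real t - z) ^ k)) = (\<lambda>t. Im ((- of_nat k * c) * inverse (of_real t - z) ^ (k + 1)))"
    by (intro ext DERIV_imp_deriv D)
  then show ?case using D smooth_alg.kernel[OF kernel] by (auto simp only: field_differentiable_def)
next
  case (add f g)
  then have "deriv (\<lambda>x. f x + g x) = (\<lambda>x. deriv f x + deriv g x)" by (intro ext) simp
  then show ?case using add by (auto intro!: smooth_alg.add field_differentiable_add)
next
  case (mult f g)
  then have "deriv (\<lambda>x. f x * g x) = (\<lambda>x. f x * deriv g x + deriv f x * g x)" by (intro ext) simp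
  then show ?case using mult by (auto intro!: smooth_alg.add smooth_alg.mult field_differentiable_mult)
qed

lemma smooth_alg_smooth: "f \<in> smooth_alg \<Longrightarrow> smooth f"
  by (rule smooth_coinduct[of _ smooth_alg]) (auto dest: smooth_alg_closed)

lemma test_function_iff: "test_function \<phi> \<longleftrightarrow> smooth \<phi> \<and> (\<exists>R. \<forall>x. R < \<bar>x\<bar> \<longrightarrow> \<phi> x = 0)"
proof -
  have "bounded {x. \<phi> x \<noteq> 0} \<longleftrightarrow> (\<exists>R. \<forall>x. R < \<bar>x\<bar> \<longrightarrow> \<phi> x = 0)"
    unfolding bounded_iff real_norm_def by (metis (mono_tags, lifting) linorder_not_less mem_Collect_eq)
  then show ?thesis by (simp add: test_function_def smooth_def)
qed

lemma test_function_deriv: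
  assumes "test_function \<phi>" shows "test_function (deriv \<phi>)"
proof -
  obtain R where R: "\<And>x. R < \<bar>x\<bar> \<Longrightarrow> \<phi> x = 0" and s: "smooth \<phi>" using assms by (auto simp: test_function_iff)
  have "deriv \<phi> x = 0" if x: "R < \<bar>x\<bar>" for x
  proof (rule DERIV_imp_deriv)
    have "open {x::real. R < \<bar>x\<bar>}" by (intro open_Collect_less continuous_intros)
    then have "\<forall>\<^sub>F u in nhds x. u \<in> {x. R < \<bar>x\<bar>}" using x by (intro eventually_nhds_in_open) auto
    then have "\<forall>\<^sub>F u in nhds x. 0 = \<phi> u" by eventually_elim (simp add: R)
    moreover have "((\<lambda>_. 0) has_real_derivative 0) (at x)" by simp
    ultimately show "(\<phi> has_real_derivative 0) (at x)" by (rule DERIV_cong_ev[OF refl _ refl, THEN iffD1])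
  qed
  then show ?thesis using s smooth_deriv by (auto simp: test_function_iff)
qed

lemma test_function_higher_deriv: "test_function \<phi> \<Longrightarrow> test_function ((deriv ^^ k) \<phi>)"
  by (induction k) (auto intro: test_function_deriv)

section \<open>Pairing with test functions and the fundamental lemma of the calculus of
  variations\<close>

lemma complex_of_real_measurable:
  "f \<in> borel_measurable M \<Longrightarrow> (\<lambda>x. complex_of_real (f x)) \<in> borel_measurable M"
  by (rule measurable_compose[OF _ borel_measurable_continuous_onI]) (auto intro: continuous_intros)

lemma compact_support_bounded:
  fixes \<phi> :: "real \<Rightarrow> real"
  assumes c: "continuous_on UNIV \<phi>" and R: "\<And>x. R < \<bar>x\<bar> \<Longrightarrow> \<phi> x = 0"
  shows "\<exists>B\<ge>0. \<forall>x. \<bar>\<phi> x\<bar> \<le> B"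
proof -
  have "bounded (\<phi> ` {-R..R})"
    by (intro compact_imp_bounded compact_continuous_image continuous_on_subset[OF c]) auto
  then obtain B where B: "\<forall>x\<in>{-R..R}. \<bar>\<phi> x\<bar> \<le> B" by (auto simp: bounded_iff)
  have "\<bar>\<phi> x\<bar> \<le> max B 0" for x
  proof (cases "R < \<bar>x\<bar>")
    case True then show ?thesis using R by simp
  next
    case False
    then have "x \<in> {-R..R}" by auto
    then show ?thesis using B by fastforce
  qed
  then show ?thesis by (intro exI[of _ "max B 0"]) auto
qed

lemma locally_integrable_mult_compact_support:
  fixes \<phi> :: "real \<Rightarrow> real"
  assumes g: "locally_integrable g" and c: "continuous_on UNIV \<phi>" and R: "\<And>x. R < \<bar>x\<bar> \<Longrightarrow> \<phi> x = 0"
  shows "integrable lebesgue (\<lambda>x. g x * of_real (\<phi> x))"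
proof -
  obtain B where B: "0 \<le> B" "\<And>x. \<bar>\<phi> x\<bar> \<le> B" using compact_support_bounded[OF c R] by blast
  have gi: "integrable lebesgue (\<lambda>x. indicat_real {-R..R} x *\<^sub>R g x)"
    using g by (simp add: locally_integrable_def set_integrable_def)
  have eq: "g x * of_real (\<phi> x) = of_real (\<phi> x) * (indicat_real {-R..R} x *\<^sub>R g x)" for x
    using R[of x] by (cases "R < \<bar>x\<bar>") (auto simp: indicator_def)
  show ?thesis
    unfolding eq
  proof (rule Bochner_Integration.integrable_bound)
    show "integrable lebesgue (\<lambda>x. B * norm (indicat_real {-R..R} x *\<^sub>R g x))"
      by (rule integrable_mult_right[OF integrable_norm[OF gi]])
    have "\<phi> \<in> borel_measurable lebesgue" by (rule continuous_imp_lebesgue_measurable[OF c])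
    then have "(\<lambda>x. complex_of_real (\<phi> x)) \<in> borel_measurable lebesgue" by (rule complex_of_real_measurable)
    then show "(\<lambda>x. complex_of_real (\<phi> x) * (indicat_real {-R..R} x *\<^sub>R g x)) \<in> borel_measurable lebesgue"
      using gi by (intro borel_measurable_times) auto
    show "AE x in lebesgue. norm (complex_of_real (\<phi> x) * (indicat_real {-R..R} x *\<^sub>R g x)) \<le> norm (B * norm (indicat_real {-R..R} x *\<^sub>R g x))"
    proof (rule AE_I2)
      fix x
      have "\<bar>\<phi> x\<bar> * norm (indicat_real {-R..R} x *\<^sub>R g x) \<le> B * norm (indicat_real {-R..R} x *\<^sub>R g x)"
        by (rule mult_right_mono[OF B(2) norm_ge_zero])
      then show "norm (complex_of_real (\<phi> x) * (indicat_real {-R..R} x *\<^sub>R g x)) \<le> norm (B * norm (indicat_real {-R..R} x *\<^sub>R g x))"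
        unfolding norm_mult norm_of_real real_norm_def using B(1) by simp
    qed
  qed
qed

lemma test_function_mult_integrable:
  "locally_integrable g \<Longrightarrow> test_function \<phi> \<Longrightarrow> integrable lebesgue (\<lambda>x. g x * of_real (\<phi> x))"
  using locally_integrable_mult_compact_support smooth_continuous unfolding test_function_iff by blast

text \<open>As \<open>ennreal\<close> sends negative numbers to 0, the densities formed from
  \<open>u\<close> and from \<open>- u\<close> are its positive and negative parts. By hypothesis
  the two measures agree on open half-lines, where they are finite, so they coincide; uniqueness of
  densities makes both parts equal and therefore 0. The Borel representative \<open>u\<close> is
  taken so that half-lines generate the sigma-algebra.\<close>

lemma AE_zero_of_integral_greaterThan:
  fixes v :: "real \<Rightarrow> real"
  assumes v: "integrable lebesgue v" and 0: "\<And>x. (LINT t|lebesgue. indicator {x<..} t * v t) = 0"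
  shows "AE t in lebesgue. v t = 0"
proof -
  obtain u where u: "u \<in> borel_measurable lborel" "AE t in lborel. v t = u t"
    using completion_ex_borel_measurable_real[of v lborel] v by auto
  have ae: "AE t in lebesgue. v t = u t" using u(2) by (rule AE_completion)
  have ul: "u \<in> borel_measurable lebesgue" using u(1) by (rule measurable_completion)
  have "integrable lebesgue u" using v ae ul by (subst integrable_cong_AE[symmetric]) auto
  then have ui: "integrable lborel u" using u(1) by (simp add: integrable_completion)
  have z: "(LINT t|lborel. indicator {x<..} t * u t) = 0" for x
  proof -
    have "(LINT t|lborel. indicator {x<..} t * u t) = (LINT t|lebesgue. indicator {x<..} t * u t)"
      by (intro integral_completion[symmetric] borel_measurable_times borel_measurable_indicator u(1)) simp
    also have "\<dots> = (LINT t|lebesgue. indicator {x<..} t * v t)"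
      by (rule integral_cong_AE) (use v ul ae in \<open>auto intro!: borel_measurable_times\<close>)
    finally show ?thesis using 0 by simp
  qed
  have iu: "integrable lborel (\<lambda>t. indicat_real {x<..} t * u t)" for x
    using integrable_mult_indicator[OF _ ui, of "{x<..}"] by simp
  have eq: "ennreal (s * indicat_real A t * u t) = ennreal (s * u t) * indicator A t" for s A and t :: real
    by (auto simp: indicator_def)
  have fin: "(\<integral>\<^sup>+t. ennreal (s * u t) * indicator {x<..} t \<partial>lborel) < \<infinity>" if "\<bar>s\<bar> = 1" for s x
  proof -
    have "(\<integral>\<^sup>+t. ennreal (s * u t) * indicator {x<..} t \<partial>lborel) \<le> (\<integral>\<^sup>+t. ennreal (norm (u t)) \<partial>lborel)"
    proof (rule nn_integral_mono)
      fix t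
      have "s * u t \<le> norm (u t)" using abs_ge_self[of "s * u t"] that by (simp add: abs_mult)
      then show "ennreal (s * u t) * indicator {x<..} t \<le> ennreal (norm (u t))"
        by (cases "t \<in> {x<..}") (simp_all add: ennreal_leI)
    qed
    also have "\<dots> < \<infinity>" using ui by (simp add: integrable_iff_bounded)
    finally show ?thesis .
  qed
  have "density lborel (\<lambda>t. ennreal (1 * u t)) = density lborel (\<lambda>t. ennreal (- 1 * u t))"
  proof (rule measure_eqI_lessThan)
    fix x :: real
    have e: "emeasure (density lborel (\<lambda>t. ennreal (s * u t))) {x<..} = (\<integral>\<^sup>+t. ennreal (s * u t) * indicator {x<..} t \<partial>lborel)" for s
      using u(1) by (intro emeasure_density) auto
    show "emeasure (density lborel (\<lambda>t. ennreal (1 * u t))) {x<..} < \<infinity>" unfolding e by (rule fin) simp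
    have "enn2real (\<integral>\<^sup>+t. ennreal (1 * indicat_real {x<..} t * u t) \<partial>lborel) = enn2real (\<integral>\<^sup>+t. ennreal (- 1 * indicat_real {x<..} t * u t) \<partial>lborel)"
      using real_lebesgue_integral_def[OF iu[of x]] z[of x] by simp
    then show "emeasure (density lborel (\<lambda>t. ennreal (1 * u t))) {x<..} = emeasure (density lborel (\<lambda>t. ennreal (- 1 * u t))) {x<..}"
      unfolding e eq
    proof -
      assume "enn2real (\<integral>\<^sup>+t. ennreal (1 * u t) * indicator {x<..} t \<partial>lborel) = enn2real (\<integral>\<^sup>+t. ennreal (- 1 * u t) * indicator {x<..} t \<partial>lborel)"
      from arg_cong[OF this, of ennreal]
      show "(\<integral>\<^sup>+t. ennreal (1 * u t) * indicator {x<..} t \<partial>lborel) = (\<integral>\<^sup>+t. ennreal (- 1 * u t) * indicator {x<..} t \<partial>lborel)"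
        using fin[of 1 x] fin[of "- 1" x] by (subst (asm) (1 2) ennreal_enn2real) auto
    qed
  qed auto
  then have "AE t in lborel. ennreal (1 * u t) = ennreal (- 1 * u t)"
    using u(1) by (intro sigma_finite_measure.density_unique[OF sigma_finite_lborel]) auto
  then have "AE t in lborel. u t = 0"
  proof eventually_elim
    case (elim t)
    then show ?case
      using ennreal_neg[of "u t"] ennreal_neg[of "- u t"] ennreal_eq_0_iff[of "u t"] ennreal_eq_0_iff[of "- u t"]
      by (cases "0 \<le> u t") auto
  qed
  then have "AE t in lebesgue. u t = 0" by (rule AE_completion)
  then show ?thesis using ae by eventually_elim simp
qed

lemma bump_product_outside:
  assumes "0 \<le> m" "x \<le> a \<or> b \<le> x"
  shows "bump 0 (m * x + (- m * a)) * bump 0 ((- m) * x + m * b) = 0"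
proof -
  have "m * x + (- m * a) \<le> 0 \<or> (- m) * x + m * b \<le> 0"
    using mult_left_mono[of x a m] mult_left_mono[of b x m] assms by auto
  then show ?thesis by (auto simp: bump_def)
qed

text \<open>One bump switches on to the right of \<open>a\<close>, the other off to the left of
  \<open>b\<close>; as \<open>n\<close> grows the product tends to the indicator of the open
  interval.\<close>

lemma test_function_interval:
  assumes "a < b"
  shows "test_function (\<lambda>x. bump 0 (real n * x + (- real n * a)) * bump 0 ((- real n) * x + real n * b))"
proof -
  have "bump 0 (real n * x + (- real n * a)) * bump 0 ((- real n) * x + real n * b) = 0" if "max \<bar>a\<bar> \<bar>b\<bar> < \<bar>x\<bar>" for x
    by (rule bump_product_outside) (use that in auto)
  moreover have "smooth (\<lambda>x. bump 0 (real n * x + (- real n * a)) * bump 0 ((- real n) * x + real n * b))"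
    by (rule smooth_alg_smooth[OF smooth_alg.mult[OF smooth_alg.bump smooth_alg.bump]])
  ultimately show ?thesis unfolding test_function_iff by blast
qed

text \<open>Dominated convergence along the functions of \<open>test_function_interval\<close> shows
  that \<open>u\<close> has integral 0 over bounded open intervals. Cutting down to
  \<open>{- real n<..<real n}\<close> makes \<open>u\<close> integrable, and half-lines meet this
  interval in intervals again, so that \<open>AE_zero_of_integral_greaterThan\<close> applies to the
  real and imaginary parts.\<close>

theorem fundamental_lemma_variations:
  assumes u: "locally_integrable u"
    and 0: "\<And>\<phi>. test_function \<phi> \<Longrightarrow> (LINT x|lebesgue. u x * of_real (\<phi> x)) = 0"
  shows "AE x in lebesgue. u x = 0"
proof -
  have int0: "(LINT x|lebesgue. indicat_real {a<..<b} x *\<^sub>R u x) = 0" if ab: "a < b" for a b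
  proof -
    define \<phi> where "\<phi> n x = bump 0 (real (Suc n) * x + (- real (Suc n) * a)) * bump 0 ((- real (Suc n)) * x + real (Suc n) * b)" for n x
    have tf: "test_function (\<phi> n)" for n unfolding \<phi>_def[abs_def] by (rule test_function_interval[OF ab])
    have b01: "0 \<le> bump 0 x" "bump 0 x \<le> 1" for x by (auto simp: bump_def)
    have \<phi>01: "\<bar>\<phi> n x\<bar> \<le> 1" for n x using b01 unfolding \<phi>_def by (simp add: abs_mult mult_le_one)
    have \<phi>out: "\<phi> n x = 0" if "x \<notin> {a<..<b}" for n x
      unfolding \<phi>_def by (rule bump_product_outside) (use that in auto)
    have blim: "(\<lambda>n. bump 0 (real (Suc n) * s)) \<longlonglongrightarrow> 1" if s: "0 < s" for s
    proof -
      have "(\<lambda>n. exp (- (inverse (real (Suc n)) * inverse s))) \<longlonglongrightarrow> exp (- (0 * inverse s))"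
        by (intro tendsto_intros LIMSEQ_inverse_real_of_nat)
      moreover have "bump 0 (real (Suc n) * s) = exp (- (inverse (real (Suc n)) * inverse s))" for n
        using s by (simp add: bump_def)
      ultimately show ?thesis by simp
    qed
    have \<phi>lim: "(\<lambda>n. \<phi> n x) \<longlonglongrightarrow> indicat_real {a<..<b} x" for x
    proof (cases "x \<in> {a<..<b}")
      case True
      have "(\<lambda>n. bump 0 (real (Suc n) * (x - a)) * bump 0 (real (Suc n) * (b - x))) \<longlonglongrightarrow> 1 * 1"
        using True by (intro tendsto_mult blim) auto
      moreover have "\<phi> n x = bump 0 (real (Suc n) * (x - a)) * bump 0 (real (Suc n) * (b - x))" for n
        unfolding \<phi>_def by (simp add: algebra_simps)
      ultimately show ?thesis using True by simp
    qed (simp add: \<phi>out)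
    have i: "integrable lebesgue (\<lambda>x. indicat_real {a..b} x *\<^sub>R u x)"
      using u by (auto simp: locally_integrable_def set_integrable_def)
    have "(\<lambda>n. LINT x|lebesgue. of_real (\<phi> n x) * (indicat_real {a..b} x *\<^sub>R u x)) \<longlonglongrightarrow> (LINT x|lebesgue. of_real (indicat_real {a<..<b} x) * (indicat_real {a..b} x *\<^sub>R u x))"
    proof (rule L1_limit_mult_bounded[OF i i, where C = 1])
      show "(\<lambda>x. complex_of_real (\<phi> n x)) \<in> borel_measurable lebesgue" for n
        by (intro complex_of_real_measurable continuous_imp_lebesgue_measurable smooth_continuous)
           (use tf[of n] in \<open>simp add: test_function_iff\<close>)
      show "(\<lambda>x. complex_of_real (indicat_real {a<..<b} x)) \<in> borel_measurable lebesgue"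
        by (intro complex_of_real_measurable borel_measurable_indicator) simp
    qed (use \<phi>01 in \<open>auto intro!: tendsto_of_real \<phi>lim\<close>)
    moreover have "of_real (\<phi> n x) * (indicat_real {a..b} x *\<^sub>R u x) = u x * of_real (\<phi> n x)" for n x
      using \<phi>out[of x n] by (auto simp: indicator_def)
    moreover have "of_real (indicat_real {a<..<b} x) * (indicat_real {a..b} x *\<^sub>R u x) = indicat_real {a<..<b} x *\<^sub>R u x" for x
      by (auto simp: indicator_def)
    ultimately have "(\<lambda>n. LINT x|lebesgue. u x * of_real (\<phi> n x)) \<longlonglongrightarrow> (LINT x|lebesgue. indicat_real {a<..<b} x *\<^sub>R u x)" by simp
    then have "(\<lambda>n. 0) \<longlonglongrightarrow> (LINT x|lebesgue. indicat_real {a<..<b} x *\<^sub>R u x)" using 0[OF tf] by simp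
    then show ?thesis by (simp add: LIMSEQ_const_iff)
  qed
  have loc: "AE x in lebesgue. indicat_real {- real n<..<real n} x *\<^sub>R u x = 0" for n :: nat
  proof -
    define v where "v x = indicat_real {- real n<..<real n} x *\<^sub>R u x" for x
    have "integrable lebesgue (\<lambda>x. indicat_real {- real n<..<real n} x *\<^sub>R (indicat_real {- real n..real n} x *\<^sub>R u x))"
      by (rule integrable_mult_indicator) (use u in \<open>auto simp: locally_integrable_def set_integrable_def\<close>)
    moreover have "indicat_real {- real n<..<real n} x *\<^sub>R (indicat_real {- real n..real n} x *\<^sub>R u x) = v x" for x
      by (auto simp: v_def indicator_def)
    ultimately have vi: "integrable lebesgue v" by simp
    have v0: "(LINT t|lebesgue. indicat_real {x<..} t *\<^sub>R v t) = 0" for x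
    proof -
      have "indicat_real {x<..} t *\<^sub>R v t = indicat_real {max x (- real n)<..<real n} t *\<^sub>R u t" for t
        by (auto simp: v_def indicator_def)
      then have "(LINT t|lebesgue. indicat_real {x<..} t *\<^sub>R v t) = (LINT t|lebesgue. indicat_real {max x (- real n)<..<real n} t *\<^sub>R u t)"
        by presburger
      also have "\<dots> = 0"
      proof (cases "max x (- real n) < real n")
        case True then show ?thesis by (rule int0)
      next
        case False
        then have "{max x (- real n)<..<real n} = {}" by auto
        then show ?thesis by simp
      qed
      finally show ?thesis .
    qed
    have vx: "integrable lebesgue (\<lambda>t. indicat_real {x<..} t *\<^sub>R v t)" for x
      by (rule integrable_mult_indicator[OF _ vi]) simp
    have "AE t in lebesgue. Re (v t) = 0"
    proof (rule AE_zero_of_integral_greaterThan[OF integrable_Re[OF vi]])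
      fix x show "(LINT t|lebesgue. indicat_real {x<..} t * Re (v t)) = 0"
        using integral_Re[OF vx[of x]] v0[of x] by simp
    qed
    moreover have "AE t in lebesgue. Im (v t) = 0"
    proof (rule AE_zero_of_integral_greaterThan[OF integrable_Im[OF vi]])
      fix x show "(LINT t|lebesgue. indicat_real {x<..} t * Im (v t)) = 0"
        using integral_Im[OF vx[of x]] v0[of x] by simp
    qed
    ultimately have "AE t in lebesgue. v t = 0" by eventually_elim (simp add: complex_eq_iff)
    then show ?thesis by (simp only: v_def)
  qed
  have "AE x in lebesgue. \<forall>n::nat. indicat_real {- real n<..<real n} x *\<^sub>R u x = 0"
    unfolding AE_all_countable using loc by blast
  then show ?thesis
  proof eventually_elim
    case (elim x)
    obtain n :: nat where "\<bar>x\<bar> < real n" using reals_Archimedean2 by blast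
    then have "x \<in> {- real n<..<real n}" by auto
    then show ?case using elim[rule_format, of n] by simp
  qed
qed

lemma locally_integrable_diff:
  assumes "locally_integrable f" "locally_integrable g" shows "locally_integrable (\<lambda>x. f x - g x)"
  using assms by (simp add: locally_integrable_def set_integrable_def scaleR_diff_right)

lemma has_weak_deriv_unique:
  assumes "has_weak_deriv k f g" "has_weak_deriv k f h"
  shows "AE x in lebesgue. g x = h x"
proof -
  have g: "locally_integrable g" and h: "locally_integrable h" using assms by (auto simp: has_weak_deriv_def)
  have "AE x in lebesgue. g x - h x = 0"
  proof (rule fundamental_lemma_variations[OF locally_integrable_diff[OF g h]])
    fix \<phi> :: "real \<Rightarrow> real" assume \<phi>: "test_function \<phi>"
    have "(-1) ^ k * (LINT x|lebesgue. g x * of_real (\<phi> x)) = (-1) ^ k * (LINT x|lebesgue. h x * of_real (\<phi> x))"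
      using assms \<phi> by (simp add: has_weak_deriv_def)
    then have "(LINT x|lebesgue. g x * of_real (\<phi> x)) = (LINT x|lebesgue. h x * of_real (\<phi> x))" by simp
    then show "(LINT x|lebesgue. (g x - h x) * of_real (\<phi> x)) = 0"
      using test_function_mult_integrable[OF g \<phi>] test_function_mult_integrable[OF h \<phi>]
      by (simp add: left_diff_distrib)
  qed
  then show ?thesis by eventually_elim simp
qed

section \<open>Duality and weak boundary limits of Poisson integrals\<close>

lemma poisson_integrable_dominated_convergence:
  fixes f :: "real \<Rightarrow> complex" and h :: "nat \<Rightarrow> real \<Rightarrow> real"
  assumes f: "poisson_integrable f" and h: "\<And>n. h n \<in> borel_measurable lebesgue" "k \<in> borel_measurable lebesgue"
    and bound: "\<And>n t. \<bar>h n t\<bar> \<le> C / (1 + t\<^sup>2)" and lim: "\<And>t. (\<lambda>n. h n t) \<longlonglongrightarrow> k t"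
  shows "(\<lambda>n. LINT t|lebesgue. f t * of_real (h n t)) \<longlonglongrightarrow> (LINT t|lebesgue. f t * of_real (k t))"
proof (rule integral_dominated_convergence[where w = "\<lambda>t. C * (norm (f t) / (1 + t\<^sup>2))"])
  have fm: "f \<in> borel_measurable lebesgue" using f by (simp add: poisson_integrable_def)
  show "(\<lambda>t. f t * of_real (k t)) \<in> borel_measurable lebesgue"
    by (intro borel_measurable_times fm complex_of_real_measurable h)
  show "(\<lambda>t. f t * of_real (h n t)) \<in> borel_measurable lebesgue" for n
    by (intro borel_measurable_times fm complex_of_real_measurable h)
  show "integrable lebesgue (\<lambda>t. C * (norm (f t) / (1 + t\<^sup>2)))"
    using f unfolding poisson_integrable_def by (intro integrable_mult_right) auto
  show "AE t in lebesgue. (\<lambda>n. f t * of_real (h n t)) \<longlonglongrightarrow> f t * of_real (k t)"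
    by (intro AE_I2 tendsto_intros lim)
  show "AE t in lebesgue. norm (f t * of_real (h n t)) \<le> C * (norm (f t) / (1 + t\<^sup>2))" for n
  proof (rule AE_I2)
    fix t
    have "norm (f t) * \<bar>h n t\<bar> \<le> norm (f t) * (C / (1 + t\<^sup>2))" by (rule mult_left_mono[OF bound norm_ge_zero])
    then show "norm (f t * of_real (h n t)) \<le> C * (norm (f t) / (1 + t\<^sup>2))" by (simp add: norm_mult mult.commute)
  qed
qed

lemma poisson_integrable_mult_integrable:
  fixes f :: "real \<Rightarrow> complex" and h :: "real \<Rightarrow> real"
  assumes f: "poisson_integrable f" and h: "h \<in> borel_measurable lebesgue"
    and bound: "\<And>t. \<bar>h t\<bar> \<le> C / (1 + t\<^sup>2)"
  shows "integrable lebesgue (\<lambda>t. f t * of_real (h t))"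
proof (rule integrable_poisson_bound[OF f, where C = C])
  have fm: "f \<in> borel_measurable lebesgue" using f by (simp add: poisson_integrable_def)
  show "(\<lambda>t. f t * of_real (h t)) \<in> borel_measurable lebesgue"
    by (intro borel_measurable_times fm complex_of_real_measurable h)
  fix t
  have "norm (f t) * \<bar>h t\<bar> \<le> norm (f t) * (C / (1 + t\<^sup>2))" by (rule mult_left_mono[OF bound norm_ge_zero])
  then show "norm (f t * of_real (h t)) \<le> C * (norm (f t) / (1 + t\<^sup>2))" by (simp add: norm_mult mult.commute)
qed

lemma poisson_integrable_locally_integrable:
  fixes f :: "real \<Rightarrow> complex"
  assumes f: "poisson_integrable f" shows "locally_integrable f"
  unfolding locally_integrable_def set_integrable_def
proof (intro allI)
  fix a b :: real
  define M where "M = 1 + (max \<bar>a\<bar> \<bar>b\<bar>)\<^sup>2"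
  have "integrable lebesgue (\<lambda>x. f x * of_real (indicat_real {a..b} x))"
  proof (rule poisson_integrable_mult_integrable[OF f])
    show "indicat_real {a..b} \<in> borel_measurable lebesgue" by (rule borel_measurable_indicator) simp
    fix t
    show "\<bar>indicat_real {a..b} t\<bar> \<le> M / (1 + t\<^sup>2)"
    proof (cases "t \<in> {a..b}")
      case True
      then have "\<bar>t\<bar> \<le> max \<bar>a\<bar> \<bar>b\<bar>" by auto
      then have "t\<^sup>2 \<le> (max \<bar>a\<bar> \<bar>b\<bar>)\<^sup>2" by (metis abs_ge_zero power2_abs power_mono)
      then show ?thesis using True by (simp add: M_def divide_simps add_pos_nonneg)
    next
      case False then show ?thesis by (simp add: M_def)
    qed
  qed
  moreover have "f x * of_real (indicat_real {a..b} x) = indicat_real {a..b} x *\<^sub>R f x" for x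
    by (simp add: indicator_def)
  ultimately show "integrable lebesgue (\<lambda>x. indicat_real {a..b} x *\<^sub>R f x)" by simp
qed

text \<open>Uniformity in \<open>0 < y \<le> 1\<close> is the point: this bound is the dominating
  function both for exchanging integrals and for letting the height tend to 0.\<close>

lemma poisson_int_compact_support_bound:
  fixes \<phi> :: "real \<Rightarrow> real"
  assumes c: "continuous_on UNIV \<phi>" and R: "\<And>x. R < \<bar>x\<bar> \<Longrightarrow> \<phi> x = 0"
  shows "\<exists>C\<ge>0. \<forall>t y. 0 < y \<and> y \<le> 1 \<longrightarrow> poisson_int (\<lambda>x. \<bar>\<phi> x\<bar>) (Complex t y) \<le> C / (1 + t\<^sup>2)"
proof -
  obtain B where B: "0 \<le> B" "\<And>x. \<bar>\<phi> x\<bar> \<le> B" using compact_support_bounded[OF c R] by blast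
  define S where "S = max R 1"
  have S: "1 \<le> S" "\<And>x. S < \<bar>x\<bar> \<Longrightarrow> \<phi> x = 0" using R by (auto simp: S_def)
  have m: "\<phi> \<in> borel_measurable lebesgue" by (rule continuous_imp_lebesgue_measurable[OF c])
  have m': "(\<lambda>x. \<bar>\<phi> x\<bar>) \<in> borel_measurable lebesgue" using m by measurable
  \<comment> \<open>First summand: for \<open>\<bar>t\<bar> \<le> 2 * S\<close> the Poisson integral
    is at most \<open>B\<close>. Second: otherwise points of the support are at distance at least
    \<open>\<bar>t\<bar> / 2\<close>, so the kernel is at most \<open>4 / t\<^sup>2\<close> on an
    interval of length \<open>2 * S\<close>, and
    \<open>1 + t\<^sup>2 \<le> 2 * t\<^sup>2\<close>.\<close>
  define C where "C = B * (1 + (2 * S)\<^sup>2) + 16 * S * B"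
  have C0: "0 \<le> 16 * S * B" "0 \<le> B * (1 + (2 * S)\<^sup>2)" using B S(1) by auto
  have "poisson_int (\<lambda>x. \<bar>\<phi> x\<bar>) (Complex t y) \<le> C / (1 + t\<^sup>2)" if y: "0 < y" "y \<le> 1" for t y
  proof (cases "\<bar>t\<bar> \<le> 2 * S")
    case True
    have "norm (poisson_int (\<lambda>x. \<bar>\<phi> x\<bar>) (Complex t y)) \<le> B"
      by (rule norm_poisson_int_bounded[OF _ m']) (use y B in auto)
    then have "poisson_int (\<lambda>x. \<bar>\<phi> x\<bar>) (Complex t y) \<le> B" by simp
    moreover have "t\<^sup>2 \<le> (2 * S)\<^sup>2" using True by (metis abs_ge_zero power2_abs power_mono)
    then have "B * (1 + t\<^sup>2) \<le> C" using B(1) C0 mult_left_mono[of "1 + t\<^sup>2" "1 + (2 * S)\<^sup>2" B] unfolding C_def by linarith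
    then have "B \<le> C / (1 + t\<^sup>2)" by (simp add: pos_le_divide_eq add_pos_nonneg)
    ultimately show ?thesis by linarith
  next
    case False
    have "2 \<le> \<bar>t\<bar>" using False S(1) by linarith
    then have t2: "0 < t\<^sup>2" "1 \<le> t\<^sup>2" using power_mono[of 1 "\<bar>t\<bar>" 2] by auto
    have "integrable lebesgue (indicat_real {-S..S})" by (rule integrable_real_indicator) (use S(1) in auto)
    then have i: "integrable lebesgue (\<lambda>x. 4 * B / t\<^sup>2 * indicat_real {-S..S} x)" by (rule integrable_mult_right)
    have "norm (poisson_int (\<lambda>x. \<bar>\<phi> x\<bar>) (Complex t y)) \<le> (LINT x|lebesgue. 4 * B / t\<^sup>2 * indicat_real {-S..S} x)"
      unfolding poisson_int_def
    proof (rule norm_integral_le_AE[OF _ i AE_I2])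
      show "integrable lebesgue (\<lambda>x. poisson (Complex t y) x *\<^sub>R \<bar>\<phi> x\<bar>)"
        by (rule integrable_poisson[OF poisson_integrable_bounded[OF m', of B]]) (use B y in auto)
      fix x
      show "norm (poisson (Complex t y) x *\<^sub>R \<bar>\<phi> x\<bar>) \<le> 4 * B / t\<^sup>2 * indicat_real {-S..S} x"
      proof (cases "S < \<bar>x\<bar>")
        case True then show ?thesis using S(2)[OF True] B by simp
      next
        case xS: False
        then have xin: "x \<in> {-S..S}" by auto
        have "\<bar>t\<bar> / 2 \<le> \<bar>x - t\<bar>" using xS False by linarith
        then have "(\<bar>t\<bar> / 2)\<^sup>2 \<le> \<bar>x - t\<bar>\<^sup>2" by (rule power_mono) simp
        then have "t\<^sup>2 / 4 \<le> (x - t)\<^sup>2" by (simp add: power_divide)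
        then have q: "t\<^sup>2 / 4 \<le> (x - t)\<^sup>2 + y\<^sup>2" using zero_le_power2[of y] by linarith
        have "1 * ((x - t)\<^sup>2 + y\<^sup>2) \<le> pi * ((x - t)\<^sup>2 + y\<^sup>2)" by (rule mult_right_mono) (use pi_ge_two in auto)
        then have den: "t\<^sup>2 / 4 \<le> pi * ((x - t)\<^sup>2 + y\<^sup>2)" unfolding mult_1 by (rule order_trans[OF q])
        have "poisson (Complex t y) x \<le> 1 / (t\<^sup>2 / 4)"
          unfolding poisson_Complex using den t2 y by (intro frac_le) auto
        then have "poisson (Complex t y) x * \<bar>\<phi> x\<bar> \<le> 4 / t\<^sup>2 * B"
          using B(2)[of x] poisson_nonneg[of "Complex t y" x] y t2 by (intro mult_mono) auto
        then show ?thesis using xin poisson_nonneg[of "Complex t y" x] y by (simp add: abs_mult)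
      qed
    qed
    also have "\<dots> = 8 * S * B / t\<^sup>2" using S(1) by (simp add: mult_ac)
    also have "\<dots> \<le> C / (1 + t\<^sup>2)"
    proof -
      have "8 * S * B * (1 + t\<^sup>2) \<le> 8 * S * B * (2 * t\<^sup>2)"
        using t2 B S(1) by (intro mult_left_mono) auto
      also have "\<dots> \<le> C * t\<^sup>2" using C0 t2 mult_right_mono[of "16 * S * B" C "t\<^sup>2"] by (simp add: C_def mult_ac)
      finally show ?thesis using t2 by (simp add: divide_simps add_pos_nonneg mult_ac)
    qed
    finally show ?thesis by simp
  qed
  then show ?thesis using C0 by (intro exI[of _ C]) (auto simp: C_def)
qed

text \<open>Symmetry of the kernel and Fubini. As \<open>f\<close> is integrable only against the
  weight \<open>1 / (1 + t\<^sup>2)\<close>, the decay of the Poisson integral of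
  \<open>\<bar>\<phi> x\<bar>\<close> has to supply that weight.\<close>

lemma poisson_int_duality:
  fixes f :: "real \<Rightarrow> complex" and \<phi> :: "real \<Rightarrow> real"
  assumes f: "poisson_integrable f" and c: "continuous_on UNIV \<phi>" and R: "\<And>x. R < \<bar>x\<bar> \<Longrightarrow> \<phi> x = 0"
    and y: "0 < y" "y \<le> 1"
  shows "(LINT x|lebesgue. poisson_int f (Complex x y) * of_real (\<phi> x)) = (LINT t|lebesgue. f t * of_real (poisson_int \<phi> (Complex t y)))"
proof -
  have ex: "\<exists>C\<ge>0. \<forall>t y. 0 < y \<and> y \<le> 1 \<longrightarrow> poisson_int (\<lambda>x. \<bar>\<phi> x\<bar>) (Complex t y) \<le> C / (1 + t\<^sup>2)"
    by (rule poisson_int_compact_support_bound[OF c R])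
  obtain C where C0: "0 \<le> C" and C1: "\<forall>t y. 0 < y \<and> y \<le> 1 \<longrightarrow> poisson_int (\<lambda>x. \<bar>\<phi> x\<bar>) (Complex t y) \<le> C / (1 + t\<^sup>2)"
    using ex by (elim exE conjE)
  note C = C0 C1[rule_format, OF conjI[OF y]]
  obtain B where B: "0 \<le> B" "\<And>x. \<bar>\<phi> x\<bar> \<le> B" using compact_support_bounded[OF c R] by blast
  have fm: "f \<in> borel_measurable lebesgue" using f by (simp add: poisson_integrable_def)
  have m: "\<phi> \<in> borel_measurable lebesgue" by (rule continuous_imp_lebesgue_measurable[OF c])
  have m': "(\<lambda>x. \<bar>\<phi> x\<bar>) \<in> borel_measurable lebesgue" using m by measurable
  have pa: "poisson_integrable (\<lambda>x. \<bar>\<phi> x\<bar>)" by (rule poisson_integrable_bounded[OF m', of B]) (use B in auto)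
  note [measurable] = fm m
  let ?h = "\<lambda>t x. f t * of_real (poisson (Complex t y) x * \<phi> x)"
  have int: "integrable (lebesgue \<Otimes>\<^sub>M lebesgue) (case_prod ?h)"
  proof (rule integrableI_bounded)
    show mh: "case_prod ?h \<in> borel_measurable (lebesgue \<Otimes>\<^sub>M lebesgue)"
      unfolding case_prod_beta by measurable
    have "(\<integral>\<^sup>+ p. ennreal (norm (case_prod ?h p)) \<partial>(lebesgue \<Otimes>\<^sub>M lebesgue))
      = (\<integral>\<^sup>+ t. (\<integral>\<^sup>+ x. ennreal (norm (?h t x)) \<partial>lebesgue) \<partial>lebesgue)"
      using sigma_finite_measure.nn_integral_fst[OF sigma_finite_lebesgue, of "\<lambda>p. ennreal (norm (case_prod ?h p))" lebesgue] mh
      by simp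
    also have "\<dots> \<le> (\<integral>\<^sup>+ t. ennreal (C * (cmod (f t) / (1 + t\<^sup>2))) \<partial>lebesgue)"
    proof (rule nn_integral_mono)
      fix t
      have z: "0 < Im (Complex t y)" using y by simp
      have i: "integrable lebesgue (\<lambda>x. cmod (f t) * (poisson (Complex t y) x *\<^sub>R \<bar>\<phi> x\<bar>))"
        by (rule integrable_mult_right[OF integrable_poisson[OF pa z]])
      have "(\<integral>\<^sup>+ x. ennreal (norm (?h t x)) \<partial>lebesgue) = (\<integral>\<^sup>+ x. ennreal (cmod (f t) * (poisson (Complex t y) x *\<^sub>R \<bar>\<phi> x\<bar>)) \<partial>lebesgue)"
        using poisson_nonneg[OF z] by (simp add: norm_mult abs_mult)
      also have "\<dots> = ennreal (LINT x|lebesgue. cmod (f t) * (poisson (Complex t y) x *\<^sub>R \<bar>\<phi> x\<bar>))"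
        by (rule nn_integral_eq_integral[OF i]) (use poisson_nonneg[OF z] in auto)
      also have "(LINT x|lebesgue. cmod (f t) * (poisson (Complex t y) x *\<^sub>R \<bar>\<phi> x\<bar>)) = cmod (f t) * poisson_int (\<lambda>x. \<bar>\<phi> x\<bar>) (Complex t y)"
        unfolding poisson_int_def by (rule integral_mult_right_zero)
      also have "ennreal \<dots> \<le> ennreal (C * (cmod (f t) / (1 + t\<^sup>2)))"
        using mult_left_mono[OF C(2)[of t] norm_ge_zero[of "f t"]] by (intro ennreal_leI) (simp add: mult.commute)
      finally show "(\<integral>\<^sup>+ x. ennreal (norm (?h t x)) \<partial>lebesgue) \<le> ennreal (C * (cmod (f t) / (1 + t\<^sup>2)))" .
    qed
    also have "\<dots> < \<infinity>"
    proof -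
      have "integrable lebesgue (\<lambda>t. C * (cmod (f t) / (1 + t\<^sup>2)))"
        using f unfolding poisson_integrable_def by (intro integrable_mult_right) auto
      then show ?thesis using C(1) by (subst nn_integral_eq_integral) auto
    qed
    finally show "(\<integral>\<^sup>+ p. ennreal (norm (case_prod ?h p)) \<partial>(lebesgue \<Otimes>\<^sub>M lebesgue)) < \<infinity>" .
  qed
  have a: "poisson_int f (Complex x y) * of_real (\<phi> x) = (LINT t|lebesgue. ?h t x)" for x
  proof -
    have "?h t x = (poisson (Complex x y) t *\<^sub>R f t) * of_real (\<phi> x)" for t
      unfolding poisson_swap[of x y t] by (simp add: scaleR_conv_of_real)
    then have "(LINT t|lebesgue. ?h t x) = (LINT t|lebesgue. (poisson (Complex x y) t *\<^sub>R f t) * of_real (\<phi> x))" by presburger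
    then show ?thesis
      unfolding Bochner_Integration.integral_mult_left_zero poisson_int_def by (rule sym)
  qed
  have b: "(LINT x|lebesgue. ?h t x) = f t * of_real (poisson_int \<phi> (Complex t y))" for t
  proof -
    have "(LINT x|lebesgue. ?h t x) = f t * (LINT x|lebesgue. of_real (poisson (Complex t y) x * \<phi> x))"
      by (rule Bochner_Integration.integral_mult_right_zero)
    also have "(LINT x|lebesgue. complex_of_real (poisson (Complex t y) x * \<phi> x)) = of_real (LINT x|lebesgue. poisson (Complex t y) x * \<phi> x)"
      by (rule integral_complex_of_real)
    finally show ?thesis by (simp add: poisson_int_def)
  qed
  show ?thesis unfolding a b[symmetric] by (rule lebesgue_pair.Fubini_integral[OF int])
qed

text \<open>The Poisson operator is moved to \<open>\<phi>\<close>, which is continuous, so that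
  pointwise convergence and a dominating function are at hand. In this way \<open>f\<close> is
  recovered from its extension in every exponent and without nontangential limits.\<close>

lemma poisson_int_weak_limit:
  fixes f :: "real \<Rightarrow> complex" and \<phi> :: "real \<Rightarrow> real"
  assumes f: "poisson_integrable f" and c: "continuous_on UNIV \<phi>" and R: "\<And>x. R < \<bar>x\<bar> \<Longrightarrow> \<phi> x = 0"
  shows "(\<lambda>n. LINT x|lebesgue. poisson_int f (Complex x (1 / real (Suc n))) * of_real (\<phi> x)) \<longlonglongrightarrow> (LINT t|lebesgue. f t * of_real (\<phi> t))"
proof -
  define e where "e n = 1 / real (Suc n)" for n
  have e: "0 < e n" "e n \<le> 1" for n by (auto simp: e_def)
  have e0: "e \<longlonglongrightarrow> 0" unfolding e_def using LIMSEQ_inverse_real_of_nat by (simp add: inverse_eq_divide)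
  have ex: "\<exists>C\<ge>0. \<forall>t y. 0 < y \<and> y \<le> 1 \<longrightarrow> poisson_int (\<lambda>x. \<bar>\<phi> x\<bar>) (Complex t y) \<le> C / (1 + t\<^sup>2)"
    by (rule poisson_int_compact_support_bound[OF c R])
  obtain C where C0: "0 \<le> C" and C1: "\<forall>t y. 0 < y \<and> y \<le> 1 \<longrightarrow> poisson_int (\<lambda>x. \<bar>\<phi> x\<bar>) (Complex t y) \<le> C / (1 + t\<^sup>2)"
    using ex by (elim exE conjE)
  note C = C0 C1[rule_format]
  obtain B where B: "0 \<le> B" "\<And>x. \<bar>\<phi> x\<bar> \<le> B" using compact_support_bounded[OF c R] by blast
  have m: "\<phi> \<in> borel_measurable lebesgue" by (rule continuous_imp_lebesgue_measurable[OF c])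
  have p: "poisson_integrable \<phi>" by (rule poisson_integrable_bounded[OF m, of B]) (use B in auto)
  have lim: "(\<lambda>n. poisson_int \<phi> (Complex t (e n))) \<longlonglongrightarrow> \<phi> t" for t
  proof -
    have "(poisson_int \<phi> \<longlongrightarrow> \<phi> t) (at (of_real t) within {z. 0 < Im z})"
      by (rule poisson_int_tendsto_boundary[OF p]) (use c in \<open>simp add: continuous_on_eq_continuous_at\<close>)
    moreover have "filterlim (\<lambda>n. Complex t (e n)) (at (of_real t) within {z. 0 < Im z}) sequentially"
      unfolding filterlim_at
    proof
      show "\<forall>\<^sub>F n in sequentially. Complex t (e n) \<in> {z. 0 < Im z} \<and> Complex t (e n) \<noteq> of_real t"
        using e by (intro always_eventually) (auto simp: complex_eq_iff less_imp_neq[symmetric])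
      have "(\<lambda>n. of_real t + \<i> * of_real (e n)) \<longlonglongrightarrow> of_real t + \<i> * of_real 0" by (intro tendsto_intros e0)
      then show "(\<lambda>n. Complex t (e n)) \<longlonglongrightarrow> of_real t" by (simp add: Complex_eq)
    qed
    ultimately show ?thesis by (rule filterlim_compose)
  qed
  have mm: "(\<lambda>t. poisson_int \<phi> (Complex t y)) \<in> borel_measurable lebesgue" for y
  proof -
    have "(\<lambda>t. LINT x|lebesgue. (case (t, x) of (t, x) \<Rightarrow> poisson (Complex t y) x *\<^sub>R \<phi> x)) \<in> borel_measurable lebesgue"
      by (rule sigma_finite_measure.borel_measurable_lebesgue_integral[OF sigma_finite_lebesgue])
         (use m in \<open>simp add: case_prod_beta, measurable\<close>)
    then show ?thesis by (simp add: poisson_int_def)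
  qed
  have "(\<lambda>n. LINT t|lebesgue. f t * of_real (poisson_int \<phi> (Complex t (e n)))) \<longlonglongrightarrow> (LINT t|lebesgue. f t * of_real (\<phi> t))"
  proof (rule poisson_integrable_dominated_convergence[OF f mm m _ lim])
    fix n t
    show "\<bar>poisson_int \<phi> (Complex t (e n))\<bar> \<le> C / (1 + t\<^sup>2)"
      using norm_poisson_int_le[of "Complex t (e n)" \<phi>] C(2)[of "e n" t] e[of n] by simp
  qed
  then show ?thesis using poisson_int_duality[OF f c R e] by (simp add: e_def)
qed

lemma poisson_int_inj:
  fixes f g :: "real \<Rightarrow> complex"
  assumes f: "poisson_integrable f" and g: "poisson_integrable g"
    and eq: "\<And>z. 0 < Im z \<Longrightarrow> poisson_int f z = poisson_int g z"
  shows "AE x in lebesgue. f x = g x"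
proof -
  have h: "poisson_integrable (\<lambda>t. f t - g t)" by (rule poisson_integrable_diff[OF f g])
  have "AE x in lebesgue. f x - g x = 0"
  proof (rule fundamental_lemma_variations[OF poisson_integrable_locally_integrable[OF h]])
    fix \<phi> :: "real \<Rightarrow> real" assume "test_function \<phi>"
    then obtain R where s: "smooth \<phi>" and R: "\<And>x. R < \<bar>x\<bar> \<Longrightarrow> \<phi> x = 0" by (auto simp: test_function_iff)
    have "poisson_int (\<lambda>t. f t - g t) (Complex x (1 / real (Suc n))) = 0" for x n
      using poisson_int_diff[OF f g, of "Complex x (1 / real (Suc n))"] eq[of "Complex x (1 / real (Suc n))"] by simp
    then have "(\<lambda>n. 0) \<longlonglongrightarrow> (LINT t|lebesgue. (f t - g t) * of_real (\<phi> t))"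
      using poisson_int_weak_limit[OF h smooth_continuous[OF s] R] by simp
    then show "(LINT t|lebesgue. (f t - g t) * of_real (\<phi> t)) = 0" by (simp add: LIMSEQ_const_iff)
  qed
  then show ?thesis by eventually_elim simp
qed

section \<open>Weak derivatives of boundary functions and derivatives of Poisson integrals\<close>

lemma compact_support_LINT_eq_integral:
  fixes u :: "real \<Rightarrow> complex"
  assumes c: "continuous_on UNIV u" and R: "\<And>x. R < \<bar>x\<bar> \<Longrightarrow> u x = 0"
  shows "(LINT x|lebesgue. u x) = integral {-R..R} u"
proof -
  have "set_integrable lebesgue {-R..R} u"
    by (rule absolutely_integrable_continuous_real[OF continuous_on_subset[OF c]]) simp
  then have "(LINT x:{-R..R}|lebesgue. u x) = integral {-R..R} u" by (rule set_lebesgue_integral_eq_integral(2))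
  moreover have "indicat_real {-R..R} x *\<^sub>R u x = u x" for x
    using R[of x] by (cases "R < \<bar>x\<bar>") (auto simp: indicator_def)
  ultimately show ?thesis by (simp add: set_lebesgue_integral_def)
qed

lemma horizontal_integration_by_parts:
  fixes F :: "complex \<Rightarrow> complex"
  assumes hol: "F holomorphic_on upper_half_plane" and y: "0 < y" and \<phi>: "test_function \<phi>"
  shows "(LINT x|lebesgue. F (Complex x y) * of_real (deriv \<phi> x)) = - (LINT x|lebesgue. deriv F (Complex x y) * of_real (\<phi> x))"
proof -
  have s: "smooth \<phi>" and t: "test_function (deriv \<phi>)" using \<phi> test_function_deriv by (auto simp: test_function_iff)
  obtain R1 R2 where R12: "\<And>x. R1 < \<bar>x\<bar> \<Longrightarrow> \<phi> x = 0" "\<And>x. R2 < \<bar>x\<bar> \<Longrightarrow> deriv \<phi> x = 0"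
    using \<phi> t by (auto simp: test_function_iff)
  \<comment> \<open>One unit beyond both supports, so that \<open>\<phi>\<close> and its derivative
    vanish at the end points \<open>R\<close> and \<open>-R\<close> too and the boundary terms drop
    out.\<close>
  define R where "R = max (max R1 R2) 0 + 1"
  have R: "0 < R" "\<And>x. R \<le> \<bar>x\<bar> \<Longrightarrow> \<phi> x = 0" "\<And>x. R \<le> \<bar>x\<bar> \<Longrightarrow> deriv \<phi> x = 0"
    using R12 by (auto simp: R_def)
  have hol': "deriv F holomorphic_on upper_half_plane" by (rule holomorphic_deriv[OF hol open_upper_half_plane])
  have c1: "continuous_on UNIV (\<lambda>x. F (Complex x y) * of_real (deriv \<phi> x))"
    by (intro continuous_intros continuous_on_horizontal[OF hol y] smooth_continuous[OF smooth_deriv[OF s]])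
  have c2: "continuous_on UNIV (\<lambda>x. deriv F (Complex x y) * of_real (\<phi> x))"
    by (intro continuous_intros continuous_on_horizontal[OF hol' y] smooth_continuous[OF s])
  have D: "((\<lambda>x. F (Complex x y) * of_real (\<phi> x)) has_vector_derivative
      (F (Complex x y) * of_real (deriv \<phi> x) + deriv F (Complex x y) * of_real (\<phi> x))) (at x within {-R..R})" for x
  proof -
    have "(F has_field_derivative deriv F (of_real x + \<i> * of_real y)) (at (of_real x + \<i> * of_real y))"
      by (rule holomorphic_derivI[OF hol open_upper_half_plane]) (use y in \<open>simp add: upper_half_plane_def\<close>)
    then have "((\<lambda>w. F (w + \<i> * of_real y)) has_field_derivative deriv F (of_real x + \<i> * of_real y)) (at (of_real x))"
      by (simp add: DERIV_shift)
    then have a: "((\<lambda>x. F (of_real x + \<i> * of_real y)) has_vector_derivative deriv F (of_real x + \<i> * of_real y)) (at x within {-R..R})"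
      by (rule has_vector_derivative_real_field[THEN has_vector_derivative_at_within])
    have b: "((\<lambda>x. complex_of_real (\<phi> x)) has_vector_derivative of_real (deriv \<phi> x)) (at x within {-R..R})"
      using smooth_DERIV[OF s, of x]
      by (intro has_vector_derivative_of_real has_vector_derivative_at_within) (simp add: has_real_derivative_iff_has_vector_derivative)
    show ?thesis using has_vector_derivative_mult[OF a b] by (simp add: Complex_eq)
  qed
  have "((\<lambda>x. F (Complex x y) * of_real (deriv \<phi> x) + deriv F (Complex x y) * of_real (\<phi> x)) has_integral
      F (Complex R y) * of_real (\<phi> R) - F (Complex (-R) y) * of_real (\<phi> (-R))) {-R..R}"
    by (rule fundamental_theorem_of_calculus) (use R D in auto)
  then have "integral {-R..R} (\<lambda>x. F (Complex x y) * of_real (deriv \<phi> x) + deriv F (Complex x y) * of_real (\<phi> x)) = 0"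
    using R by (simp add: integral_unique)
  moreover have "integral {-R..R} (\<lambda>x. F (Complex x y) * of_real (deriv \<phi> x) + deriv F (Complex x y) * of_real (\<phi> x))
    = integral {-R..R} (\<lambda>x. F (Complex x y) * of_real (deriv \<phi> x)) + integral {-R..R} (\<lambda>x. deriv F (Complex x y) * of_real (\<phi> x))"
    by (intro Henstock_Kurzweil_Integration.integral_add integrable_continuous_real continuous_on_subset[OF c1] continuous_on_subset[OF c2]) auto
  ultimately show ?thesis
    using compact_support_LINT_eq_integral[OF c1, of R] compact_support_LINT_eq_integral[OF c2, of R] R
    by (simp add: add_eq_0_iff2)
qed

text \<open>Integration by parts is valid on every line inside the half-plane, and both sides
  converge as the height tends to 0 by \<open>poisson_int_weak_limit\<close>.\<close>

lemma weak_deriv_of_boundary_values: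
  fixes F :: "complex \<Rightarrow> complex"
  assumes hol: "F holomorphic_on upper_half_plane" and f: "poisson_integrable f" and g: "poisson_integrable g"
    and Ff: "\<And>z. 0 < Im z \<Longrightarrow> F z = poisson_int f z" and Fg: "\<And>z. 0 < Im z \<Longrightarrow> deriv F z = poisson_int g z"
    and \<phi>: "test_function \<phi>"
  shows "(LINT x|lebesgue. f x * of_real (deriv \<phi> x)) = - (LINT x|lebesgue. g x * of_real (\<phi> x))"
proof -
  obtain R1 R2 where R12: "\<And>x. R1 < \<bar>x\<bar> \<Longrightarrow> \<phi> x = 0" "\<And>x. R2 < \<bar>x\<bar> \<Longrightarrow> deriv \<phi> x = 0"
    using \<phi> test_function_deriv[OF \<phi>] by (auto simp: test_function_iff)
  have s: "smooth \<phi>" using \<phi> by (simp add: test_function_iff)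
  have eq1: "F (Complex x (1 / real (Suc n))) = poisson_int f (Complex x (1 / real (Suc n)))"
    and eq2: "deriv F (Complex x (1 / real (Suc n))) = poisson_int g (Complex x (1 / real (Suc n)))" for x n
    by (rule Ff Fg; simp)+
  have l1: "(\<lambda>n. LINT x|lebesgue. F (Complex x (1 / real (Suc n))) * of_real (deriv \<phi> x)) \<longlonglongrightarrow> (LINT x|lebesgue. f x * of_real (deriv \<phi> x))"
    unfolding eq1 by (rule poisson_int_weak_limit[OF f smooth_continuous[OF smooth_deriv[OF s]] R12(2)])
  have l2: "(\<lambda>n. LINT x|lebesgue. deriv F (Complex x (1 / real (Suc n))) * of_real (\<phi> x)) \<longlonglongrightarrow> (LINT x|lebesgue. g x * of_real (\<phi> x))"
    unfolding eq2 by (rule poisson_int_weak_limit[OF g smooth_continuous[OF s] R12(1)])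
  have parts: "(LINT x|lebesgue. F (Complex x (1 / real (Suc n))) * of_real (deriv \<phi> x)) = - (LINT x|lebesgue. deriv F (Complex x (1 / real (Suc n))) * of_real (\<phi> x))" for n
    by (rule horizontal_integration_by_parts[OF hol _ \<phi>]) simp
  have "(\<lambda>n. LINT x|lebesgue. F (Complex x (1 / real (Suc n))) * of_real (deriv \<phi> x)) \<longlonglongrightarrow> - (LINT x|lebesgue. g x * of_real (\<phi> x))"
    using tendsto_minus[OF l2] unfolding parts .
  then show ?thesis by (rule LIMSEQ_unique[OF l1])
qed

lemma poisson_eq_Im: "poisson z t = Im (inverse (of_real t - z)) / pi"
  by (simp add: poisson_def cmod_power2)

lemma inverse_cmod_kernel_bound:
  assumes z: "0 < Im z"
  shows "1 / cmod (of_real t - z) \<le> kernel_const z / cmod (of_real t + \<i>)"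
proof -
  have "0 < cmod (of_real t - z)" "0 < cmod (of_real t + \<i>)"
    using of_real_diff_nonzero[OF z, of t] by (auto simp: complex_eq_iff)
  then show ?thesis using kernel_bound[OF z, of t] by (simp add: divide_simps mult.commute)
qed

lemma two_kernels_bound:
  assumes z: "0 < Im z" and w: "0 < Im w"
  shows "cmod (inverse (of_real t - z) * inverse (of_real t - w)) \<le> kernel_const z * kernel_const w / (1 + t\<^sup>2)"
proof -
  have "1 / cmod (of_real t - z) * (1 / cmod (of_real t - w))
      \<le> kernel_const z / cmod (of_real t + \<i>) * (kernel_const w / cmod (of_real t + \<i>))"
    using kernel_const_ge1[OF z]
    by (intro mult_mono inverse_cmod_kernel_bound z w) auto
  also have "\<dots> = kernel_const z * kernel_const w / (cmod (of_real t + \<i>))\<^sup>2" by (simp add: power2_eq_square)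
  finally show ?thesis by (simp only: cmod_of_real_plus_i_square norm_mult norm_divide norm_one inverse_eq_divide)
qed

text \<open>Each bump contributes \<open>exp (- 1)\<close> at the origin, whence the factor
  \<open>exp 2\<close>. The value 1 at 0 is enough for a cutoff that is to be dilated, by
  continuity. The arguments are written in the affine form of
  \<open>smooth_alg.bump\<close>.\<close>

definition cutoff :: "real \<Rightarrow> real" where
  "cutoff t = exp 2 * (bump 0 (1 * t + 1) * bump 0 ((- 1) * t + 1))"

lemma cutoff_smooth: "smooth cutoff"
  unfolding cutoff_def
  by (rule smooth_alg_smooth[OF smooth_alg.mult[OF smooth_alg.base[OF smooth_const] smooth_alg.mult[OF smooth_alg.bump smooth_alg.bump]]])

lemma cutoff_0: "cutoff 0 = 1"
  by (simp add: cutoff_def bump_def exp_add[symmetric])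

lemma cutoff_outside: "1 < \<bar>t\<bar> \<Longrightarrow> cutoff t = 0"
  by (auto simp: cutoff_def bump_def)

text \<open>The Poisson kernel is not a test function, but its products with dilated cutoffs are.
  Kernel and derivative are both bounded by multiples of \<open>1 / (1 + t\<^sup>2)\<close>, so
  dominated convergence extends the weak identity to the kernel itself. The left side carries the
  derivative of the kernel in \<open>t\<close> with its sign reversed.\<close>

lemma weak_deriv_poisson_kernel:
  fixes f g :: "real \<Rightarrow> complex"
  assumes f: "poisson_integrable f" and g: "poisson_integrable g" and z: "0 < Im z"
    and weak: "\<And>\<phi>. test_function \<phi> \<Longrightarrow> (LINT x|lebesgue. f x * of_real (deriv \<phi> x)) = - (LINT x|lebesgue. g x * of_real (\<phi> x))"
  shows "(LINT t|lebesgue. f t * of_real (Im (inverse (of_real t - z) ^ 2) / pi)) = poisson_int g z"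
proof -
  define \<psi> where "\<psi> t = Im (of_real (1 / pi) * inverse (of_real t - z) ^ 1)" for t
  define \<psi>' where "\<psi>' t = - (Im (inverse (of_real t - z) ^ 2) / pi)" for t
  have D\<psi>: "(\<psi> has_real_derivative \<psi>' t) (at t)" for t
    using has_real_derivative_kernel[OF z, of "of_real (1 / pi)" 1 t] unfolding \<psi>_def \<psi>'_def by (simp add: numeral_2_eq_2)
  have \<psi>P: "\<psi> t = poisson z t" for t by (simp add: \<psi>_def poisson_eq_Im)
  have "deriv cutoff t = 0" if "1 < \<bar>t\<bar>" for t
  proof (rule DERIV_imp_deriv)
    have "open {x::real. 1 < \<bar>x\<bar>}" by (intro open_Collect_less continuous_intros)
    then have "\<forall>\<^sub>F u in nhds t. u \<in> {x. 1 < \<bar>x\<bar>}" using that by (intro eventually_nhds_in_open) auto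
    then have "\<forall>\<^sub>F u in nhds t. 0 = cutoff u" by eventually_elim (simp add: cutoff_outside)
    moreover have "((\<lambda>_. 0) has_real_derivative 0) (at t)" by simp
    ultimately show "(cutoff has_real_derivative 0) (at t)" by (rule DERIV_cong_ev[OF refl _ refl, THEN iffD1])
  qed
  then obtain B' where B': "0 \<le> B'" "\<And>t. \<bar>deriv cutoff t\<bar> \<le> B'"
    using compact_support_bounded[OF smooth_continuous[OF smooth_deriv[OF cutoff_smooth]], of 1] by blast
  obtain B where B: "0 \<le> B" "\<And>t. \<bar>cutoff t\<bar> \<le> B"
    using compact_support_bounded[OF smooth_continuous[OF cutoff_smooth] cutoff_outside] by blast
  define m where "m n = 1 / real (Suc n)" for n
  have m: "0 < m n" "m n \<le> 1" for n by (auto simp: m_def)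
  have m0: "m \<longlonglongrightarrow> 0" unfolding m_def using LIMSEQ_inverse_real_of_nat by (simp add: inverse_eq_divide)
  define \<phi> where "\<phi> n t = cutoff (m n * t) * \<psi> t" for n t
  \<comment> \<open>Product rule; differentiating the dilated cutoff brings out a factor
    \<open>m n\<close>, so the first term tends to 0 while staying dominated.\<close>
  define \<phi>' where "\<phi>' n t = (m n * deriv cutoff (m n * t)) * \<psi> t + cutoff (m n * t) * \<psi>' t" for n t
  have D\<phi>: "(\<phi> n has_real_derivative \<phi>' n t) (at t)" for n t
  proof -
    have "((\<lambda>t. cutoff (m n * t)) has_real_derivative deriv cutoff (m n * t) * m n) (at t)"
      by (rule DERIV_chain2[OF smooth_DERIV[OF cutoff_smooth]]) (auto intro!: derivative_eq_intros)
    from DERIV_mult[OF this D\<psi>[of t]] show ?thesis unfolding \<phi>_def[abs_def] \<phi>'_def by (simp add: mult_ac add.commute)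
  qed
  have tf: "test_function (\<phi> n)" for n
    unfolding test_function_iff
  proof
    have eq: "\<phi> n = (\<lambda>t. (exp 2 * (bump 0 (m n * t + 1) * bump 0 ((- m n) * t + 1))) * Im (of_real (1 / pi) * inverse (of_real t - z) ^ 1))"
      by (rule ext) (simp add: \<phi>_def \<psi>_def cutoff_def)
    show "smooth (\<phi> n)" unfolding eq
      by (rule smooth_alg_smooth[OF smooth_alg.mult[OF smooth_alg.mult[OF smooth_alg.base[OF smooth_const]
            smooth_alg.mult[OF smooth_alg.bump smooth_alg.bump]] smooth_alg.kernel[OF z]]])
    have "\<phi> n t = 0" if "1 / m n < \<bar>t\<bar>" for t
    proof -
      have "1 < \<bar>m n * t\<bar>" using that m(1)[of n] by (simp add: abs_mult divide_simps mult.commute)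
      then show ?thesis by (simp add: \<phi>_def cutoff_outside)
    qed
    then show "\<exists>R. \<forall>x. R < \<bar>x\<bar> \<longrightarrow> \<phi> n x = 0" by blast
  qed
  define C where "C = Im z * (kernel_const z)\<^sup>2 / pi"
  define C' where "C' = kernel_const z * kernel_const z"
  have C: "0 \<le> C" "0 \<le> C'" using z by (auto simp: C_def C'_def)
  have \<psi>b: "\<bar>\<psi> t\<bar> \<le> C / (1 + t\<^sup>2)" for t
    using poisson_le[OF z, of t] poisson_nonneg[OF z, of t] by (simp add: \<psi>P C_def)
  have \<psi>'b: "\<bar>\<psi>' t\<bar> \<le> C' / (1 + t\<^sup>2)" for t
  proof -
    define w where "w = inverse (of_real t - z) * inverse (of_real t - z)"
    have "\<bar>\<psi>' t\<bar> = \<bar>Im w\<bar> / pi"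
      unfolding \<psi>'_def power2_eq_square w_def[symmetric] by simp
    also have "\<dots> \<le> cmod w / pi" by (rule divide_right_mono[OF abs_Im_le_cmod]) simp
    also have "\<dots> \<le> cmod w"
      using pi_gt3 by (simp add: divide_le_eq mult_le_cancel_left1)
    also have "\<dots> \<le> C' / (1 + t\<^sup>2)" unfolding w_def C'_def by (rule two_kernels_bound[OF z z])
    finally show ?thesis .
  qed
  have s1: "smooth (\<phi> n)" for n using tf by (simp add: test_function_iff)
  have d\<phi>: "deriv (\<phi> n) = \<phi>' n" for n by (rule ext) (rule DERIV_imp_deriv[OF D\<phi>])
  have m\<phi>: "\<phi> n \<in> borel_measurable lebesgue" "\<phi>' n \<in> borel_measurable lebesgue" for n
    using smooth_continuous[OF s1] smooth_continuous[OF smooth_deriv[OF s1]] unfolding d\<phi>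
    by (auto intro: continuous_imp_lebesgue_measurable)
  have m\<psi>: "\<psi> \<in> borel_measurable lebesgue" unfolding \<psi>P[abs_def] by measurable
  have s\<psi>: "smooth \<psi>" unfolding \<psi>_def[abs_def] by (rule smooth_alg_smooth[OF smooth_alg.kernel[OF z]])
  have d\<psi>: "deriv \<psi> = \<psi>'" by (rule ext) (rule DERIV_imp_deriv[OF D\<psi>])
  have m\<psi>': "\<psi>' \<in> borel_measurable lebesgue"
    using smooth_continuous[OF smooth_deriv[OF s\<psi>]] unfolding d\<psi> by (rule continuous_imp_lebesgue_measurable)
  have mt: "(\<lambda>n. m n * t) \<longlonglongrightarrow> 0" for t using tendsto_mult[OF m0 tendsto_const[of t]] by simp
  have cl: "(\<lambda>n. cutoff (m n * t)) \<longlonglongrightarrow> 1" for t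
  proof -
    have "isCont cutoff 0" using smooth_continuous[OF cutoff_smooth, of UNIV] by (simp add: continuous_on_eq_continuous_at)
    from isCont_tendsto_compose[OF this mt] show ?thesis by (simp add: cutoff_0)
  qed
  have \<phi>lim: "(\<lambda>n. \<phi> n t) \<longlonglongrightarrow> \<psi> t" for t
    using tendsto_mult[OF cl[of t] tendsto_const[of "\<psi> t"]] by (simp add: \<phi>_def)
  have \<phi>'lim: "(\<lambda>n. \<phi>' n t) \<longlonglongrightarrow> \<psi>' t" for t
  proof -
    have "(\<lambda>n. m n * deriv cutoff (m n * t)) \<longlonglongrightarrow> 0"
    proof (rule Lim_null_comparison)
      show "\<forall>\<^sub>F n in sequentially. norm (m n * deriv cutoff (m n * t)) \<le> m n * B'"
        using B'(2) m(1) by (intro always_eventually) (auto simp: abs_mult less_imp_le intro!: mult_left_mono)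
      show "(\<lambda>n. m n * B') \<longlonglongrightarrow> 0" using tendsto_mult[OF m0 tendsto_const[of B']] by simp
    qed
    then have "(\<lambda>n. (m n * deriv cutoff (m n * t)) * \<psi> t + cutoff (m n * t) * \<psi>' t) \<longlonglongrightarrow> 0 * \<psi> t + 1 * \<psi>' t"
      by (intro tendsto_intros cl)
    then show ?thesis by (simp add: \<phi>'_def)
  qed
  have l1: "(\<lambda>n. LINT t|lebesgue. f t * of_real (\<phi>' n t)) \<longlonglongrightarrow> (LINT t|lebesgue. f t * of_real (\<psi>' t))"
  proof (rule poisson_integrable_dominated_convergence[OF f m\<phi>(2) m\<psi>' _ \<phi>'lim])
    fix n t
    have "\<bar>m n * deriv cutoff (m n * t)\<bar> \<le> 1 * B'"
      unfolding abs_mult using m[of n] B' by (intro mult_mono) auto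
    then have a: "\<bar>(m n * deriv cutoff (m n * t)) * \<psi> t\<bar> \<le> B' * (C / (1 + t\<^sup>2))"
      unfolding abs_mult[of _ "\<psi> t"] using \<psi>b[of t] B' by (intro mult_mono) auto
    have b: "\<bar>cutoff (m n * t) * \<psi>' t\<bar> \<le> B * (C' / (1 + t\<^sup>2))"
      unfolding abs_mult using \<psi>'b[of t] B by (intro mult_mono) auto
    have "\<bar>\<phi>' n t\<bar> \<le> B' * (C / (1 + t\<^sup>2)) + B * (C' / (1 + t\<^sup>2))"
      unfolding \<phi>'_def using a b by linarith
    then show "\<bar>\<phi>' n t\<bar> \<le> (B' * C + B * C') / (1 + t\<^sup>2)" by (simp add: add_divide_distrib)
  qed
  have l2: "(\<lambda>n. LINT t|lebesgue. g t * of_real (\<phi> n t)) \<longlonglongrightarrow> (LINT t|lebesgue. g t * of_real (\<psi> t))"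
  proof (rule poisson_integrable_dominated_convergence[OF g m\<phi>(1) m\<psi> _ \<phi>lim])
    fix n t
    have "\<bar>cutoff (m n * t) * \<psi> t\<bar> \<le> B * (C / (1 + t\<^sup>2))"
      unfolding abs_mult using \<psi>b[of t] B by (intro mult_mono) auto
    then show "\<bar>\<phi> n t\<bar> \<le> (B * C) / (1 + t\<^sup>2)" by (simp add: \<phi>_def)
  qed
  have eq: "(LINT t|lebesgue. f t * of_real (\<phi>' n t)) = - (LINT t|lebesgue. g t * of_real (\<phi> n t))" for n
    using weak[OF tf[of n]] unfolding d\<phi> .
  have "(LINT t|lebesgue. f t * of_real (\<psi>' t)) = - (LINT t|lebesgue. g t * of_real (\<psi> t))"
    by (rule LIMSEQ_unique[OF l1[unfolded eq] tendsto_minus[OF l2]])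
  moreover have "(LINT t|lebesgue. g t * of_real (\<psi> t)) = poisson_int g z"
    by (simp add: \<psi>P poisson_int_def scaleR_conv_of_real mult.commute)
  moreover have "(LINT t|lebesgue. f t * of_real (\<psi>' t)) = - (LINT t|lebesgue. f t * of_real (Im (inverse (of_real t - z) ^ 2) / pi))"
    by (simp add: \<psi>'_def)
  ultimately show ?thesis by simp
qed

text \<open>Since \<open>F\<close> is holomorphic, its derivative can be computed along real
  increments. There the difference quotients of the kernel are imaginary parts of products of two
  resolvents, dominated by a multiple of \<open>1 / (1 + t\<^sup>2)\<close>. In the limit the
  derivative in the point is minus the derivative in \<open>t\<close>, which
  \<open>weak_deriv_poisson_kernel\<close> passes on to \<open>g\<close>.\<close>

lemma deriv_poisson_int:
  fixes F :: "complex \<Rightarrow> complex"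
  assumes hol: "F holomorphic_on upper_half_plane" and f: "poisson_integrable f" and g: "poisson_integrable g"
    and Ff: "\<And>z. 0 < Im z \<Longrightarrow> F z = poisson_int f z" and z: "0 < Im z"
    and weak: "\<And>\<phi>. test_function \<phi> \<Longrightarrow> (LINT x|lebesgue. f x * of_real (deriv \<phi> x)) = - (LINT x|lebesgue. g x * of_real (\<phi> x))"
  shows "deriv F z = poisson_int g z"
proof -
  define h where "h n = 1 / real (Suc n)" for n
  have h: "0 < h n" "h n \<le> 1" for n by (auto simp: h_def)
  have h0: "h \<longlonglongrightarrow> 0" unfolding h_def using LIMSEQ_inverse_real_of_nat by (simp add: inverse_eq_divide)
  have zh: "0 < Im (z + of_real (h n))" for n using z by simp
  have "(F has_field_derivative deriv F z) (at z)"
    by (rule holomorphic_derivI[OF hol open_upper_half_plane]) (use z in \<open>simp add: upper_half_plane_def\<close>)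
  then have "((\<lambda>w. (F (z + w) - F z) / w) \<longlongrightarrow> deriv F z) (at 0)" by (simp add: DERIV_def)
  moreover have "filterlim (\<lambda>n. complex_of_real (h n)) (at 0) sequentially"
    unfolding filterlim_at
  proof
    show "\<forall>\<^sub>F n in sequentially. complex_of_real (h n) \<in> UNIV \<and> complex_of_real (h n) \<noteq> 0"
      using h(1) by (intro always_eventually) (auto simp: less_imp_neq[symmetric])
    show "(\<lambda>n. complex_of_real (h n)) \<longlonglongrightarrow> 0" using tendsto_of_real[OF h0, where 'a = complex] by simp
  qed
  ultimately have l1: "(\<lambda>n. (F (z + of_real (h n)) - F z) / of_real (h n)) \<longlonglongrightarrow> deriv F z"
    by (rule filterlim_compose)
  define q where "q n t = (poisson (z + of_real (h n)) t - poisson z t) / h n" for n t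
  have q: "q n t = Im (inverse (of_real t - (z + of_real (h n))) * inverse (of_real t - z)) / pi" for n t
  proof -
    have alg: "(inverse (a - w) - inverse a) / w = inverse (a - w) * inverse a" if "a \<noteq> 0" "a - w \<noteq> 0" "w \<noteq> 0" for a w :: complex
      using that by (simp add: field_simps)
    have frac: "(a / pi - b / pi) / c = (a - b) / c / pi" for a b c :: real by (simp add: diff_divide_distrib mult.commute)
    have "q n t = Im ((inverse (of_real t - (z + of_real (h n))) - inverse (of_real t - z)) / of_real (h n)) / pi"
      unfolding q_def poisson_eq_Im frac Im_divide_of_real minus_complex.simps(2) ..
    also have "(inverse (of_real t - (z + of_real (h n))) - inverse (of_real t - z)) / of_real (h n)
      = inverse (of_real t - (z + of_real (h n))) * inverse (of_real t - z)"
      using alg[of "of_real t - z" "of_real (h n)"] of_real_diff_nonzero[OF z, of t] of_real_diff_nonzero[OF zh, of t n] h(1)[of n]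
      by (simp add: diff_diff_eq)
    finally show ?thesis .
  qed
  have dq: "(F (z + of_real (h n)) - F z) / of_real (h n) = (LINT t|lebesgue. f t * of_real (q n t))" for n
  proof -
    have "f t * of_real (q n t) = (poisson (z + of_real (h n)) t *\<^sub>R f t - poisson z t *\<^sub>R f t) / of_real (h n)" for t
      by (simp add: q_def scaleR_conv_of_real field_simps)
    then have "(LINT t|lebesgue. f t * of_real (q n t)) = (LINT t|lebesgue. (poisson (z + of_real (h n)) t *\<^sub>R f t - poisson z t *\<^sub>R f t) / of_real (h n))"
      by presburger
    also have "\<dots> = (LINT t|lebesgue. poisson (z + of_real (h n)) t *\<^sub>R f t - poisson z t *\<^sub>R f t) / of_real (h n)"
      by (rule integral_divide_zero)
    also have "(LINT t|lebesgue. poisson (z + of_real (h n)) t *\<^sub>R f t - poisson z t *\<^sub>R f t) = F (z + of_real (h n)) - F z"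
      unfolding Ff[OF zh] Ff[OF z] poisson_int_def
      by (rule Bochner_Integration.integral_diff[OF integrable_poisson[OF f zh] integrable_poisson[OF f z]])
    finally show ?thesis by simp
  qed
  have qm: "q n \<in> borel_measurable lebesgue" for n unfolding q_def[abs_def] by measurable
  \<comment> \<open>A bound for \<open>kernel_const\<close> at all the shifted points at once, from
    \<open>h n \<le> 1\<close> and the unchanged imaginary part.\<close>
  define K where "K = 1 + (cmod (z + \<i>) + 1) / Im z"
  have kK: "kernel_const (z + of_real (h n)) \<le> K" for n
  proof -
    have "cmod (z + of_real (h n) + \<i>) \<le> cmod (z + \<i>) + cmod (of_real (h n))"
      using norm_triangle_ineq[of "z + \<i>" "of_real (h n)"] by (simp add: algebra_simps)
    also have "cmod (of_real (h n) :: complex) \<le> 1" using h[of n] by simp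
    finally show ?thesis unfolding kernel_const_def K_def using z by (simp add: divide_right_mono)
  qed
  have qb: "\<bar>q n t\<bar> \<le> (K * kernel_const z) / (1 + t\<^sup>2)" for n t
  proof -
    let ?w = "inverse (of_real t - (z + of_real (h n))) * inverse (of_real t - z)"
    have "\<bar>q n t\<bar> \<le> cmod ?w / pi" unfolding q using abs_Im_le_cmod[of ?w] by (simp add: divide_right_mono)
    also have "\<dots> \<le> cmod ?w" using pi_gt3 by (simp add: divide_le_eq mult_le_cancel_left1)
    also have "\<dots> \<le> kernel_const (z + of_real (h n)) * kernel_const z / (1 + t\<^sup>2)" by (rule two_kernels_bound[OF zh z])
    also have "\<dots> \<le> (K * kernel_const z) / (1 + t\<^sup>2)"
      using kK[of n] kernel_const_ge1[OF z] by (intro divide_right_mono mult_right_mono) auto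
    finally show ?thesis .
  qed
  have ql: "(\<lambda>n. q n t) \<longlonglongrightarrow> Im (inverse (of_real t - z) ^ 2) / pi" for t
  proof -
    have "(\<lambda>n. Im (inverse (of_real t - (z + of_real (h n))) * inverse (of_real t - z)) / pi) \<longlonglongrightarrow> Im (inverse (of_real t - (z + of_real 0)) * inverse (of_real t - z)) / pi"
      using of_real_diff_nonzero[OF z, of t] by (intro tendsto_intros h0) auto
    then show ?thesis unfolding q power2_eq_square by simp
  qed
  have km: "(\<lambda>t. Im (inverse (of_real t - z) ^ 2) / pi) \<in> borel_measurable lebesgue"
    by (rule borel_measurable_LIMSEQ_real[OF _ qm]) (rule ql)
  have lim: "(\<lambda>n. LINT t|lebesgue. f t * of_real (q n t)) \<longlonglongrightarrow> (LINT t|lebesgue. f t * of_real (Im (inverse (of_real t - z) ^ 2) / pi))"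
    by (rule poisson_integrable_dominated_convergence[OF f qm km qb ql])
  have wk: "(LINT t|lebesgue. f t * of_real (Im (inverse (of_real t - z) ^ 2) / pi)) = poisson_int g z"
    by (rule weak_deriv_poisson_kernel[OF f g z weak])
  have "(\<lambda>n. (F (z + of_real (h n)) - F z) / of_real (h n)) \<longlonglongrightarrow> poisson_int g z"
    using lim unfolding dq wk .
  then show ?thesis by (rule LIMSEQ_unique[OF l1])
qed

section \<open>Boundary values\<close>

lemma one_le_enn2real: "1 \<le> p \<Longrightarrow> p \<noteq> \<infinity> \<Longrightarrow> 1 \<le> enn2real p"
  using enn2real_mono[of 1 p] by (simp add: less_top)

lemma Lp_space_measurable: "f \<in> Lp_space p \<Longrightarrow> f \<in> borel_measurable lebesgue"
  by (simp add: Lp_space_def)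

lemma Lp_space_finite_iff:
  assumes "p \<noteq> \<infinity>"
  shows "f \<in> Lp_space p \<longleftrightarrow> f \<in> borel_measurable lebesgue \<and> (\<integral>\<^sup>+x. ennreal (norm (f x) powr enn2real p) \<partial>lebesgue) < \<infinity>"
proof -
  have "(\<lambda>x. norm (f x) powr enn2real p) \<in> borel_measurable lebesgue" if "f \<in> borel_measurable lebesgue"
    using that by measurable
  then show ?thesis using assms by (auto simp: Lp_space_def integrable_iff_bounded)
qed

lemma Lp_space_infinity_iff:
  "f \<in> Lp_space \<infinity> \<longleftrightarrow> f \<in> borel_measurable lebesgue \<and> (\<exists>B. AE x in lebesgue. norm (f x) \<le> B)"
proof (cases "f \<in> borel_measurable lebesgue")
  case True
  then have m: "(\<lambda>x. ennreal (norm (f x))) \<in> borel_measurable lebesgue" by measurable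
  have "(\<exists>B. AE x in lebesgue. norm (f x) \<le> B) \<longleftrightarrow> esssup lebesgue (\<lambda>x. ennreal (norm (f x))) < \<infinity>"
  proof
    assume "\<exists>B. AE x in lebesgue. norm (f x) \<le> B"
    then obtain B where "AE x in lebesgue. norm (f x) \<le> B" by blast
    then have "AE x in lebesgue. ennreal (norm (f x)) \<le> ennreal B" by eventually_elim (rule ennreal_leI)
    then have "esssup lebesgue (\<lambda>x. ennreal (norm (f x))) \<le> ennreal B" by (rule esssup_I[OF m])
    then show "esssup lebesgue (\<lambda>x. ennreal (norm (f x))) < \<infinity>" by (auto intro: le_less_trans)
  next
    assume fin: "esssup lebesgue (\<lambda>x. ennreal (norm (f x))) < \<infinity>"
    define B where "B = enn2real (esssup lebesgue (\<lambda>x. ennreal (norm (f x))))"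
    have eq: "esssup lebesgue (\<lambda>x. ennreal (norm (f x))) = ennreal B" using fin by (simp add: B_def)
    have B0: "0 \<le> B" by (simp add: B_def)
    have "AE x in lebesgue. ennreal (norm (f x)) \<le> ennreal B" using esssup_AE[of "\<lambda>x. ennreal (norm (f x))" lebesgue] unfolding eq .
    then have "AE x in lebesgue. norm (f x) \<le> B" by eventually_elim (use B0 in simp)
    then show "\<exists>B. AE x in lebesgue. norm (f x) \<le> B" by blast
  qed
  then show ?thesis using True by (simp add: Lp_space_def)
qed (simp add: Lp_space_def)

lemma AE_le_Lp_norm_infinity:
  assumes "f \<in> Lp_space \<infinity>" shows "AE x in lebesgue. norm (f x) \<le> Lp_norm \<infinity> f"
proof -
  have fin: "esssup lebesgue (\<lambda>x. ennreal (norm (f x))) < \<infinity>" using assms by (simp add: Lp_space_def)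
  have eq: "esssup lebesgue (\<lambda>x. ennreal (norm (f x))) = ennreal (Lp_norm \<infinity> f)" using fin by (simp add: Lp_norm_def)
  have "AE x in lebesgue. ennreal (norm (f x)) \<le> ennreal (Lp_norm \<infinity> f)" using esssup_AE[of "\<lambda>x. ennreal (norm (f x))" lebesgue] unfolding eq .
  then show ?thesis by eventually_elim (simp add: Lp_norm_def)
qed

lemma Lp_norm_infinity_le:
  assumes m: "f \<in> borel_measurable lebesgue" and B: "AE x in lebesgue. norm (f x) \<le> B" "0 \<le> B"
  shows "Lp_norm \<infinity> f \<le> B"
proof -
  have "AE x in lebesgue. ennreal (norm (f x)) \<le> ennreal B" using B(1) by eventually_elim (rule ennreal_leI)
  moreover have "(\<lambda>x. ennreal (norm (f x))) \<in> borel_measurable lebesgue" using m by measurable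
  ultimately have "esssup lebesgue (\<lambda>x. ennreal (norm (f x))) \<le> ennreal B" by (intro esssup_I)
  then show ?thesis using B(2) by (simp add: Lp_norm_def enn2real_leI)
qed

lemma Lp_norm_nonneg: "0 \<le> Lp_norm p f"
  by (simp add: Lp_norm_def)

lemma Lp_norm_finite_le_iff:
  assumes p: "1 \<le> p" "p \<noteq> \<infinity>" and f: "f \<in> Lp_space p" and N: "0 \<le> N"
  shows "Lp_norm p f \<le> N \<longleftrightarrow> (\<integral>\<^sup>+x. ennreal (norm (f x) powr enn2real p) \<partial>lebesgue) \<le> ennreal (N powr enn2real p)"
proof -
  define q where "q = enn2real p"
  have q: "1 \<le> q" using one_le_enn2real[OF p] by (simp add: q_def)
  have i: "integrable lebesgue (\<lambda>x. norm (f x) powr q)" using f p(2) by (simp add: Lp_space_def q_def)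
  define I where "I = (LINT x|lebesgue. norm (f x) powr q)"
  have I0: "0 \<le> I" unfolding I_def by (rule Bochner_Integration.integral_nonneg) simp
  have "(\<integral>\<^sup>+x. ennreal (norm (f x) powr q) \<partial>lebesgue) = ennreal I"
    unfolding I_def by (rule nn_integral_eq_integral[OF i]) simp
  moreover have "Lp_norm p f = I powr (1 / q)" using p(2) by (simp add: Lp_norm_def I_def q_def)
  moreover have "I powr (1 / q) \<le> N \<longleftrightarrow> I \<le> N powr q"
  proof
    assume "I powr (1 / q) \<le> N"
    then have "(I powr (1 / q)) powr q \<le> N powr q" using q by (intro powr_mono2) auto
    then show "I \<le> N powr q" using q I0 by (simp add: powr_powr)
  next
    assume "I \<le> N powr q"
    then have "I powr (1 / q) \<le> (N powr q) powr (1 / q)" using q I0 by (intro powr_mono2) auto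
    then show "I powr (1 / q) \<le> N" using q N by (simp add: powr_powr)
  qed
  ultimately show ?thesis by (simp add: q_def[symmetric])
qed

text \<open>Measurability of \<open>g\<close> is drawn from the completeness of the Lebesgue
  measure. This is what makes \<open>boundary_value\<close> usable, which is unspecified on a null
  set.\<close>

lemma Lp_AE_cong:
  assumes m: "f \<in> borel_measurable lebesgue" and ae: "AE x in lebesgue. f x = g x"
  shows "g \<in> borel_measurable lebesgue" "Lp_norm p f = Lp_norm p g" "f \<in> Lp_space p \<longleftrightarrow> g \<in> Lp_space p"
proof -
  show mg: "g \<in> borel_measurable lebesgue" by (rule borel_measurable_AE[OF m ae])
  have e: "esssup lebesgue (\<lambda>x. ennreal (norm (f x))) = esssup lebesgue (\<lambda>x. ennreal (norm (g x)))"
  proof (rule esssup_AE_cong)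
    show "(\<lambda>x. ennreal (norm (f x))) \<in> borel_measurable lebesgue" "(\<lambda>x. ennreal (norm (g x))) \<in> borel_measurable lebesgue"
      using m mg by measurable
    show "AE x in lebesgue. ennreal (norm (f x)) = ennreal (norm (g x))" using ae by eventually_elim simp
  qed
  have mp: "(\<lambda>x. norm (f x) powr q) \<in> borel_measurable lebesgue" "(\<lambda>x. norm (g x) powr q) \<in> borel_measurable lebesgue" for q
    using m mg by measurable
  have aep: "AE x in lebesgue. norm (f x) powr q = norm (g x) powr q" for q using ae by eventually_elim simp
  have "(LINT x|lebesgue. norm (f x) powr q) = (LINT x|lebesgue. norm (g x) powr q)" for q
    by (rule integral_cong_AE[OF mp aep])
  then show "Lp_norm p f = Lp_norm p g" by (simp only: Lp_norm_def e)
  have "integrable lebesgue (\<lambda>x. norm (f x) powr q) \<longleftrightarrow> integrable lebesgue (\<lambda>x. norm (g x) powr q)" for q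
    by (rule integrable_cong_AE[OF mp aep])
  then show "f \<in> Lp_space p \<longleftrightarrow> g \<in> Lp_space p" using m mg by (simp add: Lp_space_def e)
qed

lemma poisson_integrable_AE_bounded:
  assumes m: "f \<in> borel_measurable lebesgue" and B: "AE x in lebesgue. norm (f x) \<le> B"
  shows "poisson_integrable f"
  unfolding poisson_integrable_def
proof
  show "integrable lebesgue (\<lambda>t. norm (f t) / (1 + t\<^sup>2))"
  proof (rule Bochner_Integration.integrable_bound)
    show "integrable lebesgue (\<lambda>t. B * (1 / (1 + t\<^sup>2)))"
      using integrable_inverse_1_plus_square_lebesgue by (rule integrable_mult_right)
    show "(\<lambda>t. norm (f t) / (1 + t\<^sup>2)) \<in> borel_measurable lebesgue" using m by measurable
    show "AE t in lebesgue. norm (norm (f t) / (1 + t\<^sup>2)) \<le> norm (B * (1 / (1 + t\<^sup>2)))"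
      using B
    proof eventually_elim
      case (elim t)
      then have "norm (f t) \<le> \<bar>B\<bar>" by linarith
      then have "norm (f t) / (1 + t\<^sup>2) \<le> \<bar>B\<bar> / (1 + t\<^sup>2)" by (rule divide_right_mono) simp
      then show ?case by (simp add: abs_mult)
    qed
  qed
qed (rule m)

lemma Lp_poisson_integrable:
  assumes p: "1 \<le> p" and f: "f \<in> Lp_space p" shows "poisson_integrable f"
proof (cases "p = \<infinity>")
  case True
  then have "f \<in> Lp_space \<infinity>" using f by simp
  then show ?thesis unfolding Lp_space_infinity_iff using poisson_integrable_AE_bounded by blast
next
  case False
  have m: "f \<in> borel_measurable lebesgue" using f by (rule Lp_space_measurable)
  show ?thesis
    unfolding poisson_integrable_def
  proof
    show "integrable lebesgue (\<lambda>t. norm (f t) / (1 + t\<^sup>2))"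
    proof (rule Bochner_Integration.integrable_bound)
      show "integrable lebesgue (\<lambda>t. 1 / (1 + t\<^sup>2) + norm (f t) powr enn2real p)"
        using f False by (intro Bochner_Integration.integrable_add integrable_inverse_1_plus_square_lebesgue) (simp add: Lp_space_def)
      show "(\<lambda>t. norm (f t) / (1 + t\<^sup>2)) \<in> borel_measurable lebesgue" using m by measurable
      show "AE t in lebesgue. norm (norm (f t) / (1 + t\<^sup>2)) \<le> norm (1 / (1 + t\<^sup>2) + norm (f t) powr enn2real p)"
      proof (rule AE_I2)
        fix t
        define a where "a = norm (f t) powr enn2real p"
        have "norm (f t) \<le> 1 + a"
          unfolding a_def by (rule le_one_plus_powr[OF norm_ge_zero one_le_enn2real[OF p False]])
        then have "norm (f t) / (1 + t\<^sup>2) \<le> (1 + a) / (1 + t\<^sup>2)" by (rule divide_right_mono) simp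
        also have "\<dots> = 1 / (1 + t\<^sup>2) + a / (1 + t\<^sup>2)" by (rule add_divide_distrib)
        also have "a / (1 + t\<^sup>2) \<le> a" by (simp add: a_def divide_le_eq add_pos_nonneg mult_le_cancel_left1)
        finally show "norm (norm (f t) / (1 + t\<^sup>2)) \<le> norm (1 / (1 + t\<^sup>2) + norm (f t) powr enn2real p)"
          by (simp add: a_def[symmetric])
      qed
    qed
  qed (rule m)
qed

section \<open>Boundary functions in the Hardy spaces\<close>

lemma Hardy_holomorphic: "F \<in> Hardy p \<Longrightarrow> F holomorphic_on upper_half_plane"
  by (simp add: Hardy_def)

lemma Hardy_norm_finite_bound:
  assumes p: "1 \<le> p" "p \<noteq> \<infinity>" and F: "F \<in> Hardy p"
  shows "hardy_bound (enn2real p) (Hardy_norm p F powr enn2real p) F" "0 \<le> Hardy_norm p F"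
proof -
  have L: "(\<lambda>x. F (Complex x y)) \<in> Lp_space p" if "0 < y" for y using F p that by (simp add: Hardy_def)
  have bdd: "bdd_above ((\<lambda>y. Lp_norm p (\<lambda>x. F (Complex x y))) ` {0<..})" using F p by (simp add: Hardy_def)
  have le: "Lp_norm p (\<lambda>x. F (Complex x y)) \<le> Hardy_norm p F" if "0 < y" for y
    unfolding Hardy_norm_def using p that by (auto intro!: cSUP_upper bdd)
  show 0: "0 \<le> Hardy_norm p F" using le[of 1] Lp_norm_nonneg[of p "\<lambda>x. F (Complex x 1)"] by simp
  show "hardy_bound (enn2real p) (Hardy_norm p F powr enn2real p) F"
    unfolding hardy_bound_def using Hardy_holomorphic[OF F] le L Lp_norm_finite_le_iff[OF p _ 0] by blast
qed

lemma Hardy_norm_infinity_bound: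
  assumes F: "F \<in> Hardy \<infinity>"
  shows "\<And>z. 0 < Im z \<Longrightarrow> cmod (F z) \<le> Hardy_norm \<infinity> F" "0 \<le> Hardy_norm \<infinity> F"
proof -
  have "bounded (F ` upper_half_plane)" using F by (simp add: Hardy_def)
  then have bdd: "bdd_above ((\<lambda>z. cmod (F z)) ` upper_half_plane)"
    by (auto simp: bounded_iff bdd_above_def)
  show le: "cmod (F z) \<le> Hardy_norm \<infinity> F" if "0 < Im z" for z
  proof -
    have "z \<in> upper_half_plane" using that by (simp add: upper_half_plane_def)
    then show ?thesis unfolding Hardy_norm_def using cSUP_upper[OF _ bdd] by simp
  qed
  show "0 \<le> Hardy_norm \<infinity> F" using order_trans[OF norm_ge_zero le[of \<i>]] by simp
qed

text \<open>As \<open>1 + x\<^sup>2 \<le> (cmod (Complex x y + \<i>))\<^sup>2\<close>, it suffices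
  to integrate the modulus of \<open>F\<close> against \<open>1 / (1 + x\<^sup>2)\<close>: directly
  when \<open>F\<close> is bounded, and through \<open>a \<le> 1 + a powr q\<close> for finite
  exponents.\<close>

lemma Hardy_reduction_to_exponent_1:
  assumes p: "1 \<le> p" and F: "F \<in> Hardy p"
  shows "bounded_above_lines F" "\<exists>K\<ge>0. hardy_bound 1 K (\<lambda>z. F z / (z + \<i>)\<^sup>2)"
proof -
  have hol: "F holomorphic_on upper_half_plane" by (rule Hardy_holomorphic[OF F])
  have "bounded_above_lines F \<and> (\<exists>L\<ge>0. \<forall>y>0. (\<integral>\<^sup>+x. ennreal (cmod (F (Complex x y)) / (1 + x\<^sup>2)) \<partial>lebesgue) \<le> ennreal L)"
  proof (cases "p = \<infinity>")
    case True
    define B where "B = Hardy_norm \<infinity> F"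
    have B: "\<And>z. 0 < Im z \<Longrightarrow> cmod (F z) \<le> B" "0 \<le> B" using Hardy_norm_infinity_bound F True by (auto simp: B_def)
    have "bounded_above_lines F"
      unfolding bounded_above_lines_def using B(1) by (metis less_le_trans)
    moreover have "(\<integral>\<^sup>+x. ennreal (cmod (F (Complex x y)) / (1 + x\<^sup>2)) \<partial>lebesgue) \<le> ennreal (LINT x|lebesgue. B * (1 / (1 + x\<^sup>2)))" if "0 < y" for y
    proof -
      have "(\<integral>\<^sup>+x. ennreal (cmod (F (Complex x y)) / (1 + x\<^sup>2)) \<partial>lebesgue) \<le> (\<integral>\<^sup>+x. ennreal (B * (1 / (1 + x\<^sup>2))) \<partial>lebesgue)"
        by (intro nn_integral_mono ennreal_leI) (use B(1) that in \<open>simp add: divide_right_mono\<close>)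
      also have "\<dots> = ennreal (LINT x|lebesgue. B * (1 / (1 + x\<^sup>2)))"
        by (rule nn_integral_eq_integral[OF integrable_mult_right[OF integrable_inverse_1_plus_square_lebesgue]]) (use B in auto)
      finally show ?thesis .
    qed
    moreover have "0 \<le> (LINT x|lebesgue. B * (1 / (1 + x\<^sup>2)))" by (rule Bochner_Integration.integral_nonneg) (use B in auto)
    ultimately show ?thesis by blast
  next
    case False
    define q where "q = enn2real p"
    define K where "K = Hardy_norm p F powr q"
    have q: "1 \<le> q" unfolding q_def by (rule one_le_enn2real[OF p False])
    have H: "hardy_bound q K F" unfolding q_def K_def by (rule Hardy_norm_finite_bound[OF p False F])
    have K: "0 \<le> K" by (simp add: K_def)
    define I where "I = (LINT t|lebesgue. 1 / (1 + t\<^sup>2 :: real))"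
    have I0: "0 \<le> I" unfolding I_def by (rule Bochner_Integration.integral_nonneg) simp
    have "(\<integral>\<^sup>+x. ennreal (cmod (F (Complex x y)) / (1 + x\<^sup>2)) \<partial>lebesgue) \<le> ennreal (I + K)" if y: "0 < y" for y
    proof -
      have m: "(\<lambda>x. F (Complex x y)) \<in> borel_measurable lebesgue" by (rule horizontal_measurable[OF hol y])
      have "(\<integral>\<^sup>+x. ennreal (cmod (F (Complex x y)) / (1 + x\<^sup>2)) \<partial>lebesgue)
        \<le> (\<integral>\<^sup>+x. ennreal (1 / (1 + x\<^sup>2)) + ennreal (cmod (F (Complex x y)) powr q) \<partial>lebesgue)"
      proof (rule nn_integral_mono)
        fix x
        define a where "a = cmod (F (Complex x y)) powr q"
        have "cmod (F (Complex x y)) \<le> 1 + a" unfolding a_def by (rule le_one_plus_powr[OF norm_ge_zero q])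
        then have "cmod (F (Complex x y)) / (1 + x\<^sup>2) \<le> (1 + a) / (1 + x\<^sup>2)" by (rule divide_right_mono) simp
        also have "\<dots> = 1 / (1 + x\<^sup>2) + a / (1 + x\<^sup>2)" by (rule add_divide_distrib)
        also have "a / (1 + x\<^sup>2) \<le> a" by (simp add: a_def divide_le_eq add_pos_nonneg mult_le_cancel_left1)
        finally have "ennreal (cmod (F (Complex x y)) / (1 + x\<^sup>2)) \<le> ennreal (1 / (1 + x\<^sup>2) + a)" by (intro ennreal_leI) simp
        also have "\<dots> = ennreal (1 / (1 + x\<^sup>2)) + ennreal a" by (rule ennreal_plus) (auto simp: a_def)
        finally show "ennreal (cmod (F (Complex x y)) / (1 + x\<^sup>2)) \<le> ennreal (1 / (1 + x\<^sup>2)) + ennreal (cmod (F (Complex x y)) powr q)"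
          by (simp only: a_def)
      qed
      also have "\<dots> = (\<integral>\<^sup>+x. ennreal (1 / (1 + x\<^sup>2)) \<partial>lebesgue) + (\<integral>\<^sup>+x. ennreal (cmod (F (Complex x y)) powr q) \<partial>lebesgue)"
        by (rule nn_integral_add) (use m in measurable)
      also have "(\<integral>\<^sup>+x. ennreal (1 / (1 + x\<^sup>2)) \<partial>lebesgue) = ennreal I"
        unfolding I_def by (rule nn_integral_eq_integral[OF integrable_inverse_1_plus_square_lebesgue]) simp
      also have "ennreal I + (\<integral>\<^sup>+x. ennreal (cmod (F (Complex x y)) powr q) \<partial>lebesgue) \<le> ennreal I + ennreal K"
        by (rule add_left_mono) (use H y in \<open>simp add: hardy_bound_def\<close>)
      also have "\<dots> = ennreal (I + K)" by (rule ennreal_plus[OF I0 K, symmetric])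
      finally show ?thesis .
    qed
    moreover have "bounded_above_lines F" by (rule hardy_bound_imp_bounded_above_lines[OF H q K])
    moreover have "0 \<le> I + K" using I0 K by simp
    ultimately show ?thesis by blast
  qed
  then obtain L where bd: "bounded_above_lines F" and L: "0 \<le> L"
    "\<And>y. 0 < y \<Longrightarrow> (\<integral>\<^sup>+x. ennreal (cmod (F (Complex x y)) / (1 + x\<^sup>2)) \<partial>lebesgue) \<le> ennreal L" by blast
  show "bounded_above_lines F" by (rule bd)
  have "hardy_bound 1 L (\<lambda>z. F z / (z + \<i>)\<^sup>2)"
    unfolding hardy_bound_def
  proof (intro conjI allI impI)
    show "(\<lambda>z. F z / (z + \<i>)\<^sup>2) holomorphic_on upper_half_plane"
    proof (intro holomorphic_intros hol)
      fix z assume "z \<in> upper_half_plane"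
      then have "z + \<i> \<noteq> 0" by (auto simp: upper_half_plane_def complex_eq_iff)
      then show "(z + \<i>)\<^sup>2 \<noteq> 0" by simp
    qed
    fix y :: real assume y: "0 < y"
    have "(\<integral>\<^sup>+x. ennreal (cmod (F (Complex x y) / (Complex x y + \<i>)\<^sup>2) powr 1) \<partial>lebesgue) \<le> (\<integral>\<^sup>+x. ennreal (cmod (F (Complex x y)) / (1 + x\<^sup>2)) \<partial>lebesgue)"
    proof (intro nn_integral_mono ennreal_leI)
      fix x
      have "1 \<le> (y + 1)\<^sup>2" using y by (simp add: one_le_power)
      moreover have "(cmod (Complex x y + \<i>))\<^sup>2 = x\<^sup>2 + (y + 1)\<^sup>2" by (simp add: cmod_power2)
      ultimately have "1 + x\<^sup>2 \<le> (cmod (Complex x y + \<i>))\<^sup>2" by simp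
      moreover have "0 < 1 + x\<^sup>2" by (simp add: add_pos_nonneg)
      ultimately have "cmod (F (Complex x y)) / (cmod (Complex x y + \<i>))\<^sup>2 \<le> cmod (F (Complex x y)) / (1 + x\<^sup>2)"
        by (intro frac_le) auto
      then show "cmod (F (Complex x y) / (Complex x y + \<i>)\<^sup>2) powr 1 \<le> cmod (F (Complex x y)) / (1 + x\<^sup>2)"
        by (simp add: norm_divide norm_power)
    qed
    also have "\<dots> \<le> ennreal L" by (rule L(2)[OF y])
    finally show "(\<integral>\<^sup>+x. ennreal (cmod (F (Complex x y) / (Complex x y + \<i>)\<^sup>2) powr 1) \<partial>lebesgue) \<le> ennreal L" .
  qed
  then show "\<exists>K\<ge>0. hardy_bound 1 K (\<lambda>z. F z / (z + \<i>)\<^sup>2)" using L(1) by blast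
qed

lemma vertical_filterlim: "filterlim (\<lambda>n. Complex x (1 / real (Suc n))) (at (of_real x) within cone 1 x) sequentially"
  unfolding filterlim_at
proof
  show "\<forall>\<^sub>F n in sequentially. Complex x (1 / real (Suc n)) \<in> cone 1 x \<and> Complex x (1 / real (Suc n)) \<noteq> of_real x"
    by (intro always_eventually) (auto simp: cone_def complex_eq_iff)
  have "(\<lambda>n. 1 / real (Suc n)) \<longlonglongrightarrow> 0" using LIMSEQ_inverse_real_of_nat by (simp add: inverse_eq_divide)
  then have "(\<lambda>n. of_real x + \<i> * of_real (1 / real (Suc n))) \<longlonglongrightarrow> of_real x + \<i> * of_real 0" by (intro tendsto_intros)
  then show "(\<lambda>n. Complex x (1 / real (Suc n))) \<longlonglongrightarrow> of_real x" by (simp add: Complex_eq)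
qed

lemma nontangential_limit_vertical:
  "has_nontangential_limit F x L \<Longrightarrow> (\<lambda>n. F (Complex x (1 / real (Suc n)))) \<longlonglongrightarrow> L"
  unfolding has_nontangential_limit_def by (rule filterlim_compose[OF _ vertical_filterlim]) simp

lemma nontangential_limit_unique:
  "has_nontangential_limit F x L \<Longrightarrow> has_nontangential_limit F x M \<Longrightarrow> L = M"
  by (rule LIMSEQ_unique[OF nontangential_limit_vertical nontangential_limit_vertical])

lemma boundary_value_eq: "has_nontangential_limit F x L \<Longrightarrow> boundary_value F x = L"
  unfolding boundary_value_def using nontangential_limit_unique by blast

lemma has_nontangential_limit_linear:
  assumes "has_nontangential_limit F x L" "has_nontangential_limit G x M"
  shows "has_nontangential_limit (\<lambda>z. a * F z + b * G z) x (a * L + b * M)"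
  using assms unfolding has_nontangential_limit_def by (auto intro!: tendsto_intros)

theorem Hardy_of_Lp_poisson_int:
  assumes p: "1 \<le> p" and f: "f \<in> Lp_space p" and hol: "F holomorphic_on upper_half_plane"
    and Ff: "\<And>z. 0 < Im z \<Longrightarrow> F z = poisson_int f z"
  shows "F \<in> Hardy p" "Hardy_norm p F \<le> Lp_norm p f"
proof -
  have pf: "poisson_integrable f" by (rule Lp_poisson_integrable[OF p f])
  have m: "f \<in> borel_measurable lebesgue" by (rule Lp_space_measurable[OF f])
  have "F \<in> Hardy p \<and> Hardy_norm p F \<le> Lp_norm p f"
  proof (cases "p = \<infinity>")
    case True
    have B: "cmod (F z) \<le> Lp_norm p f" if z: "z \<in> upper_half_plane" for z
    proof -
      have z0: "0 < Im z" using z by (simp add: upper_half_plane_def)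
      show ?thesis unfolding Ff[OF z0]
        by (rule norm_poisson_int_bounded[OF z0 m]) (use AE_le_Lp_norm_infinity f True in simp)
    qed
    then have "bounded (F ` upper_half_plane)" by (auto simp: bounded_iff)
    moreover have "\<i> \<in> upper_half_plane" by (simp add: upper_half_plane_def)
    then have "Hardy_norm p F \<le> Lp_norm p f"
      unfolding Hardy_norm_def using True B by (auto intro!: cSUP_least)
    ultimately show ?thesis using hol True by (simp add: Hardy_def)
  next
    case False
    have L: "(\<lambda>x. F (Complex x y)) \<in> Lp_space p \<and> Lp_norm p (\<lambda>x. F (Complex x y)) \<le> Lp_norm p f" if y: "0 < y" for y
    proof -
      have "(\<integral>\<^sup>+x. ennreal (norm (F (Complex x y)) powr enn2real p) \<partial>lebesgue) \<le> (\<integral>\<^sup>+t. ennreal (norm (f t) powr enn2real p) \<partial>lebesgue)"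
        using poisson_int_Lp_contraction[OF y one_le_enn2real[OF p False] pf] Ff y by simp
      also have le: "\<dots> \<le> ennreal (Lp_norm p f powr enn2real p)"
        using Lp_norm_finite_le_iff[OF p False f Lp_norm_nonneg] by blast
      finally have *: "(\<integral>\<^sup>+x. ennreal (norm (F (Complex x y)) powr enn2real p) \<partial>lebesgue) \<le> ennreal (Lp_norm p f powr enn2real p)" .
      then have "(\<lambda>x. F (Complex x y)) \<in> Lp_space p"
        unfolding Lp_space_finite_iff[OF False] using horizontal_measurable[OF hol y] by (auto intro: le_less_trans)
      then show ?thesis using Lp_norm_finite_le_iff[OF p False _ Lp_norm_nonneg] * by blast
    qed
    then have "bdd_above ((\<lambda>y. Lp_norm p (\<lambda>x. F (Complex x y))) ` {0<..})" by (auto simp: bdd_above_def)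
    moreover have "Hardy_norm p F \<le> Lp_norm p f"
      unfolding Hardy_norm_def using False L by (auto intro!: cSUP_least)
    ultimately show ?thesis using hol False L by (simp add: Hardy_def)
  qed
  then show "F \<in> Hardy p" "Hardy_norm p F \<le> Lp_norm p f" by auto
qed

theorem Hardy_boundary:
  assumes p: "1 \<le> p" and F: "F \<in> Hardy p"
  shows "\<exists>f\<in>Lp_space p. Lp_norm p f = Hardy_norm p F \<and> (\<forall>z. 0 < Im z \<longrightarrow> F z = poisson_int f z) \<and>
    (AE x in lebesgue. has_nontangential_limit F x (f x))"
proof -
  have hol: "F holomorphic_on upper_half_plane" by (rule Hardy_holomorphic[OF F])
  obtain K where K: "0 \<le> K" "hardy_bound 1 K (\<lambda>z. F z / (z + \<i>)\<^sup>2)"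
    using Hardy_reduction_to_exponent_1(2)[OF p F] by blast
  show ?thesis
  proof (rule hardy_poisson_representation[OF hol Hardy_reduction_to_exponent_1(1)[OF p F] K(2,1)])
    fix f assume f: "poisson_integrable f" "\<And>z. 0 < Im z \<Longrightarrow> F z = poisson_int f z"
      and nt: "AE x in lebesgue. has_nontangential_limit F x (f x)"
    have m: "f \<in> borel_measurable lebesgue" using f(1) by (simp add: poisson_integrable_def)
    have lim: "AE x in lebesgue. (\<lambda>n. F (Complex x (1 / real (Suc n)))) \<longlonglongrightarrow> f x"
      using nt by eventually_elim (rule nontangential_limit_vertical)
    have "f \<in> Lp_space p \<and> Lp_norm p f \<le> Hardy_norm p F"
    proof (cases "p = \<infinity>")
      case True
      have B: "cmod (F z) \<le> Hardy_norm p F" if "0 < Im z" for z using Hardy_norm_infinity_bound(1) F True that by simp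
      have B0: "0 \<le> Hardy_norm p F" using Hardy_norm_infinity_bound(2) F True by simp
      have ae: "AE x in lebesgue. norm (f x) \<le> Hardy_norm p F"
        using lim
      proof eventually_elim
        case (elim x)
        show ?case by (rule LIMSEQ_le_const2[OF tendsto_norm[OF elim]]) (use B in auto)
      qed
      have "f \<in> Lp_space \<infinity>" unfolding Lp_space_infinity_iff using m ae by blast
      moreover have "Lp_norm \<infinity> f \<le> Hardy_norm p F" by (rule Lp_norm_infinity_le[OF m ae B0])
      ultimately show ?thesis using True by simp
    next
      case False
      note H = Hardy_norm_finite_bound[OF p False F]
      have *: "(\<integral>\<^sup>+x. ennreal (norm (f x) powr enn2real p) \<partial>lebesgue) \<le> ennreal (Hardy_norm p F powr enn2real p)"
      proof (rule nn_integral_Fatou_le)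
        show "(\<lambda>x. ennreal (cmod (F (Complex x (1 / real (Suc n)))) powr enn2real p)) \<in> borel_measurable lebesgue" for n
          using horizontal_measurable[OF hol, of "1 / real (Suc n)"] by measurable
        show "AE x in lebesgue. (\<lambda>n. ennreal (cmod (F (Complex x (1 / real (Suc n)))) powr enn2real p)) \<longlonglongrightarrow> ennreal (norm (f x) powr enn2real p)"
          using lim
        proof eventually_elim
          case (elim x)
          \<comment> \<open>A positive exponent keeps the power continuous at 0, a value that
            \<open>f x\<close> may take.\<close>
          have "0 < enn2real p" using one_le_enn2real[OF p False] by simp
          then show ?case
            by (intro tendsto_ennrealI tendsto_powr' tendsto_norm elim tendsto_const) auto
        qed
        show "(\<integral>\<^sup>+x. ennreal (cmod (F (Complex x (1 / real (Suc n)))) powr enn2real p) \<partial>lebesgue) \<le> ennreal (Hardy_norm p F powr enn2real p)" for n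
          using H(1) by (simp add: hardy_bound_def)
      qed
      have fL: "f \<in> Lp_space p" unfolding Lp_space_finite_iff[OF False] using m * by (auto intro: le_less_trans)
      then show ?thesis using Lp_norm_finite_le_iff[OF p False fL H(2)] * by blast
    qed
    moreover have "Hardy_norm p F \<le> Lp_norm p f" if "f \<in> Lp_space p"
      by (rule Hardy_of_Lp_poisson_int(2)[OF p that hol f(2)])
    ultimately show ?thesis using f(2) nt by (intro bexI[of _ f]) auto
  qed
qed

section \<open>Changes on null sets, and the orthogonality relations for bounded functions\<close>

lemma poisson_int_AE_cong:
  assumes "f \<in> borel_measurable lebesgue" "AE x in lebesgue. f x = g x"
  shows "poisson_int f z = poisson_int (g :: real \<Rightarrow> complex) z"
  unfolding poisson_int_def
proof (rule integral_cong_AE)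
  have g: "g \<in> borel_measurable lebesgue" by (rule Lp_AE_cong(1)[OF assms])
  show "(\<lambda>t. poisson z t *\<^sub>R f t) \<in> borel_measurable lebesgue" "(\<lambda>t. poisson z t *\<^sub>R g t) \<in> borel_measurable lebesgue"
    using assms(1) g by measurable
  show "AE t in lebesgue. poisson z t *\<^sub>R f t = poisson z t *\<^sub>R g t" using assms(2) by eventually_elim simp
qed

lemma locally_integrable_AE_cong:
  assumes "locally_integrable f" "f \<in> borel_measurable lebesgue" "AE x in lebesgue. f x = g x"
  shows "locally_integrable g"
  unfolding locally_integrable_def set_integrable_def
proof (intro allI)
  fix a b :: real
  have i: "integrable lebesgue (\<lambda>x. indicat_real {a..b} x *\<^sub>R f x)" using assms(1) by (simp add: locally_integrable_def set_integrable_def)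
  have g: "g \<in> borel_measurable lebesgue" by (rule Lp_AE_cong(1)[OF assms(2,3)])
  have "(\<lambda>x. indicat_real {a..b} x *\<^sub>R g x) \<in> borel_measurable lebesgue"
    by (intro borel_measurable_scaleR borel_measurable_indicator g) simp
  moreover have "AE x in lebesgue. indicat_real {a..b} x *\<^sub>R f x = indicat_real {a..b} x *\<^sub>R g x"
    using assms(3) by eventually_elim simp
  ultimately show "integrable lebesgue (\<lambda>x. indicat_real {a..b} x *\<^sub>R g x)"
    using i integrable_cong_AE_imp by blast
qed

lemma has_weak_deriv_AE_cong:
  assumes w: "has_weak_deriv k f g" and m: "f \<in> borel_measurable lebesgue" and ae: "AE x in lebesgue. f x = f' x"
  shows "has_weak_deriv k f' g"
  unfolding has_weak_deriv_def
proof (intro conjI allI impI)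
  have lf: "locally_integrable f" using w by (simp add: has_weak_deriv_def)
  show lf': "locally_integrable f'" by (rule locally_integrable_AE_cong[OF lf m ae])
  show "locally_integrable g" using w by (simp add: has_weak_deriv_def)
  fix \<phi> assume \<phi>: "test_function \<phi>"
  have "(LINT x|lebesgue. f' x * of_real ((deriv ^^ k) \<phi> x)) = (LINT x|lebesgue. f x * of_real ((deriv ^^ k) \<phi> x))"
  proof (rule integral_cong_AE)
    show "(\<lambda>x. f' x * of_real ((deriv ^^ k) \<phi> x)) \<in> borel_measurable lebesgue" "(\<lambda>x. f x * of_real ((deriv ^^ k) \<phi> x)) \<in> borel_measurable lebesgue"
      using test_function_mult_integrable[OF lf test_function_higher_deriv[OF \<phi>]] test_function_mult_integrable[OF lf' test_function_higher_deriv[OF \<phi>]]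
      by auto
    show "AE x in lebesgue. f' x * of_real ((deriv ^^ k) \<phi> x) = f x * of_real ((deriv ^^ k) \<phi> x)"
      using ae by eventually_elim simp
  qed
  then show "(LINT x|lebesgue. f' x * of_real ((deriv ^^ k) \<phi> x)) = (-1) ^ k * (LINT x|lebesgue. g x * of_real (\<phi> x))"
    using w \<phi> by (simp add: has_weak_deriv_def)
qed

text \<open>Both poles \<open>cnj z\<close> and \<open>- \<i>\<close> of the weight lie below the
  axis. Hence the shifted \<open>F\<close> times the weight is holomorphic across the axis and
  decays quadratically above it, \<open>cauchy_vanishing\<close> applies, and boundedness of
  \<open>F\<close> lets the shift tend to 0.\<close>

lemma Hardy_infinity_orthogonality:
  assumes F: "F \<in> Hardy \<infinity>" and nt: "AE x in lebesgue. has_nontangential_limit F x (f x)"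
    and f: "f \<in> Lp_space \<infinity>" and z: "0 < Im z"
  shows "(LINT x|lebesgue. f x / ((of_real x - cnj z) * (of_real x + \<i>))) = 0"
proof -
  have hol: "F holomorphic_on upper_half_plane" by (rule Hardy_holomorphic[OF F])
  define B where "B = Hardy_norm \<infinity> F"
  have B: "\<And>w. 0 < Im w \<Longrightarrow> cmod (F w) \<le> B" "0 \<le> B" using Hardy_norm_infinity_bound[OF F] by (auto simp: B_def)
  define k where "k w = 1 / ((w - cnj z) * (w + \<i>))" for w
  define C where "C = 1 + cmod (cnj z + \<i>) / Im z"
  have C: "1 \<le> C" using z by (simp add: C_def)
  have kb: "cmod (k w) \<le> C / (cmod (w + \<i>))\<^sup>2" if w: "0 \<le> Im w" for w
  proof -
    have ge: "Im z \<le> cmod (w - cnj z)" using abs_Im_le_cmod[of "w - cnj z"] w z by simp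
    have p: "0 < cmod (w - cnj z)" "0 < cmod (w + \<i>)" using ge z w by (auto simp: complex_eq_iff)
    have "cmod (w + \<i>) \<le> cmod (w - cnj z) + cmod (cnj z + \<i>)"
      using norm_triangle_ineq[of "w - cnj z" "cnj z + \<i>"] by simp
    also have "cmod (cnj z + \<i>) \<le> cmod (cnj z + \<i>) / Im z * cmod (w - cnj z)"
      using mult_left_mono[OF ge, of "cmod (cnj z + \<i>) / Im z"] z by simp
    finally have "cmod (w + \<i>) \<le> C * cmod (w - cnj z)" by (simp add: C_def algebra_simps)
    then have "1 / cmod (w - cnj z) \<le> C / cmod (w + \<i>)" using p by (simp add: divide_simps mult.commute)
    then have "1 / cmod (w - cnj z) * (1 / cmod (w + \<i>)) \<le> C / cmod (w + \<i>) * (1 / cmod (w + \<i>))"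
      by (rule mult_right_mono) simp
    then show ?thesis by (simp add: k_def norm_divide norm_mult power2_eq_square)
  qed
  define e where "e n = 1 / real (Suc n)" for n
  have e: "0 < e n" for n by (simp add: e_def)
  have zero: "(LINT x|lebesgue. F (Complex x (e n)) * k (of_real x)) = 0" for n
  proof -
    \<comment> \<open>The depth at which the first singularity may occur: the edge of the shifted
      domain of \<open>F\<close>, the pole \<open>cnj z\<close> or the pole
      \<open>- \<i>\<close>.\<close>
    define d where "d = min (e n) (min (Im z) 1)"
    have d: "0 < d" using e[of n] z by (simp add: d_def)
    have "(LINT t|lebesgue. (\<lambda>w. F (w + \<i> * of_real (e n)) * k w) (of_real t)) = 0"
    proof (rule cauchy_vanishing[OF d])
      have "(F \<circ> (\<lambda>w. w + \<i> * of_real (e n))) holomorphic_on {w. - d < Im w}"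
        by (rule holomorphic_on_compose_gen[OF _ hol]) (auto intro!: holomorphic_intros simp: upper_half_plane_def d_def)
      then have "(\<lambda>w. F (w + \<i> * of_real (e n))) holomorphic_on {w. - d < Im w}" by (simp add: o_def)
      moreover have "k holomorphic_on {w. - d < Im w}"
        unfolding k_def
      proof (intro holomorphic_intros)
        fix w assume "w \<in> {w. - d < Im w}"
        then have "- Im z < Im w" "- 1 < Im w" by (auto simp: d_def)
        then have "w - cnj z \<noteq> 0" "w + \<i> \<noteq> 0" by (auto simp: complex_eq_iff)
        then show "(w - cnj z) * (w + \<i>) \<noteq> 0" by simp
      qed
      ultimately show "(\<lambda>w. F (w + \<i> * of_real (e n)) * k w) holomorphic_on {w. - d < Im w}"
        by (rule holomorphic_on_mult)
      fix w :: complex assume w: "0 \<le> Im w"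
      have "cmod (F (w + \<i> * of_real (e n))) * cmod (k w) \<le> B * (C / (cmod (w + \<i>))\<^sup>2)"
        by (intro mult_mono B kb w) (use w e[of n] in auto)
      then show "cmod (F (w + \<i> * of_real (e n)) * k w) \<le> B * C / (cmod (w + \<i>))\<^sup>2" by (simp add: norm_mult)
    qed
    then show ?thesis by (simp add: Complex_eq)
  qed
  have fm: "f \<in> borel_measurable lebesgue" by (rule Lp_space_measurable[OF f])
  have km: "(\<lambda>x. k (of_real x)) \<in> borel_measurable lebesgue"
    unfolding k_def using of_real_lebesgue_measurable by measurable
  have "(\<lambda>n. LINT x|lebesgue. F (Complex x (e n)) * k (of_real x)) \<longlonglongrightarrow> (LINT x|lebesgue. f x * k (of_real x))"
  proof (rule integral_dominated_convergence[where w = "\<lambda>x. B * C * (1 / (1 + x\<^sup>2))"])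
    show "(\<lambda>x. f x * k (of_real x)) \<in> borel_measurable lebesgue" by (rule borel_measurable_times[OF fm km])
    show "(\<lambda>x. F (Complex x (e n)) * k (of_real x)) \<in> borel_measurable lebesgue" for n
      by (rule borel_measurable_times[OF horizontal_measurable[OF hol e] km])
    show "integrable lebesgue (\<lambda>x. B * C * (1 / (1 + x\<^sup>2)))"
      by (rule integrable_mult_right[OF integrable_inverse_1_plus_square_lebesgue])
    show "AE x in lebesgue. (\<lambda>n. F (Complex x (e n)) * k (of_real x)) \<longlonglongrightarrow> f x * k (of_real x)"
      using nt
    proof eventually_elim
      case (elim x)
      show ?case unfolding e_def by (rule tendsto_mult[OF nontangential_limit_vertical[OF elim] tendsto_const])
    qed
    show "AE x in lebesgue. norm (F (Complex x (e n)) * k (of_real x)) \<le> B * C * (1 / (1 + x\<^sup>2))" for n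
    proof (rule AE_I2)
      fix x
      have "cmod (F (Complex x (e n))) * cmod (k (of_real x)) \<le> B * (C / (1 + x\<^sup>2))"
        using B(1)[of "Complex x (e n)"] e[of n] kb[of "of_real x"] B(2) by (intro mult_mono) (auto simp: cmod_of_real_plus_i_square)
      then show "norm (F (Complex x (e n)) * k (of_real x)) \<le> B * C * (1 / (1 + x\<^sup>2))" by (simp add: norm_mult)
    qed
  qed
  then have "(\<lambda>n. 0) \<longlonglongrightarrow> (LINT x|lebesgue. f x * k (of_real x))" unfolding zero .
  then show ?thesis by (simp add: LIMSEQ_const_iff k_def)
qed

text \<open>Under the orthogonality relations the antiholomorphic half of the Poisson kernel contributes
  nothing, which leaves a Cauchy integral.\<close>

lemma poisson_int_holomorphic_of_orthogonality:
  assumes f: "f \<in> Lp_space \<infinity>"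
    and orth: "\<And>z. 0 < Im z \<Longrightarrow> (LINT x|lebesgue. f x / ((of_real x - cnj z) * (of_real x + \<i>))) = 0"
  shows "poisson_int f holomorphic_on upper_half_plane"
proof -
  have pf: "poisson_integrable f" by (rule Lp_poisson_integrable[OF _ f]) simp
  have fm: "f \<in> borel_measurable lebesgue" by (rule Lp_space_measurable[OF f])
  \<comment> \<open>The division makes the Cauchy integral of a merely bounded function
    converge.\<close>
  define c where "c t = f t / (of_real t + \<i>)" for t
  have cm: "c \<in> borel_measurable lebesgue"
    unfolding c_def[abs_def] using fm of_real_lebesgue_measurable by measurable
  have ci: "integrable lebesgue (\<lambda>t. cmod (c t) / cmod (of_real t + \<i>))"
  proof -
    have "cmod (c t) / cmod (of_real t + \<i>) = norm (f t) / (1 + t\<^sup>2)" for t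
      unfolding cmod_of_real_plus_i_square[symmetric] by (simp add: c_def norm_divide power2_eq_square)
    then show ?thesis using pf by (simp add: poisson_integrable_def)
  qed
  define C where "C z = (LINT t|lebesgue. c t / (of_real t - z))" for z
  have holC: "C holomorphic_on upper_half_plane"
    unfolding C_def by (rule cauchy_transform_holomorphic[OF cm ci])
  have eq: "(z + \<i>) / (2 * pi * \<i>) * C z = poisson_int f z" if z: "z \<in> upper_half_plane" for z
  proof -
    have z0: "0 < Im z" using z by (simp add: upper_half_plane_def)
    have i1: "integrable lebesgue (\<lambda>t. c t / (of_real t - z))" by (rule integrable_cauchy_kernel[OF cm ci z0])
    have kern: "poisson z t *\<^sub>R f t = (z + \<i>) / (2 * pi * \<i>) * (c t / (of_real t - z))
        - (cnj z + \<i>) / (2 * pi * \<i>) * (f t / ((of_real t - cnj z) * (of_real t + \<i>)))" for t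
    proof -
      have nz: "of_real t - z \<noteq> 0" "of_real t - cnj z \<noteq> 0" "of_real t + \<i> \<noteq> 0"
        using of_real_diff_nonzero[OF z0] of_real_diff_cnj_nonzero[OF z0] by (auto simp: complex_eq_iff)
      \<comment> \<open>The Poisson kernel is a difference of two Cauchy kernels. Subtracting
        \<open>1 / (of_real t + \<i>)\<close> from both leaves the difference unchanged and gives
        each part enough decay to be integrated on its own.\<close>
      have 1: "1 / (a - w) - 1 / (a + \<i>) = (w + \<i>) / ((a - w) * (a + \<i>))" if "a - w \<noteq> 0" "a + \<i> \<noteq> 0" for a w :: complex
        using that by (simp add: field_simps)
      have "1 / (of_real t - z) - 1 / (of_real t - cnj z) = (z + \<i>) / ((of_real t - z) * (of_real t + \<i>)) - (cnj z + \<i>) / ((of_real t - cnj z) * (of_real t + \<i>))"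
        by (simp only: 1[OF nz(1,3), symmetric] 1[OF nz(2,3), symmetric]) simp
      moreover have "(a / (p * q) - b / (r * q)) / d * e = a / d * (e / q / p) - b / d * (e / (r * q))"
        for a b d e p q r :: complex
        by (simp add: diff_divide_distrib right_diff_distrib mult_ac)
      ultimately show ?thesis
        unfolding scaleR_conv_of_real poisson_cauchy_kernel[OF z0] c_def by simp
    qed
    have i2: "integrable lebesgue (\<lambda>t. (z + \<i>) / (2 * pi * \<i>) * (c t / (of_real t - z)))" by (rule integrable_mult_right[OF i1])
    have i3: "integrable lebesgue (\<lambda>t. (cnj z + \<i>) / (2 * pi * \<i>) * (f t / ((of_real t - cnj z) * (of_real t + \<i>))))"
    proof -
      have "(cnj z + \<i>) / (2 * pi * \<i>) * (f t / ((of_real t - cnj z) * (of_real t + \<i>)))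
        = (z + \<i>) / (2 * pi * \<i>) * (c t / (of_real t - z)) - poisson z t *\<^sub>R f t" for t
        unfolding kern by simp
      then show ?thesis using Bochner_Integration.integrable_diff[OF i2 integrable_poisson[OF pf z0]] by presburger
    qed
    have "poisson_int f z = (LINT t|lebesgue. (z + \<i>) / (2 * pi * \<i>) * (c t / (of_real t - z)))
        - (LINT t|lebesgue. (cnj z + \<i>) / (2 * pi * \<i>) * (f t / ((of_real t - cnj z) * (of_real t + \<i>))))"
      unfolding poisson_int_def kern by (rule Bochner_Integration.integral_diff[OF i2 i3])
    also have "\<dots> = (z + \<i>) / (2 * pi * \<i>) * C z - (cnj z + \<i>) / (2 * pi * \<i>) * 0"
      by (simp only: integral_mult_right_zero orth[OF z0] C_def)
    finally show ?thesis by simp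
  qed
  have "(\<lambda>z. (z + \<i>) / (2 * pi * \<i>) * C z) holomorphic_on upper_half_plane"
    by (intro holomorphic_intros holC) simp
  then show ?thesis by (rule holomorphic_transform) (rule eq)
qed

text \<open>This joins the two descriptions of the real Hardy space. In exponent infinity
  orthogonality makes the Poisson integral holomorphic; in finite exponents the function in the
  half-plane supplied by the definition has a representing function that equals \<open>f\<close>
  almost everywhere, by uniqueness of nontangential limits.\<close>

lemma Hardy_real_poisson_int:
  assumes p: "1 \<le> p" and f: "f \<in> Hardy_real p"
  obtains F where "F holomorphic_on upper_half_plane" "\<And>z. 0 < Im z \<Longrightarrow> F z = poisson_int f z"
proof (cases "p = \<infinity>")
  case True
  have "poisson_int f holomorphic_on upper_half_plane"
    by (rule poisson_int_holomorphic_of_orthogonality) (use f True in \<open>auto simp: Hardy_real_def upper_half_plane_def\<close>)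
  then show ?thesis using that by blast
next
  case False
  obtain F where F: "F \<in> Hardy p" "AE x in lebesgue. has_nontangential_limit F x (f x)"
    using f False by (auto simp: Hardy_real_def)
  obtain g where g: "g \<in> Lp_space p" "\<forall>z. 0 < Im z \<longrightarrow> F z = poisson_int g z" "AE x in lebesgue. has_nontangential_limit F x (g x)"
    using Hardy_boundary[OF p F(1)] by blast
  have "AE x in lebesgue. g x = f x" using F(2) g(3) by eventually_elim (rule nontangential_limit_unique)
  then have "F z = poisson_int f z" if "0 < Im z" for z
    using g(2) that poisson_int_AE_cong[OF Lp_space_measurable[OF g(1)]] by metis
  then show ?thesis using that Hardy_holomorphic[OF F(1)] by blast
qed

section \<open>Hardy--Sobolev spaces\<close>

lemma higher_deriv_Suc: "(deriv ^^ Suc k) f = (deriv ^^ k) (deriv f)"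
  by (simp only: funpow_Suc_right comp_apply)

text \<open>The weak derivatives of \<open>f\<close> of consecutive orders are linked by first order
  relations, and \<open>deriv_poisson_int\<close> climbs this ladder: each derivative of the
  extension is the Poisson integral of a function in the Lebesgue space and so belongs to the Hardy
  space.\<close>

lemma Hardy_Sobolev_real_lift:
  assumes p: "1 \<le> p" and f: "f \<in> Hardy_Sobolev_real n p"
  obtains F where "F \<in> Hardy_Sobolev n p" "\<And>z. 0 < Im z \<Longrightarrow> F z = poisson_int f z"
proof -
  have fH: "f \<in> Hardy_real p" and fS: "f \<in> Sobolev n p" using f by (auto simp: Hardy_Sobolev_real_def)
  have fL: "f \<in> Lp_space p" using fS by (simp add: Sobolev_def)
  obtain F where F: "F holomorphic_on upper_half_plane" "\<And>z. 0 < Im z \<Longrightarrow> F z = poisson_int f z"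
    using Hardy_real_poisson_int[OF p fH] by blast
  have "\<exists>g\<in>Lp_space p. has_weak_deriv k f g" if "k \<in> {1..n}" for k using fS that by (simp add: Sobolev_def)
  then obtain g0 where g0: "\<And>k. k \<in> {1..n} \<Longrightarrow> g0 k \<in> Lp_space p \<and> has_weak_deriv k f (g0 k)" by metis
  \<comment> \<open>\<open>Sobolev\<close> supplies weak derivatives from order 1 on; order 0 is
    filled in by \<open>f\<close> itself.\<close>
  define g where "g k = (if k = 0 then f else g0 k)" for k
  have gL: "g k \<in> Lp_space p" if "k \<le> n" for k using g0[of k] fL that by (auto simp: g_def)
  have gp: "poisson_integrable (g k)" if "k \<le> n" for k by (rule Lp_poisson_integrable[OF p gL[OF that]])
  have gw: "(LINT x|lebesgue. f x * of_real ((deriv ^^ k) \<phi> x)) = (-1) ^ k * (LINT x|lebesgue. g k x * of_real (\<phi> x))"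
    if "k \<le> n" "test_function \<phi>" for k \<phi>
  proof (cases "k = 0")
    case False
    then have "has_weak_deriv k f (g k)" using g0[of k] that by (simp add: g_def)
    then show ?thesis using that(2) by (simp add: has_weak_deriv_def)
  qed (simp add: g_def)
  \<comment> \<open>The relation of order \<open>k\<close> is tested with
    \<open>deriv \<phi>\<close> and compared with that of order \<open>Suc k\<close>; the common
    sign cancels.\<close>
  have step: "(LINT x|lebesgue. g k x * of_real (deriv \<phi> x)) = - (LINT x|lebesgue. g (Suc k) x * of_real (\<phi> x))"
    if "Suc k \<le> n" "test_function \<phi>" for k \<phi>
  proof -
    have "(-1) ^ k * (LINT x|lebesgue. g k x * of_real (deriv \<phi> x)) = (LINT x|lebesgue. f x * of_real ((deriv ^^ k) (deriv \<phi>) x))"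
      by (rule gw[symmetric]) (use that test_function_deriv in auto)
    also have "\<dots> = (-1) ^ Suc k * (LINT x|lebesgue. g (Suc k) x * of_real (\<phi> x))"
      unfolding higher_deriv_Suc[symmetric] by (rule gw[OF that])
    also have "\<dots> = (-1) ^ k * (- (LINT x|lebesgue. g (Suc k) x * of_real (\<phi> x)))" by simp
    finally show ?thesis by (subst (asm) mult_cancel_left) simp
  qed
  have holk: "(deriv ^^ k) F holomorphic_on upper_half_plane" for k
    by (rule holomorphic_higher_deriv[OF F(1) open_upper_half_plane])
  have rep: "k \<le> n \<Longrightarrow> 0 < Im z \<Longrightarrow> (deriv ^^ k) F z = poisson_int (g k) z" for k z
  proof (induction k arbitrary: z)
    case 0
    then show ?case using F(2) by (simp add: g_def)
  next
    case (Suc k)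
    have "deriv ((deriv ^^ k) F) z = poisson_int (g (Suc k)) z"
      by (rule deriv_poisson_int[OF holk gp gp Suc.IH Suc.prems(2) step]) (use Suc.prems in auto)
    then show ?case by simp
  qed
  have "(deriv ^^ k) F \<in> Hardy p" if "k \<le> n" for k
    by (rule Hardy_of_Lp_poisson_int(1)[OF p gL[OF that] holk rep[OF that]])
  then have "F \<in> Hardy_Sobolev n p" using F(1) by (simp add: Hardy_Sobolev_def)
  then show ?thesis using that F(2) by blast
qed

lemma Hardy_Sobolev_boundary:
  assumes p: "1 \<le> p" and F: "F \<in> Hardy_Sobolev n p"
  shows "AE x in lebesgue. \<exists>L. has_nontangential_limit F x L"
    and "boundary_value F \<in> Hardy_Sobolev_real n p"
    and "Sobolev_norm n p (boundary_value F) = Hardy_Sobolev_norm n p F"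
proof -
  have Fk: "(deriv ^^ k) F \<in> Hardy p" if "k \<le> n" for k using F that by (simp add: Hardy_Sobolev_def)
  have F0: "F \<in> Hardy p" using Fk[of 0] by simp
  have "\<exists>f. f \<in> Lp_space p \<and> Lp_norm p f = Hardy_norm p ((deriv ^^ k) F) \<and>
    (\<forall>z. 0 < Im z \<longrightarrow> (deriv ^^ k) F z = poisson_int f z) \<and>
    (AE x in lebesgue. has_nontangential_limit ((deriv ^^ k) F) x (f x))" if "k \<le> n" for k
    using Hardy_boundary[OF p Fk[OF that]] by blast
  then obtain f where f: "\<And>k. k \<le> n \<Longrightarrow> f k \<in> Lp_space p \<and> Lp_norm p (f k) = Hardy_norm p ((deriv ^^ k) F) \<and>
    (\<forall>z. 0 < Im z \<longrightarrow> (deriv ^^ k) F z = poisson_int (f k) z) \<and>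
    (AE x in lebesgue. has_nontangential_limit ((deriv ^^ k) F) x (f k x))" by metis
  have fL: "f k \<in> Lp_space p" and fN: "Lp_norm p (f k) = Hardy_norm p ((deriv ^^ k) F)"
    and fP: "\<And>z. 0 < Im z \<Longrightarrow> (deriv ^^ k) F z = poisson_int (f k) z" if "k \<le> n" for k
    using f[OF that] by auto
  have fm: "f k \<in> borel_measurable lebesgue" if "k \<le> n" for k by (rule Lp_space_measurable[OF fL[OF that]])
  have fp: "poisson_integrable (f k)" if "k \<le> n" for k by (rule Lp_poisson_integrable[OF p fL[OF that]])
  have nt: "AE x in lebesgue. has_nontangential_limit F x (f 0 x)" using f[of 0] by simp
  then show "AE x in lebesgue. \<exists>L. has_nontangential_limit F x L" by eventually_elim blast
  define b where "b = boundary_value F"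
  have bf: "AE x in lebesgue. f 0 x = b x"
    using nt unfolding b_def by eventually_elim (simp add: boundary_value_eq)
  have ntb: "AE x in lebesgue. has_nontangential_limit F x (b x)" using nt bf by eventually_elim simp
  note cong = Lp_AE_cong[OF fm[of 0] bf, simplified]
  have bL: "b \<in> Lp_space p" using cong(3)[of p] fL[of 0] by simp
  have step: "(LINT x|lebesgue. f k x * of_real (deriv \<phi> x)) = - (LINT x|lebesgue. f (Suc k) x * of_real (\<phi> x))"
    if "Suc k \<le> n" "test_function \<phi>" for k \<phi>
  proof (rule weak_deriv_of_boundary_values[OF _ _ _ _ _ that(2)])
    show "(deriv ^^ k) F holomorphic_on upper_half_plane"
      using Hardy_holomorphic[OF Fk[of k]] that by simp
    show "deriv ((deriv ^^ k) F) z = poisson_int (f (Suc k)) z" if "0 < Im z" for z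
      using fP[OF \<open>Suc k \<le> n\<close> that] by simp
  qed (use fp fP that in auto)
  have weak: "k \<le> n \<Longrightarrow> test_function \<phi> \<Longrightarrow>
    (LINT x|lebesgue. f 0 x * of_real ((deriv ^^ k) \<phi> x)) = (-1) ^ k * (LINT x|lebesgue. f k x * of_real (\<phi> x))" for k \<phi>
  proof (induction k arbitrary: \<phi>)
    case (Suc k)
    have "(LINT x|lebesgue. f 0 x * of_real ((deriv ^^ Suc k) \<phi> x)) = (-1) ^ k * (LINT x|lebesgue. f k x * of_real (deriv \<phi> x))"
      unfolding higher_deriv_Suc by (rule Suc.IH) (use Suc.prems test_function_deriv in auto)
    then show ?case using step[OF Suc.prems] by simp
  qed simp
  have wd: "has_weak_deriv k b (f k)" if k: "k \<le> n" for k
  proof (rule has_weak_deriv_AE_cong[OF _ fm[of 0] bf])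
    show "has_weak_deriv k (f 0) (f k)"
      unfolding has_weak_deriv_def using weak[OF k] poisson_integrable_locally_integrable[OF fp] k by simp
  qed simp
  have bS: "b \<in> Sobolev n p" unfolding Sobolev_def
  proof (intro CollectI conjI ballI bL)
    fix k assume "k \<in> {1..n}"
    then show "\<exists>g\<in>Lp_space p. has_weak_deriv k b g" by (intro bexI[of _ "f k"] wd fL) auto
  qed
  have bH: "b \<in> Hardy_real p"
  proof (cases "p = \<infinity>")
    case True
    have "(LINT x|lebesgue. b x / ((of_real x - cnj z) * (of_real x + \<i>))) = 0" if "z \<in> upper_half_plane" for z
      by (rule Hardy_infinity_orthogonality[of F]) (use F0 ntb bL True that in \<open>auto simp: upper_half_plane_def\<close>)
    then show ?thesis using bL True by (simp add: Hardy_real_def)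
  next
    case False
    then show ?thesis using bL F0 ntb by (auto simp: Hardy_real_def)
  qed
  show "boundary_value F \<in> Hardy_Sobolev_real n p"
    using bS bH by (simp add: Hardy_Sobolev_real_def b_def)
  \<comment> \<open>\<open>weak_deriv\<close> is an arbitrary choice; uniqueness up to null sets
    identifies it with the boundary function \<open>f k\<close>, whose norm is known.\<close>
  have norm: "Lp_norm p (weak_deriv k b) = Hardy_norm p ((deriv ^^ k) F)" if k: "k \<le> n" for k
  proof (cases "k = 0")
    case True
    then show ?thesis using cong(2)[of p] fN[of 0] by (simp add: weak_deriv_def)
  next
    case False
    have "has_weak_deriv k b (weak_deriv k b)"
      using someI[of "has_weak_deriv k b", OF wd[OF k]] False by (simp add: weak_deriv_def)
    from has_weak_deriv_unique[OF wd[OF k] this] have "AE x in lebesgue. f k x = weak_deriv k b x" .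
    then show ?thesis using Lp_AE_cong(2)[OF fm[OF k]] fN[OF k] by simp
  qed
  show "Sobolev_norm n p (boundary_value F) = Hardy_Sobolev_norm n p F"
    unfolding Sobolev_norm_def Hardy_Sobolev_norm_def b_def[symmetric] combined_norm_def
    using norm by (auto intro!: sum.cong arg_cong[where f = "\<lambda>s. s powr (1 / enn2real p)"])
qed

theorem theorem3p1:
  fixes p :: ennreal and n :: nat
  assumes "1 \<le> p"
  shows
    "(\<forall>F\<in>Hardy_Sobolev n p.
        (AE x in lebesgue. \<exists>L. has_nontangential_limit F x L) \<and>
        boundary_value F \<in> Hardy_Sobolev_real n p \<and>
        Sobolev_norm n p (boundary_value F) = Hardy_Sobolev_norm n p F) \<and>
     (\<forall>F\<in>Hardy_Sobolev n p. \<forall>G\<in>Hardy_Sobolev n p. \<forall>a b :: complex.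
        AE x in lebesgue. boundary_value (\<lambda>z. a * F z + b * G z) x =
                          a * boundary_value F x + b * boundary_value G x) \<and>
     (\<forall>F\<in>Hardy_Sobolev n p. \<forall>G\<in>Hardy_Sobolev n p.
        (AE x in lebesgue. boundary_value F x = boundary_value G x) \<longrightarrow>
        (\<forall>z\<in>upper_half_plane. F z = G z)) \<and>
     (\<forall>f\<in>Hardy_Sobolev_real n p. \<exists>F\<in>Hardy_Sobolev n p.
        AE x in lebesgue. boundary_value F x = f x)"
proof (intro conjI ballI allI impI)
  \<comment> \<open>Representing function and boundary values in one statement, from which linearity
    and injectivity are read off.\<close>
  have bv: "\<exists>f\<in>Lp_space p. (\<forall>z. 0 < Im z \<longrightarrow> F z = poisson_int f z) \<and>
      (AE x in lebesgue. has_nontangential_limit F x (f x)) \<and> (AE x in lebesgue. boundary_value F x = f x)"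
    if "F \<in> Hardy_Sobolev n p" for F
  proof -
    have "F \<in> Hardy p" using that by (auto simp: Hardy_Sobolev_def dest: spec[of _ 0])
    then obtain f where f: "f \<in> Lp_space p" "\<forall>z. 0 < Im z \<longrightarrow> F z = poisson_int f z"
      "AE x in lebesgue. has_nontangential_limit F x (f x)"
      using Hardy_boundary[OF assms] by blast
    have "AE x in lebesgue. boundary_value F x = f x" using f(3) by eventually_elim (rule boundary_value_eq)
    then show ?thesis using f by blast
  qed
  fix F assume F: "F \<in> Hardy_Sobolev n p"
  show "AE x in lebesgue. \<exists>L. has_nontangential_limit F x L"
    "boundary_value F \<in> Hardy_Sobolev_real n p"
    "Sobolev_norm n p (boundary_value F) = Hardy_Sobolev_norm n p F"
    by (rule Hardy_Sobolev_boundary[OF assms F])+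
  obtain f where f: "f \<in> Lp_space p" "\<forall>z. 0 < Im z \<longrightarrow> F z = poisson_int f z"
    "AE x in lebesgue. has_nontangential_limit F x (f x)" "AE x in lebesgue. boundary_value F x = f x"
    using bv[OF F] by blast
  fix G assume G: "G \<in> Hardy_Sobolev n p"
  obtain g where g: "g \<in> Lp_space p" "\<forall>z. 0 < Im z \<longrightarrow> G z = poisson_int g z"
    "AE x in lebesgue. has_nontangential_limit G x (g x)" "AE x in lebesgue. boundary_value G x = g x"
    using bv[OF G] by blast
  show "AE x in lebesgue. boundary_value (\<lambda>z. a * F z + b * G z) x = a * boundary_value F x + b * boundary_value G x" for a b
    using f(3) g(3)
    by eventually_elim (simp add: boundary_value_eq has_nontangential_limit_linear)
  assume eq: "AE x in lebesgue. boundary_value F x = boundary_value G x"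
  \<comment> \<open>Equal boundary values give equal representing functions up to null sets, hence
    equal Poisson integrals.\<close>
  have "AE x in lebesgue. f x = g x" using eq f(4) g(4) by eventually_elim simp
  then have "poisson_int f z = poisson_int g z" for z by (rule poisson_int_AE_cong[OF Lp_space_measurable[OF f(1)]])
  then show "F z = G z" if "z \<in> upper_half_plane" for z
    using f(2) g(2) that by (simp add: upper_half_plane_def)
next
  fix f assume f: "f \<in> Hardy_Sobolev_real n p"
  have fL: "f \<in> Lp_space p" using f by (simp add: Hardy_Sobolev_real_def Sobolev_def)
  obtain F where F: "F \<in> Hardy_Sobolev n p" "\<And>z. 0 < Im z \<Longrightarrow> F z = poisson_int f z"
    using Hardy_Sobolev_real_lift[OF assms f] by blast
  have "F \<in> Hardy p" using F(1) by (auto simp: Hardy_Sobolev_def dest: spec[of _ 0])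
  then obtain g where g: "g \<in> Lp_space p" "\<forall>z. 0 < Im z \<longrightarrow> F z = poisson_int g z"
    "AE x in lebesgue. has_nontangential_limit F x (g x)"
    using Hardy_boundary[OF assms] by blast
  \<comment> \<open>Both \<open>f\<close> and the boundary function \<open>g\<close> have
    \<open>F\<close> as their Poisson integral, which determines a function up to null sets.\<close>
  have "AE x in lebesgue. g x = f x"
    by (rule poisson_int_inj[OF Lp_poisson_integrable[OF assms g(1)] Lp_poisson_integrable[OF assms fL]])
       (use g(2) F(2) in metis)
  then have "AE x in lebesgue. boundary_value F x = f x"
    using g(3) by eventually_elim (simp add: boundary_value_eq)
  then show "\<exists>F\<in>Hardy_Sobolev n p. AE x in lebesgue. boundary_value F x = f x" using F(1) by blast
qed

end
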